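(* Let $p\ge1$, let $K$ be a symmetric convex body in $\mathbb{R}^n$, and let $L$ be either a symmetric convex body in $\mathbb{R}^n$ or an origin-symmetric line segment in $\mathbb{R}^n$. The function $$\mathbb{R}\ni t\mapsto\big|(K^{\circ}+_p e^t\cdot L)^{\circ}\big|$$ is log-concave in each of the following cases: (i) $p=2$ and $L=B_2^n$; (ii) $L$ is an origin-symmetric line segment; (iii) $K$ and $L$ are unconditional with respect to the same orthonormal basis; (iv) $K$ and $L$ are planar, i.e. $n=2$.
   Context: A convex body in $\mathbb{R}^n$ is a compact convex set with non-empty interior; it is symmetric if $K=-K$. $|\cdot|$ is Lebesgue measure, $B_2^n$ the Euclidean unit ball. The support function of a compact convex set is $h_K(x)=\max_{y\in K}x\cdot y$; the polar body is $K^{\circ}=\{x: x\cdot y\le 1\ \forall y\in K\}$. For $p\ge1$ and $b>0$, $K+_p b\cdot L$ is the convex body with support function $(h_K^p+b h_L^p)^{1/p}$. A set is unconditional with respect to an orthonormal basis if it is invariant under reflections in the coordinate hyperplanes of that basis. A non-negative function is log-concave if its logarithm (with values in $[-\infty,\infty)$) is concave. *)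

theory Defs
  imports "HOL-Analysis.Analysis"
begin

definition convex_body :: "'a::euclidean_space set \<Rightarrow> bool" where
  "convex_body K \<longleftrightarrow> compact K \<and> convex K \<and> interior K \<noteq> {}"

definition origin_symmetric :: "'a::real_vector set \<Rightarrow> bool" where
  "origin_symmetric K \<longleftrightarrow> uminus ` K = K"

text \<open>A degenerate segment (\<open>v = 0\<close>) is allowed.\<close>

definition symmetric_segment :: "'a::real_vector set \<Rightarrow> bool" where
  "symmetric_segment L \<longleftrightarrow> (\<exists>v. L = closed_segment (- v) v)"

text \<open>For compact non-empty \<open>K\<close>, the only case of interest, the supremum is a maximum.\<close>

definition support_fun :: "'a::real_inner set \<Rightarrow> 'a \<Rightarrow> real" where
  "support_fun K x = (SUP y\<in>K. x \<bullet> y)"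

definition polar_body :: "'a::real_inner set \<Rightarrow> 'a set" where
  "polar_body K = {x. \<forall>y\<in>K. x \<bullet> y \<le> 1}"

text \<open>
  \<open>Lp_sum p K b L\<close> is \<open>K +\<^sub>p b \<cdot> L\<close>. A convex body is determined by its support function,
  and for \<open>p \<ge> 1\<close>, \<open>b > 0\<close>, \<open>K\<close> a convex body and \<open>L\<close> compact and convex, both containing
  the origin, a body with the prescribed support function exists; only then is the
  description meaningful.
\<close>

definition Lp_sum :: "real \<Rightarrow> 'a::euclidean_space set \<Rightarrow> real \<Rightarrow> 'a set \<Rightarrow> 'a set" where
  "Lp_sum p K b L = (THE M. convex_body M \<and>
     (\<forall>x. support_fun M x = (support_fun K x powr p + b * support_fun L x powr p) powr (1 / p)))"

definition orthonormal_basis :: "'a::euclidean_space set \<Rightarrow> bool" where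
  "orthonormal_basis B \<longleftrightarrow> pairwise orthogonal B \<and> (\<forall>u\<in>B. norm u = 1) \<and> span B = UNIV"

text \<open>For a unit vector \<open>u\<close>, \<open>x \<mapsto> x - 2 (x \<bullet> u) u\<close> is the reflection in the hyperplane
  orthogonal to \<open>u\<close>.\<close>

definition unconditional :: "'a::euclidean_space set \<Rightarrow> 'a set \<Rightarrow> bool" where
  "unconditional B K \<longleftrightarrow> (\<forall>u\<in>B. (\<lambda>x. x - (2 * (x \<bullet> u)) *\<^sub>R u) ` K = K)"

definition ext_ln :: "real \<Rightarrow> ereal" where
  "ext_ln r = (if r = 0 then - \<infinity> else ereal (ln r))"

definition log_concave_fun :: "('a::real_vector \<Rightarrow> real) \<Rightarrow> bool" where
  "log_concave_fun f \<longleftrightarrow> (\<forall>x. 0 \<le> f x) \<and>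
     (\<forall>x y. \<forall>s\<in>{0<..<1}.
        ereal (1 - s) * ext_ln (f x) + ereal s * ext_ln (f y)
          \<le> ext_ln (f ((1 - s) *\<^sub>R x + s *\<^sub>R y)))"

end

theory Submission
  imports Defs
begin

text \<open>
  The polar of \<open>K\<^sup>\<circ> +\<^sub>p e\<^sup>t \<cdot> L\<close> is \<open>{x. a x powr p + exp t * b x powr p \<le> 1}\<close>, where \<open>a\<close> and \<open>b\<close> are the
  support functions of \<open>K\<^sup>\<circ>\<close> and \<open>L\<close>. Its volume is continuous in \<open>t\<close>, so midpoint log-concavity
  suffices, and up to a constant it equals the integral of \<open>exp (- a\<^sup>p - e\<^sup>t b\<^sup>p)\<close>. The main tool
  is the Prekopa--Leindler inequality, additive and multiplicative.

  Unconditional bodies: the gauge of the coordinatewise geometric mean is at most the geometric mean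
  of the gauges, so the multiplicative inequality applies on the positive orthant.
  Segments: the integral of \<open>exp (- a\<^sup>p)\<close> over the hyperplanes orthogonal to the segment is an even
  log-concave, hence decreasing, function of the distance, which reduces the claim to one variable.
  Euclidean ball: for \<open>I c = \<integral> exp (- a\<^sup>2 - c |x|\<^sup>2) dx\<close>, the substitution \<open>x = u + v\<close>, \<open>y = u - v\<close> in
  \<open>I \<alpha> * I \<beta>\<close> and completing the square bound this product by the one for two weights with the same
  product but a ratio closer to \<open>1\<close>; iterating gives \<open>(I (sqrt (\<alpha> * \<beta>)))\<^sup>2\<close>.
  Planar bodies: by a layer-cake argument it is enough that the area of \<open>{a \<le> 1, b \<le> e\<^sup>t}\<close> is
  log-concave. The proportion of that area lying in the cone \<open>b \<le> e\<^sup>t a\<close> determines its logarithmic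
  derivative, and it is nondecreasing because the cone gains area at a rate controlled by the tangents
  to the two unit circles at the points where the boundary of the cone meets them.
\<close>

section \<open>The Prekopa--Leindler inequality, midpoint form\<close>

text \<open>The parameter enters as the weight \<open>exp t\<close> on the second norm, so the
  midpoint of \<open>s\<close> and \<open>t\<close> corresponds to the geometric mean of two
  weights. Convexity of the norms speaks of arithmetic means of points, and these do not match:
  \<open>sqrt (\<alpha> * \<beta>) * b ((1/2) *\<^sub>R (x + y)) powr p\<close> can exceed the
  average of \<open>\<alpha> * b x powr p\<close> and \<open>\<beta> * b y powr p\<close>. Geometric
  means of points match the weights exactly, but they make sense only in coordinates in which the
  norms are monotone. Each of the four cases is another way round this obstacle: coordinates common
  to both bodies; a decreasing marginal, which tolerates the passage from the arithmetic to the
  geometric mean; a rotation in the doubled space; and, in the plane, geometric means of the levels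
  of \<open>a\<close> and \<open>b\<close> instead of points, at the price of a separate first-order
  argument for areas. The exponential is preferred to the indicator of the ball where
  \<open>a\<close> and \<open>b\<close> have to be separated, since it is a product of a function of
  \<open>a\<close> and a function of \<open>b\<close>.\<close>

text \<open>Only midpoints occur, with the square root moved to the right-hand side, since there is no
  \<open>powr\<close> on \<open>ennreal\<close>. The set \<open>P\<close> is the domain of the mean \<open>m\<close>.\<close>

definition prekopa_leindler :: "'a measure \<Rightarrow> 'a set \<Rightarrow> ('a \<Rightarrow> 'a \<Rightarrow> 'a) \<Rightarrow> bool" where
  "prekopa_leindler M P m \<longleftrightarrow>
     (\<forall>f g h :: 'a \<Rightarrow> ennreal.
        f \<in> borel_measurable M \<longrightarrow> g \<in> borel_measurable M \<longrightarrow> h \<in> borel_measurable M \<longrightarrow>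
        (\<forall>x\<in>space M - P. f x = 0 \<and> g x = 0) \<longrightarrow>
        (\<forall>x\<in>P. \<forall>y\<in>P. f x * g y \<le> (h (m x y))\<^sup>2) \<longrightarrow>
        (\<integral>\<^sup>+x. f x \<partial>M) * (\<integral>\<^sup>+x. g x \<partial>M) \<le> (\<integral>\<^sup>+x. h x \<partial>M)\<^sup>2)"

lemma prekopa_leindlerD:
  assumes "prekopa_leindler M P m"
    and "f \<in> borel_measurable M" "g \<in> borel_measurable M" "h \<in> borel_measurable M"
    and "\<And>x. x \<in> space M \<Longrightarrow> x \<notin> P \<Longrightarrow> f x = 0" "\<And>x. x \<in> space M \<Longrightarrow> x \<notin> P \<Longrightarrow> g x = 0"
    and "\<And>x y. x \<in> P \<Longrightarrow> y \<in> P \<Longrightarrow> f x * g y \<le> (h (m x y))\<^sup>2"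
  shows "(\<integral>\<^sup>+x. f x \<partial>M) * (\<integral>\<^sup>+x. g x \<partial>M) \<le> (\<integral>\<^sup>+x. h x \<partial>M)\<^sup>2"
  using assms unfolding prekopa_leindler_def by blast

section \<open>The Brunn-Minkowski inequality on the line\<close>

lemma emeasure_real_double:
  fixes A :: "real set"
  assumes "A \<in> sets borel"
  shows "emeasure lborel A = 2 * emeasure lborel {z. 2 * z - b \<in> A}"
proof -
  have [measurable]: "A \<in> sets borel" by fact
  have "emeasure lborel A = (\<integral>\<^sup>+x. indicator A x \<partial>lborel)" by simp
  also have "\<dots> = ennreal \<bar>2\<bar> * (\<integral>\<^sup>+x. indicator A (- b + 2 * x) \<partial>lborel)"
    by (rule nn_integral_real_affine) auto
  also have "(\<integral>\<^sup>+x. indicator A (- b + 2 * x) \<partial>lborel) = (\<integral>\<^sup>+x. indicator {z. 2 * z - b \<in> A} x \<partial>lborel)"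
    by (intro nn_integral_cong) (auto simp: indicator_def)
  also have "\<dots> = emeasure lborel {z. 2 * z - b \<in> A}"
    by (rule nn_integral_indicator) measurable
  finally show ?thesis by simp
qed

text \<open>For fixed \<open>a\<close> and \<open>b\<close> the half-sums \<open>(A + b) / 2\<close>
  and \<open>(a + B) / 2\<close> lie in \<open>C\<close> and have half the measures of
  \<open>A\<close> and \<open>B\<close>. With \<open>a\<close> close to the supremum of
  \<open>A\<close> and \<open>b\<close> close to the infimum of \<open>B\<close> the first copy ends
  about where the second begins, so they overlap in a short interval at most.\<close>

lemma brunn_minkowski_real_bounded:
  fixes A B C :: "real set"
  assumes [measurable]: "A \<in> sets borel" "B \<in> sets borel" "C \<in> sets borel"
    and ne: "A \<noteq> {}" "B \<noteq> {}" and bd: "bdd_above A" "bdd_below B"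
    and sub: "\<And>a b. a \<in> A \<Longrightarrow> b \<in> B \<Longrightarrow> (a + b) / 2 \<in> C"
  shows "emeasure lborel A + emeasure lborel B \<le> 2 * emeasure lborel C"
proof (rule ennreal_le_epsilon)
  fix e :: real assume e: "0 < e"
  have "\<exists>a\<in>A. Sup A - e/2 < a" using less_cSupD[of A "Sup A - e/2"] ne e by auto
  then obtain a where a: "a \<in> A" "Sup A - e/2 < a" by blast
  have "\<exists>b\<in>B. b < Inf B + e/2" using cInf_lessD[of B "Inf B + e/2"] ne e by auto
  then obtain b where b: "b \<in> B" "b < Inf B + e/2" by blast
  define S T where "S = {z. 2 * z - b \<in> A}" and "T = {z. 2 * z - a \<in> B}"
  have [measurable]: "S \<in> sets borel" "T \<in> sets borel" unfolding S_def T_def by measurable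
  have "S \<union> T \<subseteq> C"
  proof
    fix z assume "z \<in> S \<union> T"
    then show "z \<in> C"
      using sub[of "2 * z - b" b] sub[of a "2 * z - a"] a b by (auto simp: S_def T_def)
  qed
  then have U: "emeasure lborel (S \<union> T) \<le> emeasure lborel C" by (intro emeasure_mono) auto
  have "S \<inter> T \<subseteq> {(a + b - e/2)/2..(a + b + e/2)/2}"
  proof
    fix z assume "z \<in> S \<inter> T"
    then have "2 * z - b \<le> Sup A" "Inf B \<le> 2 * z - a"
      using bd by (auto simp: S_def T_def intro: cSup_upper cInf_lower)
    then show "z \<in> {(a + b - e/2)/2..(a + b + e/2)/2}" using a b by auto
  qed
  then have "emeasure lborel (S \<inter> T) \<le> emeasure lborel {(a + b - e/2)/2..(a + b + e/2)/2}"
    by (intro emeasure_mono) auto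
  also have "\<dots> = ennreal (e/2)" using e by (simp add: field_simps)
  finally have I: "emeasure lborel (S \<inter> T) \<le> ennreal (e/2)" .
  have "emeasure lborel A + emeasure lborel B = 2 * (emeasure lborel S + emeasure lborel T)"
    using emeasure_real_double[of A b] emeasure_real_double[of B a] by (simp add: S_def T_def distrib_left)
  also have "emeasure lborel S + emeasure lborel T = emeasure lborel (S \<union> T) + emeasure lborel (S \<inter> T)"
    by (rule emeasure_Un_Int) auto
  also have "2 * \<dots> \<le> 2 * (emeasure lborel C + ennreal (e/2))"
    using U I by (intro mult_left_mono add_mono) auto
  also have "\<dots> = 2 * emeasure lborel C + ennreal e"
  proof -
    have "2 * ennreal (e/2) = ennreal e" using e
      by (metis ennreal_mult' ennreal_numeral less_eq_real_def nonzero_mult_div_cancel_left times_divide_eq_right zero_le_numeral zero_neq_numeral)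
    then show ?thesis by (simp add: distrib_left)
  qed
  finally show "emeasure lborel A + emeasure lborel B \<le> 2 * emeasure lborel C + ennreal e" .
qed

lemma brunn_minkowski_real:
  fixes A B C :: "real set"
  assumes [measurable]: "A \<in> sets borel" "B \<in> sets borel" "C \<in> sets borel"
    and ne: "A \<noteq> {}" "B \<noteq> {}"
    and sub: "\<And>a b. a \<in> A \<Longrightarrow> b \<in> B \<Longrightarrow> (a + b) / 2 \<in> C"
  shows "emeasure lborel A + emeasure lborel B \<le> 2 * emeasure lborel C"
proof -
  let ?I = "\<lambda>n. {- real n..real n}"
  have lim: "(\<lambda>n. emeasure lborel (D \<inter> ?I n)) \<longlonglongrightarrow> emeasure lborel D" if [measurable]: "D \<in> sets borel" for D
  proof -
    have "(\<lambda>n. emeasure lborel (D \<inter> ?I n)) \<longlonglongrightarrow> emeasure lborel (\<Union>n. D \<inter> ?I n)"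
      by (intro Lim_emeasure_incseq) (auto simp: incseq_def)
    also have "(\<Union>n. D \<inter> ?I n) = D"
    proof -
      have "\<exists>n. x \<in> ?I n" for x :: real
      proof -
        obtain n where "\<bar>x\<bar> \<le> real n" using real_arch_simple by blast
        then show ?thesis by (intro exI[of _ n]) auto
      qed
      then show ?thesis by blast
    qed
    finally show ?thesis .
  qed
  obtain a b where ab: "a \<in> A" "b \<in> B" using ne by blast
  obtain N where N: "max \<bar>a\<bar> \<bar>b\<bar> \<le> real N" using real_arch_simple by blast
  have "emeasure lborel (A \<inter> ?I n) + emeasure lborel (B \<inter> ?I n) \<le> 2 * emeasure lborel C" if "n \<ge> N" for n
  proof (rule brunn_minkowski_real_bounded)
    have "max \<bar>a\<bar> \<bar>b\<bar> \<le> real n" using N that by linarith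
    then have "a \<in> A \<inter> ?I n" "b \<in> B \<inter> ?I n" using ab by auto
    then show "A \<inter> ?I n \<noteq> {}" "B \<inter> ?I n \<noteq> {}" by auto
  qed (auto intro: sub bdd_aboveI2 simp: bdd_above_def bdd_below_def)
  then show ?thesis
    by (intro LIMSEQ_le_const2[OF tendsto_add[OF lim lim]]) (auto intro!: exI[of _ N])
qed

section \<open>From level sets to functions on the line\<close>

lemma nn_integral_layer_cake:
  assumes "sigma_finite_measure M" and [measurable]: "f \<in> borel_measurable M"
  shows "(\<integral>\<^sup>+x. f x \<partial>M)
    = (\<integral>\<^sup>+l. emeasure M {x \<in> space M. ennreal l < f x} * indicator {0..} l \<partial>lborel)"
proof -
  interpret M: sigma_finite_measure M by fact
  interpret pair_sigma_finite M lborel by standard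
  have 1: "f x = (\<integral>\<^sup>+l. indicator {l. ennreal l < f x} l * indicator {0..} l \<partial>lborel)" for x
  proof -
    have "(\<integral>\<^sup>+l. indicator {l. ennreal l < f x} l * indicator {0..} l \<partial>lborel)
      = (\<integral>\<^sup>+l. indicator {l. ennreal l < f x \<and> 0 \<le> l} l \<partial>lborel)"
      by (intro nn_integral_cong) (auto simp: indicator_def)
    also have "\<dots> = emeasure lborel {l. ennreal l < f x \<and> 0 \<le> l}"
      by (rule nn_integral_indicator) measurable
    also have "\<dots> = f x"
    proof (cases "f x")
      case (real r)
      then have "{l. ennreal l < f x \<and> 0 \<le> l} = {0..<r}" by (auto simp: ennreal_less_iff)
      then show ?thesis using real by simp
    next
      case top
      then have "{l. ennreal l < f x \<and> 0 \<le> l} = {0..}" by auto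
      moreover have "emeasure lborel {0::real..} = \<infinity>"
      proof -
        have "ennreal (real n) \<le> emeasure lborel {0::real..}" for n
        proof -
          have "emeasure lborel {0..real n} \<le> emeasure lborel {0::real..}" by (intro emeasure_mono) auto
          then show ?thesis by simp
        qed
        then show ?thesis by (metis ennreal_Ex_less_of_nat ennreal_of_nat_eq_real_of_nat infinity_ennreal_def leD top.not_eq_extremum)
      qed
      ultimately show ?thesis using top by simp
    qed
    finally show ?thesis by simp
  qed
  have "(\<integral>\<^sup>+x. f x \<partial>M) = (\<integral>\<^sup>+x. (\<integral>\<^sup>+l. indicator {l. ennreal l < f x} l * indicator {0..} l \<partial>lborel) \<partial>M)"
    by (intro nn_integral_cong) (rule 1)
  also have "\<dots> = (\<integral>\<^sup>+l. (\<integral>\<^sup>+x. indicator {l. ennreal l < f x} l * indicator {0..} l \<partial>M) \<partial>lborel)"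
    by (rule Fubini'[symmetric]) measurable
  also have "\<dots> = (\<integral>\<^sup>+l. emeasure M {x \<in> space M. ennreal l < f x} * indicator {0..} l \<partial>lborel)"
  proof (rule nn_integral_cong)
    fix l :: real
    have "(\<integral>\<^sup>+x. indicator {l. ennreal l < f x} l * indicator {0..} l \<partial>M)
      = (\<integral>\<^sup>+x. indicator {x \<in> space M. ennreal l < f x} x \<partial>M) * indicator {0..} l"
      by (subst nn_integral_multc[symmetric]) (auto intro!: nn_integral_cong simp: indicator_def)
    then show "(\<integral>\<^sup>+x. indicator {l. ennreal l < f x} l * indicator {0..} l \<partial>M)
      = emeasure M {x \<in> space M. ennreal l < f x} * indicator {0..} l"
      by simp
  qed
  finally show ?thesis .
qed

lemma ennreal_four_mult_le: "4 * (a * b) \<le> (a + b)\<^sup>2" for a b :: ennreal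
proof (cases "a = top \<or> b = top")
  case True
  then show ?thesis by (auto simp: power2_eq_square)
next
  case False
  then obtain r s where *: "a = ennreal r" "0 \<le> r" "b = ennreal s" "0 \<le> s"
    by (metis ennreal_cases)
  have "4 * (r * s) \<le> (r + s)\<^sup>2" using zero_le_power2[of "r - s"] by (simp add: power2_eq_square algebra_simps)
  then have "ennreal (4 * (r * s)) \<le> ennreal ((r + s)\<^sup>2)" by (rule ennreal_leI)
  then show ?thesis using * by (simp add: ennreal_mult ennreal_power flip: ennreal_plus)
qed

lemma ennreal_power2_strict_mono:
  fixes a b :: ennreal
  assumes "a < b"
  shows "a\<^sup>2 < b\<^sup>2"
proof (cases "b = top")
  case True
  then show ?thesis using assms by (simp add: power2_eq_square ennreal_mult_less_top)
next
  case False
  then obtain r s where *: "a = ennreal r" "0 \<le> r" "b = ennreal s" "0 \<le> s"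
    using assms by (metis ennreal_cases top.extremum_strict)
  then have "r < s" using assms by (simp add: ennreal_less_iff)
  then show ?thesis using * by (simp add: ennreal_power ennreal_less_iff power_strict_mono)
qed

lemma ennreal_power2_le_iff: "a\<^sup>2 \<le> b\<^sup>2 \<longleftrightarrow> a \<le> b" for a b :: ennreal
  by (meson ennreal_power2_strict_mono leD leI power_mono zero_le)

lemma ennreal_mult_strict_mono:
  fixes a b c d :: ennreal
  assumes "a < b" "c < d"
  shows "a * c < b * d"
proof (cases "b = top \<or> d = top")
  case True
  then have "b * d = top" using assms by (auto simp: ennreal_mult_top ennreal_top_mult)
  then show ?thesis using assms by (auto simp: ennreal_mult_less_top intro: less_le_trans[OF _ top_greatest])
next
  case False
  then obtain r s t u where *: "a = ennreal r" "0 \<le> r" "b = ennreal s" "0 \<le> s"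
    "c = ennreal t" "0 \<le> t" "d = ennreal u" "0 \<le> u"
    using assms by (metis ennreal_cases top.extremum_strict)
  then have "r * t < s * u" using assms by (intro mult_strict_mono') (auto simp: ennreal_less_iff)
  then show ?thesis using * by (simp add: ennreal_less_iff flip: ennreal_mult)
qed

text \<open>With both suprema equal to 1, the superlevel sets of \<open>f\<close> and
  \<open>g\<close> are nonempty at the same levels, those below 1, so Brunn-Minkowski applies at
  each of them. Integration over the levels bounds the sum of the two integrals, and the
  arithmetic-geometric mean inequality passes from the sum to the product.\<close>

lemma prekopa_leindler_real_normalized:
  fixes f g h :: "real \<Rightarrow> ennreal"
  assumes [measurable]: "f \<in> borel_measurable borel" "g \<in> borel_measurable borel" "h \<in> borel_measurable borel"
    and sup: "(SUP x. f x) = 1" "(SUP x. g x) = 1"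
    and le: "\<And>x y. f x * g y \<le> (h ((x + y) / 2))\<^sup>2"
  shows "(\<integral>\<^sup>+x. f x \<partial>lborel) * (\<integral>\<^sup>+x. g x \<partial>lborel) \<le> (\<integral>\<^sup>+x. h x \<partial>lborel)\<^sup>2"
proof -
  let ?E = "\<lambda>f l. emeasure lborel {x \<in> space lborel. ennreal l < f x} * indicator {0..} l"
  have lev: "?E f l + ?E g l \<le> 2 * ?E h l" for l :: real
  proof (cases "0 \<le> l \<and> l < 1")
    case True
    then have l1: "ennreal l < 1" by (simp add: ennreal_less_one_iff)
    have "emeasure lborel {x. ennreal l < f x} + emeasure lborel {x. ennreal l < g x}
      \<le> 2 * emeasure lborel {x. ennreal l < h x}"
    proof (rule brunn_minkowski_real)
      show "{x. ennreal l < f x} \<noteq> {}" "{x. ennreal l < g x} \<noteq> {}"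
        using l1 less_SUP_iff[of "ennreal l" f UNIV] less_SUP_iff[of "ennreal l" g UNIV] sup by auto
      fix a b assume ab: "a \<in> {x. ennreal l < f x}" "b \<in> {x. ennreal l < g x}"
      have "(ennreal l)\<^sup>2 < f a * g b"
        unfolding power2_eq_square using ab by (intro ennreal_mult_strict_mono) auto
      also have "\<dots> \<le> (h ((a + b) / 2))\<^sup>2" by (rule le)
      finally show "(a + b) / 2 \<in> {x. ennreal l < h x}"
        using ennreal_power2_le_iff[of "h ((a+b)/2)" "ennreal l"] by auto
    qed auto
    then show ?thesis using True by simp
  next
    case False
    have "f x \<le> 1" "g x \<le> 1" for x using sup SUP_upper[of x UNIV f] SUP_upper[of x UNIV g] by auto
    then have "\<not> ennreal l < f x" "\<not> ennreal l < g x" if "l \<ge> 1" for x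
      using that by (metis dual_order.trans ennreal_1 ennreal_leI leD)+
    then show ?thesis using False by (cases "0 \<le> l") auto
  qed
  have "(\<integral>\<^sup>+x. f x \<partial>lborel) + (\<integral>\<^sup>+x. g x \<partial>lborel) = (\<integral>\<^sup>+l. ?E f l \<partial>lborel) + (\<integral>\<^sup>+l. ?E g l \<partial>lborel)"
    by (subst (1 2) nn_integral_layer_cake) (auto simp: sigma_finite_lborel)
  also have "\<dots> = (\<integral>\<^sup>+l. ?E f l + ?E g l \<partial>lborel)"
    by (rule nn_integral_add[symmetric]) measurable
  also have "\<dots> \<le> (\<integral>\<^sup>+l. 2 * ?E h l \<partial>lborel)" by (intro nn_integral_mono lev)
  also have "\<dots> = 2 * (\<integral>\<^sup>+l. ?E h l \<partial>lborel)" by (rule nn_integral_cmult) measurable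
  also have "\<dots> = 2 * (\<integral>\<^sup>+x. h x \<partial>lborel)"
    by (subst nn_integral_layer_cake[of _ h]) (auto simp: sigma_finite_lborel)
  finally have s: "(\<integral>\<^sup>+x. f x \<partial>lborel) + (\<integral>\<^sup>+x. g x \<partial>lborel) \<le> 2 * (\<integral>\<^sup>+x. h x \<partial>lborel)" .
  have "4 * ((\<integral>\<^sup>+x. f x \<partial>lborel) * (\<integral>\<^sup>+x. g x \<partial>lborel)) \<le> ((\<integral>\<^sup>+x. f x \<partial>lborel) + (\<integral>\<^sup>+x. g x \<partial>lborel))\<^sup>2"
    by (rule ennreal_four_mult_le)
  also have "\<dots> \<le> (2 * (\<integral>\<^sup>+x. h x \<partial>lborel))\<^sup>2" by (rule power_mono[OF s]) simp
  also have "\<dots> = 4 * (\<integral>\<^sup>+x. h x \<partial>lborel)\<^sup>2" by (simp add: power_mult_distrib)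
  finally show ?thesis by (subst (asm) ennreal_mult_le_mult_iff) auto
qed

lemma prekopa_leindler_real_bounded:
  fixes f g h :: "real \<Rightarrow> ennreal"
  assumes [measurable]: "f \<in> borel_measurable borel" "g \<in> borel_measurable borel" "h \<in> borel_measurable borel"
    and sup: "(SUP x. f x) < top" "(SUP x. g x) < top"
    and le: "\<And>x y. f x * g y \<le> (h ((x + y) / 2))\<^sup>2"
  shows "(\<integral>\<^sup>+x. f x \<partial>lborel) * (\<integral>\<^sup>+x. g x \<partial>lborel) \<le> (\<integral>\<^sup>+x. h x \<partial>lborel)\<^sup>2"
proof (cases "(SUP x. f x) = 0 \<or> (SUP x. g x) = 0")
  case True
  then have "(\<forall>x. f x = 0) \<or> (\<forall>x. g x = 0)" by (metis SUP_upper UNIV_I le_zero_eq)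
  then show ?thesis by auto
next
  case False
  obtain a where a: "(SUP x. f x) = ennreal a" "a > 0"
    using False sup(1) by (cases "SUP x. f x") (auto simp: less_le)
  obtain b where b: "(SUP x. g x) = ennreal b" "b > 0"
    using False sup(2) by (cases "SUP x. g x") (auto simp: less_le)
  \<comment> \<open>The scaling of \<open>h\<close> is forced: \<open>1/c\<close> has to be the
    geometric mean of \<open>1/a\<close> and \<open>1/b\<close> for the hypothesis to
    survive.\<close>
  define c where "c = sqrt (a * b)"
  have c: "c > 0" "c * c = a * b" using a b by (auto simp: c_def)
  have "(\<integral>\<^sup>+x. ennreal (1/a) * f x \<partial>lborel) * (\<integral>\<^sup>+x. ennreal (1/b) * g x \<partial>lborel)
     \<le> (\<integral>\<^sup>+x. ennreal (1/c) * h x \<partial>lborel)\<^sup>2"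
  proof (rule prekopa_leindler_real_normalized)
    show "(SUP x. ennreal (1/a) * f x) = 1" "(SUP x. ennreal (1/b) * g x) = 1"
      using a b by (simp_all flip: SUP_mult_left_ennreal ennreal_mult' ennreal_1)
    fix x y
    have "ennreal (1/a) * f x * (ennreal (1/b) * g y) = ennreal (1/(a*b)) * (f x * g y)"
      using a b by (simp add: ennreal_mult' divide_inverse mult_ac)
    also have "\<dots> \<le> ennreal (1/(a*b)) * (h ((x + y) / 2))\<^sup>2" by (intro mult_left_mono le) auto
    also have "ennreal (1/(a*b)) = (ennreal (1/c))\<^sup>2"
      using c a b by (simp add: power2_eq_square flip: ennreal_mult')
    finally show "ennreal (1/a) * f x * (ennreal (1/b) * g y) \<le> (ennreal (1/c) * h ((x + y) / 2))\<^sup>2"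
      by (simp add: power_mult_distrib)
  qed auto
  then have "ennreal (1/a) * (\<integral>\<^sup>+x. f x \<partial>lborel) * (ennreal (1/b) * (\<integral>\<^sup>+x. g x \<partial>lborel))
     \<le> (ennreal (1/c) * (\<integral>\<^sup>+x. h x \<partial>lborel))\<^sup>2"
    by (simp add: nn_integral_cmult)
  moreover have "ennreal (1/a) * F * (ennreal (1/b) * G) = ennreal (1/(a*b)) * (F * G)" for F G
      using a b by (simp add: ennreal_mult' divide_inverse mult_ac)
  moreover have "(ennreal (1/c))\<^sup>2 = ennreal (1/(a*b))"
      using c a b by (simp add: power2_eq_square flip: ennreal_mult')
  ultimately show ?thesis using a b
    by (simp add: power_mult_distrib ennreal_mult_le_mult_iff)
qed

lemma prekopa_leindler_real: "prekopa_leindler lborel UNIV (\<lambda>x y :: real. (x + y) / 2)"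
  unfolding prekopa_leindler_def
proof (intro allI impI)
  fix f g h :: "real \<Rightarrow> ennreal"
  assume "f \<in> borel_measurable lborel" "g \<in> borel_measurable lborel" "h \<in> borel_measurable lborel"
  then have [measurable]: "f \<in> borel_measurable borel" "g \<in> borel_measurable borel" "h \<in> borel_measurable borel"
    by auto
  assume le: "\<forall>x\<in>UNIV. \<forall>y\<in>UNIV. f x * g y \<le> (h ((x + y) / 2))\<^sup>2"
  have lim: "(\<lambda>n. \<integral>\<^sup>+x. min (k x) (of_nat n) \<partial>lborel) \<longlonglongrightarrow> (\<integral>\<^sup>+x. k x \<partial>lborel)"
    if [measurable]: "k \<in> borel_measurable borel" for k :: "real \<Rightarrow> ennreal"
  proof (rule nn_integral_LIMSEQ)
    show "incseq (\<lambda>n x. min (k x) (of_nat n))"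
      by (auto simp: incseq_def le_fun_def min_le_iff_disj)
    fix x
    have "(\<lambda>n. min (k x) (of_nat n)) \<longlonglongrightarrow> min (k x) top"
      by (intro tendsto_min tendsto_const) (rule of_nat_tendsto_top_ennreal)
    then show "(\<lambda>n. min (k x) (of_nat n)) \<longlonglongrightarrow> k x" by simp
  qed auto
  show "(\<integral>\<^sup>+x. f x \<partial>lborel) * (\<integral>\<^sup>+x. g x \<partial>lborel) \<le> (\<integral>\<^sup>+x. h x \<partial>lborel)\<^sup>2"
  proof -
    have *: "(\<integral>\<^sup>+x. min (f x) (of_nat n) \<partial>lborel) * (\<integral>\<^sup>+x. min (g x) (of_nat n) \<partial>lborel) \<le> (\<integral>\<^sup>+x. h x \<partial>lborel)\<^sup>2" for n
    proof (rule prekopa_leindler_real_bounded)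
      have "(SUP x. min (k x) (of_nat n)) \<le> (of_nat n :: ennreal)" for k :: "real \<Rightarrow> ennreal" by (rule SUP_least) auto
      then show "(SUP x. min (f x) (of_nat n)) < top" "(SUP x. min (g x) (of_nat n)) < top"
        by (metis ennreal_of_nat_neq_top infinity_ennreal_def le_less_trans less_top)+
      fix x y
      have "min (f x) (of_nat n) * min (g y) (of_nat n) \<le> f x * g y" by (intro mult_mono) auto
      also have "\<dots> \<le> (h ((x + y)/2))\<^sup>2" using le by auto
      finally show "min (f x) (of_nat n) * min (g y) (of_nat n) \<le> (h ((x + y)/2))\<^sup>2" .
    qed auto
    have mono: "(\<integral>\<^sup>+x. min (k x) (of_nat n) \<partial>lborel) \<le> (\<integral>\<^sup>+x. min (k x) (of_nat m) \<partial>lborel)" if "n \<le> m" for k :: "real \<Rightarrow> ennreal" and n m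
      using that by (intro nn_integral_mono) (auto simp: min_le_iff_disj)
    \<comment> \<open>The product of the two suprema ranges over independent truncation levels; both
      are compared with the larger one.\<close>
    have **: "(\<integral>\<^sup>+x. min (f x) (of_nat n) \<partial>lborel) * (\<integral>\<^sup>+x. min (g x) (of_nat m) \<partial>lborel) \<le> (\<integral>\<^sup>+x. h x \<partial>lborel)\<^sup>2" for n m
      using mult_mono[OF mono[of n "max n m" f] mono[of m "max n m" g]] *[of "max n m"]
      by (meson dual_order.trans max.cobounded1 max.cobounded2 zero_le)
    have F: "(\<integral>\<^sup>+x. k x \<partial>lborel) = (SUP n. \<integral>\<^sup>+x. min (k x) (of_nat n) \<partial>lborel)"
      if [measurable]: "k \<in> borel_measurable borel" for k :: "real \<Rightarrow> ennreal"
      using LIMSEQ_unique[OF lim LIMSEQ_SUP] mono that by (metis (mono_tags, lifting) incseq_def)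
    show ?thesis
      unfolding F[of f, simplified] F[of g, simplified] SUP_mult_left_ennreal SUP_mult_right_ennreal
      by (intro SUP_least **)
  qed
qed

text \<open>The image under \<open>exp\<close> of the measure with density \<open>exp u\<close> is
  Lebesgue measure on the positive half-line. The two are compared on the images of the intervals
  from \<open>- real n\<close> to \<open>real n\<close>, and then \<open>n\<close> tends to
  infinity; this leaves \<open>f\<close> free to have an infinite integral.\<close>

lemma nn_integral_exp_substitution:
  fixes f :: "real \<Rightarrow> ennreal"
  assumes [measurable]: "f \<in> borel_measurable borel" and zero: "\<And>x. x \<le> 0 \<Longrightarrow> f x = 0"
  shows "(\<integral>\<^sup>+x. f x \<partial>lborel) = (\<integral>\<^sup>+u. f (exp u) * ennreal (exp u) \<partial>lborel)"
proof -
  let ?M = "density lborel (\<lambda>u. ennreal (exp u))"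
  have "distr ?M borel exp = density lborel (indicator {0<..})" (is "?D = ?L")
  proof (rule measure_eqI)
    fix A assume "A \<in> sets ?D"
    then have [measurable]: "A \<in> sets borel" by simp
    have [measurable]: "exp -` A \<in> sets (borel :: real measure)"
      using measurable_sets[of exp borel borel A] by simp
    let ?r = "\<lambda>n::nat. (\<integral>\<^sup>+u. indicator A (exp u) * exp u * indicator {- real n..real n} u \<partial>lborel)"
    have eq: "emeasure lborel (A \<inter> {exp (- real n)..exp (real n)}) = ?r n" for n
    proof -
      have "emeasure lborel (A \<inter> {exp (- real n)..exp (real n)})
        = (\<integral>\<^sup>+x. ennreal (indicator A x * indicator {exp (- real n)..exp (real n)} x) \<partial>lborel)"
        by (simp add: nn_integral_indicator[symmetric] indicator_inter_arith ennreal_mult' ennreal_indicator del: nn_integral_indicator)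
      also have "\<dots> = ?r n"
        by (rule nn_integral_substitution)
           (auto intro!: derivative_eq_intros continuous_intros simp: set_borel_measurable_def)
      finally show ?thesis .
    qed
    have l1: "(\<lambda>n. emeasure lborel (A \<inter> {exp (- real n)..exp (real n)}))
      \<longlonglongrightarrow> emeasure lborel (\<Union>n. A \<inter> {exp (- real n)..exp (real n)})"
    proof (intro Lim_emeasure_incseq incseq_SucI Int_mono order_refl)
      show "{exp (- real n)..exp (real n)} \<subseteq> {exp (- real (Suc n))..exp (real (Suc n))}" for n
        unfolding atLeastatMost_subset_iff exp_le_cancel_iff by simp
    qed auto
    have l2: "(\<Union>n. A \<inter> {exp (- real n)..exp (real n)}) = A \<inter> {0<..}"
    proof (intro equalityI subsetI)
      fix x assume "x \<in> A \<inter> {0<..}"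
      then have x: "x \<in> A" "0 < x" by auto
      obtain n where "\<bar>ln x\<bar> \<le> real n" using real_arch_simple by blast
      then have "- real n \<le> ln x" "ln x \<le> real n" by auto
      then have "exp (- real n) \<le> x" "x \<le> exp (real n)" using x by (metis exp_le_cancel_iff exp_ln)+
      then show "x \<in> (\<Union>n. A \<inter> {exp (- real n)..exp (real n)})" using x by auto
    qed (auto intro: less_le_trans[OF exp_gt_zero])
    have l3: "?r \<longlonglongrightarrow> (\<integral>\<^sup>+u. ennreal (indicator A (exp u) * exp u) \<partial>lborel)"
    proof (rule nn_integral_LIMSEQ)
      show "incseq (\<lambda>n u. ennreal (indicator A (exp u) * exp u * indicator {- real n..real n} u))"
        by (auto simp: incseq_def le_fun_def indicator_def intro!: ennreal_leI)
      fix u :: real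
      obtain N where "\<bar>u\<bar> \<le> real N" using real_arch_simple by blast
      then have "ennreal (indicator A (exp u) * exp u * indicator {- real n..real n} u) = ennreal (indicator A (exp u) * exp u)" if "n \<ge> N" for n
        using that by (auto simp: indicator_def)
      then show "(\<lambda>n. ennreal (indicator A (exp u) * exp u * indicator {- real n..real n} u)) \<longlonglongrightarrow> ennreal (indicator A (exp u) * exp u)"
        by (intro tendsto_eventually) (auto simp: eventually_sequentially)
    qed simp
    have "emeasure lborel (A \<inter> {0<..}) = (\<integral>\<^sup>+u. ennreal (indicator A (exp u) * exp u) \<partial>lborel)"
      by (rule LIMSEQ_unique[OF l1[unfolded eq l2] l3])
    moreover have "emeasure ?D A = (\<integral>\<^sup>+u. ennreal (indicator A (exp u) * exp u) \<partial>lborel)"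
      by (subst emeasure_distr, simp, simp, subst emeasure_density)
         (auto intro!: nn_integral_cong simp: indicator_def)
    moreover have "emeasure ?L A = emeasure lborel (A \<inter> {0<..})"
      by (subst emeasure_density, simp, simp) (simp add: indicator_inter_arith[symmetric] Int_commute)
    ultimately show "emeasure ?D A = emeasure ?L A" by simp
  qed simp
  then have "(\<integral>\<^sup>+x. f x \<partial>?D) = (\<integral>\<^sup>+x. f x \<partial>?L)" by simp
  moreover have "(\<integral>\<^sup>+x. f x \<partial>?D) = (\<integral>\<^sup>+u. f (exp u) * ennreal (exp u) \<partial>lborel)"
    by (subst nn_integral_distr, simp, simp, subst nn_integral_density) (auto simp: mult.commute)
  moreover have "(\<integral>\<^sup>+x. f x \<partial>?L) = (\<integral>\<^sup>+x. f x \<partial>lborel)"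
    using zero by (subst nn_integral_density) (auto intro!: nn_integral_cong simp: indicator_def)
  ultimately show ?thesis by simp
qed

text \<open>The substitution \<open>x = exp u\<close> turns geometric means into midpoints. Its
  Jacobian is log-affine: \<open>exp u * exp v\<close> is exactly the square of the Jacobian at the
  midpoint, so nothing is lost.\<close>

lemma prekopa_leindler_real_mult: "prekopa_leindler lborel {0<..} (\<lambda>x y :: real. sqrt (x * y))"
  unfolding prekopa_leindler_def
proof (intro allI impI)
  fix f g h :: "real \<Rightarrow> ennreal"
  assume "f \<in> borel_measurable lborel" "g \<in> borel_measurable lborel" "h \<in> borel_measurable lborel"
  then have [measurable]: "f \<in> borel_measurable borel" "g \<in> borel_measurable borel" "h \<in> borel_measurable borel"
    by auto
  assume zero: "\<forall>x\<in>space lborel - {0<..}. f x = 0 \<and> g x = 0"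
  assume le: "\<forall>x\<in>{0<..}. \<forall>y\<in>{0<..}. f x * g y \<le> (h (sqrt (x * y)))\<^sup>2"
  let ?k = "\<lambda>x. h x * indicator {0<..} x"
  have "(\<integral>\<^sup>+u. f (exp u) * ennreal (exp u) \<partial>lborel) * (\<integral>\<^sup>+u. g (exp u) * ennreal (exp u) \<partial>lborel)
     \<le> (\<integral>\<^sup>+u. h (exp u) * ennreal (exp u) \<partial>lborel)\<^sup>2"
  proof (rule prekopa_leindlerD[OF prekopa_leindler_real])
    fix u v :: real
    have "sqrt (exp u * exp v) = exp ((u + v) / 2)"
      by (intro real_sqrt_unique) (auto simp: power2_eq_square simp flip: exp_add)
    then have 1: "f (exp u) * g (exp v) \<le> (h (exp ((u + v) / 2)))\<^sup>2"
      using le by (metis exp_gt_zero greaterThan_iff)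
    have 2: "ennreal (exp u) * ennreal (exp v) = (ennreal (exp ((u + v) / 2)))\<^sup>2"
      by (simp add: power2_eq_square flip: ennreal_mult exp_add)
    have "f (exp u) * ennreal (exp u) * (g (exp v) * ennreal (exp v))
      = (f (exp u) * g (exp v)) * (ennreal (exp u) * ennreal (exp v))" by (simp add: mult_ac)
    also have "\<dots> \<le> (h (exp ((u + v) / 2)))\<^sup>2 * (ennreal (exp ((u + v) / 2)))\<^sup>2"
      unfolding 2 by (rule mult_right_mono[OF 1]) simp
    finally show "f (exp u) * ennreal (exp u) * (g (exp v) * ennreal (exp v))
      \<le> (h (exp ((u + v) / 2)) * ennreal (exp ((u + v) / 2)))\<^sup>2" by (simp add: power_mult_distrib)
  qed auto
  also have "(\<integral>\<^sup>+u. h (exp u) * ennreal (exp u) \<partial>lborel) = (\<integral>\<^sup>+u. ?k (exp u) * ennreal (exp u) \<partial>lborel)"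
    by (intro nn_integral_cong) auto
  also have "\<dots> = (\<integral>\<^sup>+x. ?k x \<partial>lborel)" by (rule nn_integral_exp_substitution[symmetric]) auto
  also have "(\<integral>\<^sup>+x. ?k x \<partial>lborel)\<^sup>2 \<le> (\<integral>\<^sup>+x. h x \<partial>lborel)\<^sup>2"
    by (intro power_mono nn_integral_mono) (auto simp: indicator_def)
  also have "(\<integral>\<^sup>+u. f (exp u) * ennreal (exp u) \<partial>lborel) = (\<integral>\<^sup>+x. f x \<partial>lborel)"
    using zero by (intro nn_integral_exp_substitution[symmetric]) auto
  also have "(\<integral>\<^sup>+u. g (exp u) * ennreal (exp u) \<partial>lborel) = (\<integral>\<^sup>+x. g x \<partial>lborel)"
    using zero by (intro nn_integral_exp_substitution[symmetric]) auto
  finally show "(\<integral>\<^sup>+x. f x \<partial>lborel) * (\<integral>\<^sup>+x. g x \<partial>lborel) \<le> (\<integral>\<^sup>+x. h x \<partial>lborel)\<^sup>2" .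
qed

section \<open>Products and Euclidean space\<close>

text \<open>When coordinate \<open>i\<close> is fixed at \<open>y\<close>, \<open>y'\<close> and
  \<open>m i y y'\<close>, the induction hypothesis bounds the fibre integrals in just the form in
  which the inequality for \<open>M i\<close> takes them as input. Measures, domains and means stay
  abstract so that one induction serves both the arithmetic mean on the line and the geometric mean
  on the half-line.\<close>

lemma prekopa_leindler_PiM:
  assumes M: "product_sigma_finite M" and "finite I"
    and pl: "\<And>i. i \<in> I \<Longrightarrow> prekopa_leindler (M i) (P i) (m i)"
    and sp: "\<And>i. i \<in> I \<Longrightarrow> P i \<subseteq> space (M i)"
    and cl: "\<And>i x y. i \<in> I \<Longrightarrow> x \<in> P i \<Longrightarrow> y \<in> P i \<Longrightarrow> m i x y \<in> space (M i)"
  shows "prekopa_leindler (PiM I M) (PiE I P) (\<lambda>x y. \<lambda>i\<in>I. m i (x i) (y i))"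
  using assms(2-)
proof (induction I rule: finite_induct)
  case empty
  interpret product_sigma_finite M by fact
  show ?case
    by (auto simp: prekopa_leindler_def nn_integral_empty restrict_def)
next
  case (insert i I)
  interpret product_sigma_finite M by fact
  have IH: "prekopa_leindler (PiM I M) (PiE I P) (\<lambda>x y. \<lambda>i\<in>I. m i (x i) (y i))"
    by (rule insert.IH) (use insert.prems in auto)
  have ne: "i \<notin> I" "finite I" using insert by auto
  let ?op = "\<lambda>x y. \<lambda>i\<in>insert i I. m i (x i) (y i)"
  show ?case
    unfolding prekopa_leindler_def
  proof (intro allI impI)
    fix f g h :: "('a \<Rightarrow> 'b) \<Rightarrow> ennreal"
    assume [measurable]: "f \<in> borel_measurable (PiM (insert i I) M)" "g \<in> borel_measurable (PiM (insert i I) M)"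
       "h \<in> borel_measurable (PiM (insert i I) M)"
    assume zero: "\<forall>x\<in>space (PiM (insert i I) M) - PiE (insert i I) P. f x = 0 \<and> g x = 0"
    assume le: "\<forall>x\<in>PiE (insert i I) P. \<forall>y\<in>PiE (insert i I) P. f x * g y \<le> (h (?op x y))\<^sup>2"
    have sect: "(\<lambda>x. k (x(i := y))) \<in> borel_measurable (PiM I M)"
      if [measurable]: "k \<in> borel_measurable (PiM (insert i I) M)" and [measurable]: "y \<in> space (M i)"
      for y and k :: "('a \<Rightarrow> 'b) \<Rightarrow> ennreal" by measurable
    interpret I: finite_product_sigma_finite M I by standard (rule ne)
    have marg: "(\<lambda>y. \<integral>\<^sup>+x. k (x(i := y)) \<partial>PiM I M) \<in> borel_measurable (M i)"
      if [measurable]: "k \<in> borel_measurable (PiM (insert i I) M)"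
      for k :: "('a \<Rightarrow> 'b) \<Rightarrow> ennreal"
      by measurable
    have z: "f (x(i := y)) = 0 \<and> g (x(i := y)) = 0"
      if "y \<in> space (M i)" "x \<in> space (PiM I M)" "y \<notin> P i \<or> x \<notin> PiE I P" for x y
    proof -
      have "x(i := y) \<in> space (PiM (insert i I) M)"
        using that(1,2) unfolding space_PiM by (intro PiE_fun_upd)
      moreover have "x(i := y) \<notin> PiE (insert i I) P"
      proof
        assume a: "x(i := y) \<in> PiE (insert i I) P"
        then have "y \<in> P i" by (metis PiE_mem fun_upd_same insertI1)
        moreover have "x \<in> PiE I P"
          using a ne that(2) by (auto simp: space_PiM PiE_def Pi_def extensional_def) (metis fun_upd_apply)
        ultimately show False using that by blast
      qed
      ultimately show ?thesis using zero by blast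
    qed
    have "(\<integral>\<^sup>+y. \<integral>\<^sup>+x. f (x(i := y)) \<partial>PiM I M \<partial>M i) * (\<integral>\<^sup>+y. \<integral>\<^sup>+x. g (x(i := y)) \<partial>PiM I M \<partial>M i)
      \<le> (\<integral>\<^sup>+y. \<integral>\<^sup>+x. h (x(i := y)) \<partial>PiM I M \<partial>M i)\<^sup>2"
    proof (rule prekopa_leindlerD[where P = "P i" and m = "m i"])
      show "prekopa_leindler (M i) (P i) (m i)" using insert.prems by auto
      fix y assume y: "y \<in> space (M i)" "y \<notin> P i"
      then show "(\<integral>\<^sup>+x. f (x(i := y)) \<partial>PiM I M) = 0" "(\<integral>\<^sup>+x. g (x(i := y)) \<partial>PiM I M) = 0"
        using z nn_integral_cong[of "PiM I M" "\<lambda>x. f (x(i := y))" "\<lambda>_. 0"]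
          nn_integral_cong[of "PiM I M" "\<lambda>x. g (x(i := y))" "\<lambda>_. 0"] by simp_all
    next
      fix y y' assume y: "y \<in> P i" "y' \<in> P i"
      have sy: "y \<in> space (M i)" "y' \<in> space (M i)" "m i y y' \<in> space (M i)"
        using y insert.prems(2)[of i] insert.prems(3)[of i y y'] by auto
      show "(\<integral>\<^sup>+x. f (x(i := y)) \<partial>PiM I M) * (\<integral>\<^sup>+x. g (x(i := y')) \<partial>PiM I M)
        \<le> (\<integral>\<^sup>+x. h (x(i := m i y y')) \<partial>PiM I M)\<^sup>2"
      proof (rule prekopa_leindlerD[OF IH])
        fix x x' assume x: "x \<in> PiE I P" "x' \<in> PiE I P"
        have "?op (x(i := y)) (x'(i := y')) = (\<lambda>i\<in>I. m i (x i) (x' i))(i := m i y y')"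
          using ne by (auto simp: fun_eq_iff)
        moreover have "x(i := y) \<in> PiE (insert i I) P" "x'(i := y') \<in> PiE (insert i I) P"
          by (rule PiE_fun_upd[OF y(1) x(1)], rule PiE_fun_upd[OF y(2) x(2)])
        ultimately show "f (x(i := y)) * g (x'(i := y')) \<le> (h ((\<lambda>i\<in>I. m i (x i) (x' i))(i := m i y y')))\<^sup>2"
          using le by metis
      qed (use z sy sect in auto)
    qed (use marg in auto)
    then show "(\<integral>\<^sup>+x. f x \<partial>PiM (insert i I) M) * (\<integral>\<^sup>+x. g x \<partial>PiM (insert i I) M) \<le> (\<integral>\<^sup>+x. h x \<partial>PiM (insert i I) M)\<^sup>2"
      using ne by (simp add: product_nn_integral_insert_rev)
  qed
qed

lemma nn_integral_lborel_PiM: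
  fixes f :: "'a::euclidean_space \<Rightarrow> ennreal"
  assumes [measurable]: "f \<in> borel_measurable borel"
  shows "(\<integral>\<^sup>+x. f x \<partial>lborel) = (\<integral>\<^sup>+\<omega>. f (\<Sum>b\<in>Basis. \<omega> b *\<^sub>R b) \<partial>(\<Pi>\<^sub>M b\<in>Basis. lborel))"
  by (subst lborel_eq, subst nn_integral_distr) auto

lemma prekopa_leindler_lborel:
  assumes "prekopa_leindler lborel P m"
  shows "prekopa_leindler lborel {x :: 'a::euclidean_space. \<forall>b\<in>Basis. x \<bullet> b \<in> P}
    (\<lambda>x y. \<Sum>b\<in>Basis. m (x \<bullet> b) (y \<bullet> b) *\<^sub>R b)"
  unfolding prekopa_leindler_def
proof (intro allI impI)
  let ?S = "\<lambda>\<omega>. \<Sum>b\<in>Basis. \<omega> b *\<^sub>R (b :: 'a)"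
  let ?P = "{x :: 'a. \<forall>b\<in>Basis. x \<bullet> b \<in> P}"
  have coord: "?S \<omega> \<bullet> b = \<omega> b" if "b \<in> Basis" for \<omega> and b :: 'a
    using that by (simp add: inner_sum_left inner_Basis if_distrib cong: if_cong)
  interpret product_sigma_finite "\<lambda>b::'a. lborel :: real measure" by standard
  fix f g h :: "'a \<Rightarrow> ennreal"
  assume "f \<in> borel_measurable lborel" "g \<in> borel_measurable lborel" "h \<in> borel_measurable lborel"
  then have [measurable]: "f \<in> borel_measurable borel" "g \<in> borel_measurable borel" "h \<in> borel_measurable borel"
    by auto
  assume zero: "\<forall>x\<in>space lborel - ?P. f x = 0 \<and> g x = 0"
  assume le: "\<forall>x\<in>?P. \<forall>y\<in>?P. f x * g y \<le> (h (\<Sum>b\<in>Basis. m (x \<bullet> b) (y \<bullet> b) *\<^sub>R b))\<^sup>2"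
  have "prekopa_leindler (\<Pi>\<^sub>M b\<in>(Basis::'a set). lborel) (PiE Basis (\<lambda>_. P)) (\<lambda>x y. \<lambda>i\<in>Basis. m (x i) (y i))"
    by (rule prekopa_leindler_PiM) (use assms product_sigma_finite_axioms in auto)
  then have "(\<integral>\<^sup>+\<omega>. f (?S \<omega>) \<partial>(\<Pi>\<^sub>M b\<in>Basis. lborel)) * (\<integral>\<^sup>+\<omega>. g (?S \<omega>) \<partial>(\<Pi>\<^sub>M b\<in>Basis. lborel))
    \<le> (\<integral>\<^sup>+\<omega>. h (?S \<omega>) \<partial>(\<Pi>\<^sub>M b\<in>Basis. lborel))\<^sup>2"
  proof (rule prekopa_leindlerD)
    fix \<omega> assume "\<omega> \<in> space (\<Pi>\<^sub>M b\<in>(Basis::'a set). (lborel :: real measure))" "\<omega> \<notin> (\<Pi>\<^sub>E b\<in>Basis. P)"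
    then have "?S \<omega> \<notin> ?P" by (auto simp: coord space_PiM PiE_def)
    then show "f (?S \<omega>) = 0" "g (?S \<omega>) = 0" using zero by auto
  next
    fix \<omega> \<omega>' assume w: "\<omega> \<in> (\<Pi>\<^sub>E b\<in>(Basis::'a set). P)" "\<omega>' \<in> (\<Pi>\<^sub>E b\<in>(Basis::'a set). P)"
    then have "?S \<omega> \<in> ?P" "?S \<omega>' \<in> ?P" by (auto simp: coord)
    then have "f (?S \<omega>) * g (?S \<omega>') \<le> (h (\<Sum>b\<in>Basis. m (?S \<omega> \<bullet> b) (?S \<omega>' \<bullet> b) *\<^sub>R b))\<^sup>2"
      using le by blast
    also have "(\<Sum>b\<in>Basis. m (?S \<omega> \<bullet> b) (?S \<omega>' \<bullet> b) *\<^sub>R b) = ?S (\<lambda>i\<in>Basis. m (\<omega> i) (\<omega>' i))"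
      by (intro sum.cong) (auto simp: coord)
    finally show "f (?S \<omega>) * g (?S \<omega>') \<le> (h (?S (\<lambda>i\<in>Basis. m (\<omega> i) (\<omega>' i))))\<^sup>2" .
  qed auto
  then show "(\<integral>\<^sup>+x. f x \<partial>lborel) * (\<integral>\<^sup>+x. g x \<partial>lborel) \<le> (\<integral>\<^sup>+x. h x \<partial>lborel)\<^sup>2"
    by (simp add: nn_integral_lborel_PiM)
qed

lemma prekopa_leindler_additive:
  "prekopa_leindler lborel UNIV (\<lambda>x y :: 'a::euclidean_space. (1/2) *\<^sub>R (x + y))"
proof -
  have "(\<Sum>b\<in>Basis. ((x \<bullet> b + y \<bullet> b) / 2) *\<^sub>R b) = (1/2) *\<^sub>R (x + y)" for x y :: 'a
    using euclidean_representation[of "(1/2) *\<^sub>R (x + y)"] by (simp add: inner_add_left)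
  then show ?thesis
    using prekopa_leindler_lborel[OF prekopa_leindler_real, where 'a = 'a] by simp
qed

section \<open>Norms and support functions\<close>

definition is_seminorm :: "('a::real_vector \<Rightarrow> real) \<Rightarrow> bool" where
  "is_seminorm a \<longleftrightarrow> (\<forall>x y. a (x + y) \<le> a x + a y) \<and> (\<forall>c x. a (c *\<^sub>R x) = \<bar>c\<bar> * a x)"

text \<open>Definiteness in quantitative form. On a Euclidean space it amounts to positivity off the
  origin (see \<open>is_normI\<close>), and it gives directly that the unit ball is bounded.\<close>

definition is_norm :: "('a::real_normed_vector \<Rightarrow> real) \<Rightarrow> bool" where
  "is_norm a \<longleftrightarrow> is_seminorm a \<and> (\<exists>r>0. \<forall>x. r * norm x \<le> a x)"

lemma is_seminormD:
  assumes "is_seminorm a"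
  shows "a (x + y) \<le> a x + a y" "a (c *\<^sub>R x) = \<bar>c\<bar> * a x"
  using assms by (auto simp: is_seminorm_def)

lemma seminorm_0: "is_seminorm a \<Longrightarrow> a 0 = 0"
  using is_seminormD(2)[of a 0 0] by simp

lemma seminorm_minus: "is_seminorm a \<Longrightarrow> a (- x) = a x"
  using is_seminormD(2)[of a "-1" x] by simp

lemma seminorm_nonneg:
  assumes "is_seminorm a"
  shows "0 \<le> a x"
  using is_seminormD(1)[OF assms, of x "- x"] by (simp add: seminorm_0 seminorm_minus assms)

lemma seminorm_combine:
  assumes "is_seminorm a"
  shows "a (u *\<^sub>R x + v *\<^sub>R y) \<le> \<bar>u\<bar> * a x + \<bar>v\<bar> * a y"
  using is_seminormD(1)[OF assms, of "u *\<^sub>R x" "v *\<^sub>R y"] by (simp add: is_seminormD(2) assms)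

lemma seminorm_convex:
  assumes "is_seminorm a"
  shows "convex_on UNIV a"
proof (rule convex_onI)
  fix t x y assume "0 < t" "t < (1::real)"
  then show "a ((1 - t) *\<^sub>R x + t *\<^sub>R y) \<le> (1 - t) * a x + t * a y"
    using seminorm_combine[OF assms, of "1 - t" x t y] by simp
qed simp

lemma seminorm_continuous:
  fixes a :: "'a::euclidean_space \<Rightarrow> real"
  shows "is_seminorm a \<Longrightarrow> continuous_on S a"
  by (rule continuous_on_subset[OF convex_on_continuous[OF open_UNIV seminorm_convex]]) auto

lemma seminorm_measurable:
  fixes a :: "'a::euclidean_space \<Rightarrow> real"
  shows "is_seminorm a \<Longrightarrow> a \<in> borel_measurable borel"
  by (intro borel_measurable_continuous_onI seminorm_continuous)

lemma seminorm_linear_image: "is_seminorm a \<Longrightarrow> linear f \<Longrightarrow> is_seminorm (\<lambda>x. a (f x))"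
  by (simp add: is_seminorm_def linear_add linear_cmul)

lemma is_norm_seminorm: "is_norm a \<Longrightarrow> is_seminorm a"
  by (simp add: is_norm_def)

lemma is_norm_pos: "is_norm a \<Longrightarrow> x \<noteq> 0 \<Longrightarrow> 0 < a x"
  unfolding is_norm_def by (metis mult_pos_pos order_less_le_trans zero_less_norm_iff)

text \<open>The minimum of \<open>a\<close> on the compact unit sphere serves as the
  constant.\<close>

lemma is_normI:
  fixes a :: "'a::euclidean_space \<Rightarrow> real"
  assumes a: "is_seminorm a" and pos: "\<And>x. x \<noteq> 0 \<Longrightarrow> 0 < a x"
  shows "is_norm a"
proof (cases "sphere (0::'a) 1 = {}")
  case True
  then have "x = 0" for x :: 'a
    by (metis dist_0_norm mem_sphere norm_Basis nonempty_Basis ex_in_conv)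
  then have "\<forall>x. 1 * norm x \<le> a x" using seminorm_nonneg[OF a] by (metis mult_1 norm_zero)
  then show ?thesis using a unfolding is_norm_def by (metis zero_less_one)
next
  case False
  obtain z where z: "z \<in> sphere (0::'a) 1" "\<And>y. y \<in> sphere 0 1 \<Longrightarrow> a z \<le> a y"
    using continuous_attains_inf[OF compact_sphere False seminorm_continuous[OF a]] by blast
  have "a z * norm x \<le> a x" for x
  proof (cases "x = 0")
    case False
    then have "a z \<le> a ((1 / norm x) *\<^sub>R x)" by (intro z(2)) auto
    then show ?thesis using False by (simp add: is_seminormD(2)[OF a] field_simps)
  qed (simp add: seminorm_0[OF a])
  moreover have "0 < a z" using z(1) pos[of z] by (cases "z = 0") auto
  ultimately show ?thesis using a unfolding is_norm_def by blast
qed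

lemma is_norm_linear_image:
  fixes a :: "'a::euclidean_space \<Rightarrow> real" and f :: "'b::euclidean_space \<Rightarrow> 'a"
  assumes "is_norm a" "linear f" "inj f"
  shows "is_norm (\<lambda>x. a (f x))"
proof (rule is_normI)
  show "is_seminorm (\<lambda>x. a (f x))" by (rule seminorm_linear_image[OF is_norm_seminorm[OF assms(1)] assms(2)])
  show "0 < a (f x)" if "x \<noteq> 0" for x
    using that assms is_norm_pos[of a "f x"] by (metis injD linear_0)
qed

lemma is_norm_norm: "is_norm (norm :: 'a::real_normed_vector \<Rightarrow> real)"
  unfolding is_norm_def is_seminorm_def by (auto intro: norm_triangle_ineq exI[of _ 1])

lemma seminorm_upper_bound:
  fixes a :: "'a::euclidean_space \<Rightarrow> real"
  assumes a: "is_seminorm a"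
  obtains C where "C > 0" "\<And>x. a x \<le> C * norm x"
proof -
  define C where "C = 1 + (\<Sum>b\<in>Basis. a (b :: 'a))"
  have "a x \<le> C * norm x" for x
  proof -
    have sum: "a (\<Sum>b\<in>B. (x \<bullet> b) *\<^sub>R b) \<le> (\<Sum>b\<in>B. \<bar>x \<bullet> b\<bar> * a b)" if "finite B" for B
      using that
    proof (induction B rule: finite_induct)
      case (insert b B)
      then show ?case
        using is_seminormD(1)[OF a, of "(x \<bullet> b) *\<^sub>R b" "\<Sum>b\<in>B. (x \<bullet> b) *\<^sub>R b"] by (simp add: is_seminormD(2)[OF a])
    qed (simp add: seminorm_0[OF a])
    have "a x \<le> (\<Sum>b\<in>Basis. \<bar>x \<bullet> b\<bar> * a b)"
      using sum[OF finite_Basis] by (simp add: euclidean_representation)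
    also have "\<dots> \<le> (\<Sum>b\<in>Basis. norm x * a b)"
      by (intro sum_mono mult_right_mono Basis_le_norm seminorm_nonneg[OF a])
    also have "\<dots> \<le> C * norm x" by (simp add: C_def sum_distrib_right algebra_simps flip: sum_distrib_left)
    finally show ?thesis .
  qed
  moreover have "C > 0" unfolding C_def by (intro add_pos_nonneg sum_nonneg seminorm_nonneg[OF a]) auto
  ultimately show ?thesis using that by blast
qed

section \<open>Support functions as norms, and bodies recovered from them\<close>

lemma seminorm_support_fun:
  fixes S :: "'a::euclidean_space set"
  assumes S: "bounded S" "S \<noteq> {}" "uminus ` S = S"
  shows "is_seminorm (support_fun S)"
proof -
  have bdd: "bdd_above ((\<lambda>y. x \<bullet> y) ` S)" for x
  proof -
    obtain R where R: "\<And>y. y \<in> S \<Longrightarrow> norm y \<le> R" using S(1) by (auto simp: bounded_iff)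
    have "x \<bullet> y \<le> norm x * R" if "y \<in> S" for y
      using norm_cauchy_schwarz[of x y] R[OF that] by (meson dual_order.trans mult_left_mono norm_ge_zero)
    then show ?thesis by (auto simp: bdd_above_def)
  qed
  have le: "x \<bullet> y \<le> support_fun S x" if "y \<in> S" for x y
    unfolding support_fun_def using that by (intro cSUP_upper bdd)
  have scale: "support_fun S (c *\<^sub>R x) = c * support_fun S x" if "c \<ge> 0" for c x
  proof -
    have sc: "support_fun S (c *\<^sub>R x) \<le> c * support_fun S x" if "c \<ge> 0" for c x
      unfolding support_fun_def[of _ "c *\<^sub>R x"] by (intro cSUP_least S) (simp add: le mult_left_mono that)
    show ?thesis
    proof (cases "c = 0")
      case False
      then have "support_fun S x \<le> inverse c * support_fun S (c *\<^sub>R x)"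
        using sc[of "inverse c" "c *\<^sub>R x"] that by simp
      then show ?thesis using sc[OF that, of x] False that by (simp add: field_simps)
    qed (use S(2) in \<open>simp add: support_fun_def\<close>)
  qed
  have minus: "support_fun S (- x) = support_fun S x" for x
    unfolding support_fun_def by (subst S(3)[symmetric]) (simp add: image_image)
  show ?thesis
    unfolding is_seminorm_def
  proof (intro conjI allI)
    show "support_fun S (x + y) \<le> support_fun S x + support_fun S y" for x y
      unfolding support_fun_def[of _ "x + y"]
      by (intro cSUP_least S) (simp add: inner_add_left add_mono le)
    show "support_fun S (c *\<^sub>R x) = \<bar>c\<bar> * support_fun S x" for c x
    proof (cases "c \<ge> 0")
      case False
      then show ?thesis using scale[of "- c" x] minus[of "c *\<^sub>R x"] by simp
    qed (simp add: scale)
  qed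
qed

lemma is_norm_support_fun:
  fixes S :: "'a::euclidean_space set"
  assumes S: "bounded S" "uminus ` S = S" and r: "0 < r" "cball 0 r \<subseteq> S"
  shows "is_norm (support_fun S)"
proof (rule is_normI)
  show s: "is_seminorm (support_fun S)"
    by (rule seminorm_support_fun) (use assms in auto)
  fix x :: 'a assume x: "x \<noteq> 0"
  let ?y = "(r / norm x) *\<^sub>R x"
  obtain R where R: "\<And>y. y \<in> S \<Longrightarrow> norm y \<le> R" using S(1) by (auto simp: bounded_iff)
  have "x \<bullet> y \<le> norm x * R" if "y \<in> S" for y
    using norm_cauchy_schwarz[of x y] R[OF that] by (meson dual_order.trans mult_left_mono norm_ge_zero)
  then have "bdd_above ((\<lambda>y. x \<bullet> y) ` S)" by (auto simp: bdd_above_def)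
  moreover have "?y \<in> S" using r x by (intro subsetD[OF r(2)]) auto
  ultimately have "x \<bullet> ?y \<le> support_fun S x" unfolding support_fun_def by (intro cSUP_upper)
  moreover have "x \<bullet> ?y > 0" using r x by auto
  ultimately show "0 < support_fun S x" by linarith
qed

text \<open>The origin is the midpoint of an interior point and its reflection, hence interior
  itself.\<close>

lemma symmetric_convex_body_cball:
  fixes K :: "'a::euclidean_space set"
  assumes "convex_body K" "origin_symmetric K"
  obtains r where "0 < r" "cball 0 r \<subseteq> K"
proof -
  obtain x where x: "x \<in> interior K" using assms by (auto simp: convex_body_def)
  then have "- x \<in> K" using assms(2) interior_subset[of K] unfolding origin_symmetric_def by blast
  then have "- x - (1/2) *\<^sub>R (- x - x) \<in> interior K"
    using assms(1) x by (intro mem_interior_convex_shrink) (auto simp: convex_body_def)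
  moreover have "- x - (1/2) *\<^sub>R (- x - x) = 0" by (simp add: algebra_simps flip: scaleR_add_left)
  ultimately show ?thesis using that mem_interior_cball by metis
qed

lemma convex_body_bounded_symmetric:
  assumes "convex_body K" "origin_symmetric K"
  shows "bounded K" "uminus ` K = K"
  using assms by (auto simp: convex_body_def origin_symmetric_def compact_imp_bounded)

lemma is_norm_support_fun_body:
  fixes K :: "'a::euclidean_space set"
  assumes "convex_body K" "origin_symmetric K"
  shows "is_norm (support_fun K)"
proof -
  obtain r where r: "0 < r" "cball 0 r \<subseteq> K" using symmetric_convex_body_cball[OF assms] by blast
  then show ?thesis by (intro is_norm_support_fun[OF convex_body_bounded_symmetric[OF assms]])
qed

text \<open>Polarity reverses inclusions: a body between the balls of radii \<open>r\<close> and
  \<open>R\<close> has its polar between those of radii \<open>1 / R\<close> and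
  \<open>1 / r\<close>.\<close>

lemma is_norm_support_fun_polar:
  fixes K :: "'a::euclidean_space set"
  assumes "convex_body K" "origin_symmetric K"
  shows "is_norm (support_fun (polar_body K))"
proof -
  obtain r where r: "0 < r" "cball 0 r \<subseteq> K" using symmetric_convex_body_cball[OF assms] by blast
  obtain R where R: "R > 0" "\<And>y. y \<in> K \<Longrightarrow> norm y \<le> R"
    using convex_body_bounded_symmetric(1)[OF assms] by (auto simp: bounded_pos)
  show ?thesis
  proof (rule is_norm_support_fun[where r = "1 / R"])
    have "norm x \<le> 1 / r" if "x \<in> polar_body K" for x
    proof (cases "x = 0")
      case False
      have "(r / norm x) *\<^sub>R x \<in> K" using r False by (intro subsetD[OF r(2)]) auto
      then have "x \<bullet> ((r / norm x) *\<^sub>R x) \<le> 1" using that by (auto simp: polar_body_def)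
      then show ?thesis using False r by (simp add: dot_square_norm power2_eq_square field_simps)
    qed (use r in auto)
    then show "bounded (polar_body K)" by (auto simp: bounded_iff)
    have K: "- y \<in> K" if "y \<in> K" for y using that convex_body_bounded_symmetric(2)[OF assms] by blast
    have "- x \<in> polar_body K" if "x \<in> polar_body K" for x
      using that K by (fastforce simp: polar_body_def)
    then show "uminus ` polar_body K = polar_body K"
      by (force simp: image_iff intro: bexI[of _ "- x" for x])
    show "cball 0 (1 / R) \<subseteq> polar_body K"
    proof
      fix x assume "x \<in> cball (0::'a) (1 / R)"
      then have x: "norm x \<le> 1 / R" by simp
      have "x \<bullet> y \<le> 1" if "y \<in> K" for y
      proof -
        have "x \<bullet> y \<le> norm x * norm y" by (rule norm_cauchy_schwarz)
        also have "\<dots> \<le> 1 / R * R" using x R(2)[OF that] R(1) by (intro mult_mono) auto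
        finally show ?thesis using R(1) by simp
      qed
      then show "x \<in> polar_body K" by (auto simp: polar_body_def)
    qed
  qed (use R in auto)
qed

text \<open>A point of \<open>M\<close> outside \<open>N\<close> is separated from \<open>N\<close>
  by a hyperplane, and the two support functions differ in the normal direction. Used in both
  directions, this gives the uniqueness that the \<open>THE\<close> in \<open>Lp_sum\<close> asks
  for.\<close>

lemma convex_body_eq_support_fun:
  fixes M N :: "'a::euclidean_space set"
  assumes M: "convex_body M" and N: "convex_body N" and eq: "\<And>x. support_fun M x = support_fun N x"
  shows "M \<subseteq> N"
proof
  fix x assume x: "x \<in> M"
  show "x \<in> N"
  proof (rule ccontr)
    assume "x \<notin> N"
    then obtain a b where ab: "a \<bullet> x < b" "\<And>z. z \<in> N \<Longrightarrow> a \<bullet> z > b"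
      using separating_hyperplane_closed_point[of N x] N by (auto simp: convex_body_def compact_imp_closed)
    have "N \<noteq> {}" using N by (auto simp: convex_body_def)
    then have "support_fun N (- a) \<le> - b" unfolding support_fun_def
      using ab(2) by (intro cSUP_least) (auto intro: less_imp_le)
    moreover have "- a \<bullet> x \<le> support_fun M (- a)"
    proof -
      have "compact ((\<lambda>y. - a \<bullet> y) ` M)"
        using M by (intro compact_continuous_image continuous_intros) (auto simp: convex_body_def)
      then have "bdd_above ((\<lambda>y. - a \<bullet> y) ` M)" by (intro bounded_imp_bdd_above compact_imp_bounded)
      then show ?thesis unfolding support_fun_def using x by (intro cSUP_upper)
    qed
    ultimately show False using ab(1) eq[of "- a"] by simp
  qed
qed

text \<open>Hahn-Banach in finite dimension: a hyperplane separates the boundary point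
  \<open>x\<close> from the convex set \<open>U\<close>, and its normal is rescaled to take the
  value 1 at \<open>x\<close>.\<close>

lemma norm_supporting_functional:
  fixes a :: "'a::euclidean_space \<Rightarrow> real"
  assumes a: "is_norm a" and x: "a x = 1"
  obtains y where "x \<bullet> y = 1" "\<And>z. z \<bullet> y \<le> a z"
proof -
  have s: "is_seminorm a" by (rule is_norm_seminorm[OF a])
  define U where "U = {z. a z < 1}"
  have "convex U"
    unfolding convex_alt
  proof (intro ballI allI impI)
    fix y z u assume "y \<in> U" "z \<in> U" "0 \<le> u \<and> u \<le> (1::real)"
    then have "a ((1 - u) *\<^sub>R y + u *\<^sub>R z) \<le> (1 - u) * a y + u * a z" "a y < 1" "a z < 1"
      using seminorm_combine[OF s, of "1 - u" y u z] by (auto simp: U_def)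
    moreover have "(1 - u) * a y + u * a z < 1"
      using \<open>0 \<le> u \<and> u \<le> 1\<close> \<open>a y < 1\<close> \<open>a z < 1\<close> convex_bound_lt[of "a y" 1 "a z" "1 - u" u] by simp
    ultimately show "(1 - u) *\<^sub>R y + u *\<^sub>R z \<in> U" by (simp add: U_def)
  qed
  moreover have "0 \<in> U" by (simp add: U_def seminorm_0[OF s])
  ultimately obtain w b where w: "w \<noteq> 0" "\<And>z. z \<in> U \<Longrightarrow> w \<bullet> z \<le> b" "w \<bullet> x \<ge> b"
    using separating_hyperplane_sets[of U "{x}"] x by (auto simp: U_def)
  have "a w > 0" using is_norm_pos[OF a w(1)] .
  \<comment> \<open>A point of \<open>U\<close> with positive inner product with \<open>w\<close>
    forces the separating value \<open>b\<close> to be positive, so that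
    \<open>w \<bullet> x\<close> may be divided by.\<close>
  have "(1 / (2 * a w)) *\<^sub>R w \<in> U" using \<open>a w > 0\<close> by (simp add: U_def is_seminormD(2)[OF s])
  from w(2)[OF this] w(1,3) \<open>a w > 0\<close> have p: "w \<bullet> x > 0"
    by (smt (verit) divide_pos_pos inner_gt_zero_iff inner_scaleR_right mult_pos_pos zero_less_one)
  define y where "y = (1 / (w \<bullet> x)) *\<^sub>R w"
  have U1: "z \<bullet> y \<le> 1" if "z \<in> U" for z
    using w(2)[OF that] w(3) p by (simp add: y_def inner_commute field_simps)
  have "z \<bullet> y \<le> a z" for z
  proof (rule field_le_epsilon)
    fix e :: real assume e: "0 < e"
    have n: "a z \<ge> 0" by (rule seminorm_nonneg[OF s])
    have "(1 / (a z + e)) *\<^sub>R z \<in> U" using n e by (simp add: U_def is_seminormD(2)[OF s])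
    from U1[OF this] show "z \<bullet> y \<le> a z + e" using n e by (simp add: field_simps)
  qed
  moreover have "x \<bullet> y = 1" using p by (simp add: y_def inner_commute)
  ultimately show ?thesis using that by blast
qed

text \<open>\<open>M\<close> is the unit ball of the dual norm. That its support function reaches
  \<open>a\<close>, and does not stay below it, is the existence of supporting functionals. This is
  the existence half of what \<open>THE\<close> asks for.\<close>

lemma convex_body_with_support_fun:
  fixes a :: "'a::euclidean_space \<Rightarrow> real"
  assumes a: "is_norm a"
  defines "M \<equiv> {y. \<forall>x. x \<bullet> y \<le> a x}"
  shows "convex_body M" "support_fun M = a"
proof -
  have s: "is_seminorm a" by (rule is_norm_seminorm[OF a])
  obtain r where r: "r > 0" "\<And>x. r * norm x \<le> a x" using a by (auto simp: is_norm_def)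
  obtain C where C: "C > 0" "\<And>x. a x \<le> C * norm x" using seminorm_upper_bound[OF s] by blast
  have M: "M = (\<Inter>x. {y. x \<bullet> y \<le> a x})" by (auto simp: M_def)
  have "norm y \<le> C" if "y \<in> M" for y
  proof (cases "y = 0")
    case False
    have "y \<bullet> y \<le> C * norm y" using that C(2)[of y] by (auto simp: M_def intro: order.trans)
    then show ?thesis using False by (simp add: dot_square_norm power2_eq_square)
  qed (use C in auto)
  then have "bounded M" by (auto simp: bounded_iff)
  moreover have "closed M" unfolding M by (intro closed_INT ballI closed_halfspace_le)
  moreover have "convex M" unfolding M by (intro convex_INT convex_halfspace_le)
  moreover have "cball 0 r \<subseteq> M"
  proof
    fix y assume y: "y \<in> cball (0::'a) r"
    show "y \<in> M" unfolding M_def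
    proof (intro CollectI allI)
      fix x
      have "x \<bullet> y \<le> norm x * norm y" by (rule norm_cauchy_schwarz)
      also have "\<dots> \<le> norm x * r" using y by (intro mult_left_mono) auto
      finally show "x \<bullet> y \<le> a x" using r(2)[of x] by (simp add: mult.commute)
    qed
  qed
  then have "0 \<in> interior M" using r(1) mem_interior_cball by blast
  ultimately show "convex_body M" by (auto simp: convex_body_def compact_eq_bounded_closed)
  show "support_fun M = a"
  proof
    fix x
    have ne: "M \<noteq> {}" using \<open>0 \<in> interior M\<close> interior_subset by blast
    have le: "support_fun M x \<le> a x" unfolding support_fun_def
      using ne by (intro cSUP_least) (auto simp: M_def)
    show "support_fun M x = a x"
    proof (cases "x = 0")
      case True
      then show ?thesis using ne by (simp add: support_fun_def seminorm_0[OF s])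
    next
      case False
      then have p: "a x > 0" by (rule is_norm_pos[OF a])
      then obtain y where y: "((1 / a x) *\<^sub>R x) \<bullet> y = 1" "\<And>z. z \<bullet> y \<le> a z"
        using norm_supporting_functional[OF a, of "(1 / a x) *\<^sub>R x"] by (auto simp: is_seminormD(2)[OF s])
      have "x \<bullet> y \<le> support_fun M x" unfolding support_fun_def
        by (rule cSUP_upper) (use y in \<open>auto simp: M_def bdd_above_def\<close>)
      moreover have "x \<bullet> y = a x" using y(1) p by simp
      ultimately show ?thesis using le by simp
    qed
  qed
qed

text \<open>The polar of the dual unit ball is the unit ball of \<open>a\<close>. From here on the
  bodies given by \<open>THE\<close> are replaced by sublevel sets of explicit functions.\<close>

lemma polar_body_THE_support_fun:
  fixes a :: "'a::euclidean_space \<Rightarrow> real"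
  assumes a: "is_norm a"
  shows "polar_body (THE M. convex_body M \<and> (\<forall>x. support_fun M x = a x)) = {x. a x \<le> 1}"
proof -
  define M where "M = {y. \<forall>x. x \<bullet> y \<le> a x}"
  have M: "convex_body M" "support_fun M = a"
    unfolding M_def using convex_body_with_support_fun[OF a] by auto
  have "(THE M. convex_body M \<and> (\<forall>x. support_fun M x = a x)) = M"
  proof (rule the_equality)
    fix N assume N: "convex_body N \<and> (\<forall>x. support_fun N x = a x)"
    then show "N = M"
      using M convex_body_eq_support_fun[of N M] convex_body_eq_support_fun[of M N] by (simp add: subset_antisym)
  qed (use M in auto)
  moreover have "polar_body M = {x. a x \<le> 1}"
  proof (intro equalityI subsetI CollectI)
    fix x assume x: "x \<in> polar_body M"
    have "M \<noteq> {}" using M(1) by (auto simp: convex_body_def)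
    then have "support_fun M x \<le> 1" unfolding support_fun_def
      using x by (intro cSUP_least) (auto simp: polar_body_def)
    then show "a x \<le> 1" using M(2) by simp
  next
    fix x assume "x \<in> {x. a x \<le> 1}"
    then show "x \<in> polar_body M" by (auto simp: polar_body_def M_def intro: order.trans)
  qed
  ultimately show ?thesis by simp
qed

section \<open>Volumes of the polar bodies\<close>

lemma nn_integral_lborel_affine:
  fixes f :: "'a::euclidean_space \<Rightarrow> ennreal" and c :: real
  assumes [measurable]: "f \<in> borel_measurable borel" and "c \<noteq> 0"
  shows "(\<integral>\<^sup>+x. f x \<partial>lborel) = ennreal (\<bar>c\<bar> ^ DIM('a)) * (\<integral>\<^sup>+x. f (t + c *\<^sub>R x) \<partial>lborel)"
  by (subst lborel_affine[OF \<open>c \<noteq> 0\<close>, of t])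
     (simp add: nn_integral_density nn_integral_distr nn_integral_cmult)

lemma emeasure_lborel_scale:
  fixes S :: "'a::euclidean_space set"
  assumes [measurable]: "S \<in> sets borel" and "c > 0"
  shows "emeasure lborel {x. (1 / c) *\<^sub>R x \<in> S} = ennreal (c ^ DIM('a)) * emeasure lborel S"
proof -
  have "emeasure lborel {x. (1 / c) *\<^sub>R x \<in> S} = (\<integral>\<^sup>+x. indicator {x. (1 / c) *\<^sub>R x \<in> S} x \<partial>lborel)"
    by (rule nn_integral_indicator[symmetric]) measurable
  also have "\<dots> = ennreal (\<bar>c\<bar> ^ DIM('a)) * (\<integral>\<^sup>+x. indicator {x. (1 / c) *\<^sub>R x \<in> S} (0 + c *\<^sub>R x) \<partial>lborel)"
    using \<open>c > 0\<close> by (intro nn_integral_lborel_affine) auto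
  also have "(\<integral>\<^sup>+x. indicator {x. (1 / c) *\<^sub>R x \<in> S} (0 + c *\<^sub>R x) \<partial>lborel) = (\<integral>\<^sup>+x. indicator S x \<partial>lborel)"
    using \<open>c > 0\<close> by (intro nn_integral_cong) (auto simp: indicator_def)
  finally show ?thesis using \<open>c > 0\<close> by simp
qed

lemma powr_convex_combination:
  fixes x y u v p :: real
  assumes p: "p \<ge> 1" and xy: "0 \<le> x" "0 \<le> y" and uv: "0 \<le> u" "0 \<le> v" "u + v = 1"
  shows "(u * x + v * y) powr p \<le> u * x powr p + v * y powr p"
proof (cases "x = 0 \<or> y = 0")
  case True
  have le: "(w * z) powr p \<le> w * z powr p" if "0 \<le> w" "w \<le> 1" "0 \<le> z" for w z
  proof -
    have "w powr p \<le> w powr 1" using that p by (intro powr_mono') auto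
    then have "w powr p * z powr p \<le> w * z powr p" using that by (intro mult_right_mono) auto
    then show ?thesis using that by (simp add: powr_mult)
  qed
  from True show ?thesis using le[of u x] le[of v y] xy uv p by auto
next
  case False
  then have "x > 0" "y > 0" using xy by auto
  then show ?thesis
    using convex_onD[OF powr_convex[OF p], of v x y] uv by (simp add: eq_diff_eq[symmetric])
qed

text \<open>When \<open>a\<close> and \<open>b\<close> are the support functions of the two
  summands, this is the p-th power of the support function of the sum. The power is convex and
  homogeneous of degree \<open>p\<close>, and it has the same unit sublevel set as its p-th
  root.\<close>

definition lp_energy :: "real \<Rightarrow> ('a \<Rightarrow> real) \<Rightarrow> ('a \<Rightarrow> real) \<Rightarrow> real \<Rightarrow> 'a \<Rightarrow> real" where
  "lp_energy p a b t x = a x powr p + exp t * b x powr p"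

definition lp_ball :: "real \<Rightarrow> ('a \<Rightarrow> real) \<Rightarrow> ('a \<Rightarrow> real) \<Rightarrow> real \<Rightarrow> 'a set" where
  "lp_ball p a b t = {x. lp_energy p a b t x \<le> 1}"

lemma lp_energy_nonneg: "0 \<le> lp_energy p a b t x"
  by (simp add: lp_energy_def)

context
  fixes p :: real and a b :: "'a::euclidean_space \<Rightarrow> real"
  assumes p: "p \<ge> 1" and a: "is_norm a" and b: "is_seminorm b"
begin

lemma lp_energy_scale: "lp_energy p a b t (c *\<^sub>R x) = \<bar>c\<bar> powr p * lp_energy p a b t x"
  using seminorm_nonneg[OF b] seminorm_nonneg[OF is_norm_seminorm[OF a]]
  by (simp add: lp_energy_def is_seminormD(2)[OF b] is_seminormD(2)[OF is_norm_seminorm[OF a]] powr_mult algebra_simps)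

lemma lp_energy_continuous: "continuous_on S (lp_energy p a b t)"
  unfolding lp_energy_def
  using seminorm_continuous[OF b] seminorm_continuous[OF is_norm_seminorm[OF a]]
    seminorm_nonneg[OF b] seminorm_nonneg[OF is_norm_seminorm[OF a]] p
  by (intro continuous_intros continuous_on_powr') auto

lemma lp_energy_measurable [measurable]: "lp_energy p a b t \<in> borel_measurable borel"
  by (intro borel_measurable_continuous_onI lp_energy_continuous)

lemma lp_energy_convex:
  assumes "0 \<le> u" "0 \<le> v" "u + v = 1"
  shows "lp_energy p a b t (u *\<^sub>R x + v *\<^sub>R y) \<le> u * lp_energy p a b t x + v * lp_energy p a b t y"
proof -
  have n: "n (u *\<^sub>R x + v *\<^sub>R y) powr p \<le> u * n x powr p + v * n y powr p" if "is_seminorm n" for n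
  proof -
    have "n (u *\<^sub>R x + v *\<^sub>R y) powr p \<le> (u * n x + v * n y) powr p"
      using seminorm_combine[OF that, of u x v y] seminorm_nonneg[OF that] assms p by (intro powr_mono2) auto
    also have "\<dots> \<le> u * n x powr p + v * n y powr p"
      by (rule powr_convex_combination[OF p seminorm_nonneg[OF that] seminorm_nonneg[OF that] assms])
    finally show ?thesis .
  qed
  have "exp t * b (u *\<^sub>R x + v *\<^sub>R y) powr p \<le> exp t * (u * b x powr p + v * b y powr p)"
    by (rule mult_left_mono[OF n[OF b]]) simp
  with n[OF is_norm_seminorm[OF a]] show ?thesis by (simp add: lp_energy_def algebra_simps)
qed

lemma lp_energy_eq_0_iff: "lp_energy p a b t x = 0 \<longleftrightarrow> x = 0"
proof
  assume "lp_energy p a b t x = 0"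
  then have "a x powr p = 0" using zero_le_mult_iff[of "exp t" "b x powr p"]
    by (auto simp: lp_energy_def add_nonneg_eq_0_iff)
  then show "x = 0" using is_norm_pos[OF a, of x] by auto
qed (simp add: lp_energy_def seminorm_0 b is_norm_seminorm[OF a])

text \<open>A homogeneous function with a convex unit ball is subadditive: \<open>x\<close> and
  \<open>y\<close> are scaled to energy 1, and \<open>x + y\<close> becomes a multiple of a convex
  combination of the scaled points.\<close>

lemma is_norm_lp_gauge: "is_norm (\<lambda>x. lp_energy p a b t x powr (1 / p))" (is "is_norm ?H")
proof (rule is_normI)
  have pos: "?H x > 0" if "x \<noteq> 0" for x
    using lp_energy_eq_0_iff[of t x] lp_energy_nonneg[of p a b t x] that by auto
  have scale: "?H (c *\<^sub>R x) = \<bar>c\<bar> * ?H x" for c x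
    using p by (simp add: lp_energy_scale powr_mult lp_energy_nonneg powr_powr)
  have H1: "lp_energy p a b t ((1 / ?H x) *\<^sub>R x) = 1" if "x \<noteq> 0" for x
    using pos[OF that] p lp_energy_nonneg[of p a b t x] by (simp add: lp_energy_scale powr_divide powr_powr)
  show "is_seminorm ?H"
    unfolding is_seminorm_def
  proof (intro conjI allI scale)
    fix x y
    show "?H (x + y) \<le> ?H x + ?H y"
    proof (cases "x = 0 \<or> y = 0")
      case True
      have "lp_energy p a b t 0 = 0" by (simp add: lp_energy_eq_0_iff)
      then show ?thesis using True by auto
    next
      case False
      let ?s = "?H x + ?H y"
      have s: "?H x > 0" "?H y > 0" using False pos by auto
      have "?s / ?s = 1" using s by (intro divide_self) linarith
      then have s1: "?H x / ?s + ?H y / ?s = 1" by (simp only: add_divide_distrib)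
      have eq: "(1 / ?s) *\<^sub>R (x + y) = (?H x / ?s) *\<^sub>R ((1 / ?H x) *\<^sub>R x) + (?H y / ?s) *\<^sub>R ((1 / ?H y) *\<^sub>R y)"
        using s by (simp add: scaleR_add_right)
      have "lp_energy p a b t ((1 / ?s) *\<^sub>R (x + y)) \<le> ?H x / ?s * 1 + ?H y / ?s * 1"
        unfolding eq
      proof (rule order.trans[OF lp_energy_convex])
        show "?H x / ?s + ?H y / ?s = 1" by (rule s1)
      qed (use s False H1 in auto)
      also have "\<dots> = 1" using s1 by simp
      finally have "?H ((1 / ?s) *\<^sub>R (x + y)) \<le> 1 powr (1 / p)"
        using p by (intro powr_mono2 lp_energy_nonneg) auto
      then show ?thesis unfolding scale using s by (simp add: field_simps)
    qed
  qed
  show "0 < ?H x" if "x \<noteq> 0" for x by (rule pos[OF that])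
qed

lemma lp_ball_gauge: "lp_ball p a b t = {x. lp_energy p a b t x powr (1 / p) \<le> 1}"
proof -
  have "q powr (1 / p) \<le> 1 \<longleftrightarrow> q \<le> 1" if "q \<ge> 0" for q
  proof
    assume "q powr (1 / p) \<le> 1"
    then have "(q powr (1 / p)) powr p \<le> 1 powr p" using p by (intro powr_mono2) auto
    then show "q \<le> 1" using that p by (simp add: powr_powr)
  next
    assume "q \<le> 1"
    then show "q powr (1 / p) \<le> 1" using powr_mono2[of "1 / p" q 1] that p by simp
  qed
  then show ?thesis by (simp add: lp_ball_def lp_energy_nonneg)
qed

lemma lp_ball_borel [measurable]: "lp_ball p a b t \<in> sets borel"
  unfolding lp_ball_def by measurable

lemma emeasure_lp_ball_finite: "emeasure lborel (lp_ball p a b t) < \<infinity>"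
proof -
  obtain r where r: "r > 0" "\<And>x. r * norm x \<le> lp_energy p a b t x powr (1 / p)"
    using is_norm_lp_gauge[of t] by (auto simp: is_norm_def)
  have "lp_ball p a b t \<subseteq> cball 0 (1 / r)"
  proof
    fix x assume "x \<in> lp_ball p a b t"
    then have "r * norm x \<le> 1" using r(2)[of x] by (simp add: lp_ball_gauge)
    then show "x \<in> cball 0 (1 / r)" using r(1) by (simp add: field_simps)
  qed
  then have "emeasure lborel (lp_ball p a b t) \<le> emeasure lborel (cball (0::'a) (1 / r))"
    by (intro emeasure_mono) auto
  also have "\<dots> < \<infinity>" by (rule emeasure_lborel_cball_finite)
  finally show ?thesis .
qed

lemma emeasure_lp_ball_pos: "emeasure lborel (lp_ball p a b t) > 0"
proof -
  have "open (lp_energy p a b t -` {..<1})"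
    by (intro open_vimage lp_energy_continuous) auto
  moreover have "0 \<in> lp_energy p a b t -` {..<1}"
    using lp_energy_eq_0_iff[of t 0] by simp
  ultimately obtain e where e: "e > 0" "ball 0 e \<subseteq> lp_energy p a b t -` {..<1}"
    by (meson openE)
  have "0 < emeasure lborel (ball (0::'a) e)"
  proof (rule ccontr)
    assume "\<not> 0 < emeasure lborel (ball (0::'a) e)"
    then have "measure lborel (ball (0::'a) e) = 0" by (simp add: measure_def)
    then show False using content_ball_pos[OF e(1), of "0::'a"] by simp
  qed
  also have "\<dots> \<le> emeasure lborel (lp_ball p a b t)"
    using e(2) by (intro emeasure_mono) (auto simp: lp_ball_def)
  finally show ?thesis .
qed

lemma lp_ball_antimono:
  assumes "s \<le> t"
  shows "lp_ball p a b t \<subseteq> lp_ball p a b s"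
proof -
  have "exp s * b x powr p \<le> exp t * b x powr p" for x
    using assms by (intro mult_right_mono) auto
  then show ?thesis unfolding lp_ball_def lp_energy_def by (smt (verit) Collect_mono)
qed

text \<open>Shrinking by the factor \<open>c = exp ((t - s) / p)\<close> exactly compensates the
  change of weight from \<open>exp s\<close> to \<open>exp t\<close> and only lowers the
  contribution of \<open>a\<close>; thus the ball at \<open>s\<close> lies in the dilate by
  \<open>c\<close> of the ball at \<open>t\<close>. The bound makes the logarithm of the volume
  Lipschitz.\<close>

lemma emeasure_lp_ball_le:
  assumes "s \<le> t"
  shows "emeasure lborel (lp_ball p a b s)
    \<le> ennreal (exp (real DIM('a) / p * (t - s))) * emeasure lborel (lp_ball p a b t)"
proof -
  define c where "c = exp ((t - s) / p)"
  have "1 / c = exp (- ((t - s) / p))" by (simp add: c_def exp_minus divide_inverse)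
  then have c: "c > 0" "(1 / c) powr p = exp (- (t - s))"
    using p by (simp_all add: c_def exp_powr_real)
  have "lp_ball p a b s \<subseteq> {x. (1 / c) *\<^sub>R x \<in> lp_ball p a b t}"
  proof (intro subsetI CollectI)
    fix x assume "x \<in> lp_ball p a b s"
    then have x: "lp_energy p a b s x \<le> 1" by (simp add: lp_ball_def)
    have "lp_energy p a b t ((1 / c) *\<^sub>R x) = exp (- (t - s)) * lp_energy p a b t x"
      using c by (simp add: lp_energy_scale)
    also have "\<dots> = exp (- (t - s)) * a x powr p + exp s * b x powr p"
      by (simp add: lp_energy_def algebra_simps flip: exp_add mult.assoc)
    also have "\<dots> \<le> lp_energy p a b s x"
      using assms by (simp add: lp_energy_def mult_left_le_one_le)
    finally show "(1 / c) *\<^sub>R x \<in> lp_ball p a b t" using x by (simp add: lp_ball_def)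
  qed
  then have "emeasure lborel (lp_ball p a b s) \<le> emeasure lborel {x. (1 / c) *\<^sub>R x \<in> lp_ball p a b t}"
    by (intro emeasure_mono) (auto simp: pred_def)
  also have "\<dots> = ennreal (c ^ DIM('a)) * emeasure lborel (lp_ball p a b t)"
    using c by (intro emeasure_lborel_scale) auto
  also have "c ^ DIM('a) = exp (real DIM('a) / p * (t - s))"
    by (simp add: c_def flip: exp_of_nat_mult)
  finally show ?thesis .
qed

end

section \<open>Exponential integrals, and log-concavity from midpoints\<close>

lemma exp_minus_eq_nn_integral:
  assumes "q \<ge> 0"
  shows "ennreal (exp (- q)) = (\<integral>\<^sup>+r. ennreal (exp (- r)) * indicator {q..} r \<partial>lborel)"
proof -
  have "((\<lambda>x::real. exp (- x)) \<longlongrightarrow> 0) at_top"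
    by (rule filterlim_compose[OF exp_at_bot filterlim_uminus_at_bot_at_top])
  then have "((\<lambda>x::real. - exp (- x)) \<longlongrightarrow> 0) at_top" using tendsto_minus by fastforce
  then have "(\<integral>\<^sup>+r. ennreal (exp (- r)) * indicator {q..} r \<partial>lborel) = ennreal (0 - (- exp (- q)))"
    by (intro nn_integral_FTC_atLeast) (auto intro!: derivative_eq_intros)
  then show ?thesis by simp
qed

text \<open>By homogeneity the sublevel set of the energy at height \<open>r\<close> has
  \<open>r powr (n / p)\<close> times the volume of the unit ball, \<open>n\<close> being the
  dimension. Integrating this against \<open>exp (- r)\<close> gives a Gamma value that does not
  depend on \<open>t\<close>.\<close>

lemma nn_integral_exp_lp_energy:
  fixes a b :: "'a::euclidean_space \<Rightarrow> real"
  assumes p: "p \<ge> 1" and a: "is_norm a" and b: "is_seminorm b"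
  shows "(\<integral>\<^sup>+x. ennreal (exp (- lp_energy p a b t x)) \<partial>lborel)
    = ennreal (Gamma (real DIM('a) / p + 1)) * emeasure lborel (lp_ball p a b t)"
proof -
  let ?Q = "lp_energy p a b t" and ?n = "real DIM('a)"
  note [measurable] = lp_energy_measurable[OF assms] lp_ball_borel[OF assms]
  have "(\<integral>\<^sup>+x. ennreal (exp (- ?Q x)) \<partial>lborel)
    = (\<integral>\<^sup>+x. (\<integral>\<^sup>+r. ennreal (exp (- r)) * indicator {r. ?Q x \<le> r} r \<partial>lborel) \<partial>lborel)"
    by (simp add: exp_minus_eq_nn_integral lp_energy_nonneg atLeast_def)
  also have "\<dots> = (\<integral>\<^sup>+r. (\<integral>\<^sup>+x. ennreal (exp (- r)) * indicator {r. ?Q x \<le> r} r \<partial>lborel) \<partial>lborel)"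
    by (rule lborel_pair.Fubini'[symmetric]) measurable
  \<comment> \<open>The exponent keeps the summands \<open>+ 1 - 1\<close> so that the integrand is
    literally that of the Gamma integral.\<close>
  also have "\<dots> = (\<integral>\<^sup>+r. ennreal (indicator {0..} r * r powr (?n / p + 1 - 1) / exp r) * emeasure lborel (lp_ball p a b t) \<partial>lborel)"
  proof (rule nn_integral_cong)
    fix r :: real
    have "(\<integral>\<^sup>+x. ennreal (exp (- r)) * indicator {r. ?Q x \<le> r} r \<partial>lborel)
      = ennreal (exp (- r)) * (\<integral>\<^sup>+x. indicator {x. ?Q x \<le> r} x \<partial>lborel)"
      by (subst nn_integral_cmult[symmetric]) (auto intro!: nn_integral_cong simp: indicator_def)
    also have "(\<integral>\<^sup>+x. indicator {x. ?Q x \<le> r} x \<partial>lborel) = emeasure lborel {x. ?Q x \<le> r}"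
      by (rule nn_integral_indicator) measurable
    also have "\<dots> = ennreal (indicator {0..} r * r powr (?n / p)) * emeasure lborel (lp_ball p a b t)"
    proof (cases "r > 0")
      case True
      define c where "c = r powr (1 / p)"
      have c: "c > 0" "(1 / c) powr p = 1 / r" "c ^ DIM('a) = r powr (?n / p)"
        using True p by (simp_all add: c_def powr_divide powr_powr flip: powr_realpow)
      have "{x. ?Q x \<le> r} = {x. (1 / c) *\<^sub>R x \<in> lp_ball p a b t}"
        using c(1) True by (simp add: lp_ball_def lp_energy_scale[OF assms] c(2))
      then show ?thesis using c True emeasure_lborel_scale[of "lp_ball p a b t" c] by simp
    next
      case False
      have "{x. ?Q x \<le> r} \<subseteq> {0}"
        using False lp_energy_nonneg[of p a b t] lp_energy_eq_0_iff[OF assms, of t]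
        by (auto simp: not_less) (metis dual_order.antisym order.trans)
      then have "emeasure lborel {x. ?Q x \<le> r} = 0"
        by (meson emeasure_lborel_countable finite.emptyI finite.insertI countable_finite countable_subset)
      then show ?thesis using False by (auto simp: indicator_def not_less)
    qed
    finally show "(\<integral>\<^sup>+x. ennreal (exp (- r)) * indicator {r. ?Q x \<le> r} r \<partial>lborel)
      = ennreal (indicator {0..} r * r powr (?n / p + 1 - 1) / exp r) * emeasure lborel (lp_ball p a b t)"
      by (simp add: exp_minus divide_inverse ennreal_mult' mult_ac)
  qed
  also have "\<dots> = ennreal (Gamma (?n / p + 1)) * emeasure lborel (lp_ball p a b t)"
    using p by (subst nn_integral_multc) (auto simp: Gamma_conv_nn_integral_real add_nonneg_pos)
  finally show ?thesis .
qed

lemma midpoint_volume_from_integral: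
  fixes a b :: "'a::euclidean_space \<Rightarrow> real"
  assumes p: "p \<ge> 1" and a: "is_norm a" and b: "is_seminorm b"
    and le: "(\<integral>\<^sup>+x. ennreal (exp (- lp_energy p a b s x)) \<partial>lborel) * (\<integral>\<^sup>+x. ennreal (exp (- lp_energy p a b t x)) \<partial>lborel)
       \<le> (\<integral>\<^sup>+x. ennreal (exp (- lp_energy p a b ((s + t) / 2) x)) \<partial>lborel)\<^sup>2"
  shows "emeasure lborel (lp_ball p a b s) * emeasure lborel (lp_ball p a b t)
    \<le> (emeasure lborel (lp_ball p a b ((s + t) / 2)))\<^sup>2"
proof -
  let ?G = "Gamma (real DIM('a) / p + 1)"
  have G: "?G > 0" using p by (intro Gamma_real_pos add_nonneg_pos) auto
  have "(ennreal ?G)\<^sup>2 * (emeasure lborel (lp_ball p a b s) * emeasure lborel (lp_ball p a b t))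
    \<le> (ennreal ?G)\<^sup>2 * (emeasure lborel (lp_ball p a b ((s + t) / 2)))\<^sup>2"
    using le unfolding nn_integral_exp_lp_energy[OF p a b] by (simp add: power2_eq_square mult_ac)
  then show ?thesis using G
    by (subst (asm) ennreal_mult_le_mult_iff) (auto simp: ennreal_power)
qed

text \<open>Midpoint concavity of \<open>ln V\<close> together with continuity gives concavity.
  Continuity comes from \<open>anti\<close> and \<open>growth\<close>, which make
  \<open>ln V\<close> Lipschitz with constant \<open>\<bar>k\<bar>\<close>; positivity keeps the
  value minus infinity of \<open>ext_ln\<close> out of play.\<close>

lemma log_concave_fun_from_midpoint:
  fixes V :: "real \<Rightarrow> real"
  assumes pos: "\<And>t. 0 < V t" and anti: "\<And>s t. s \<le> t \<Longrightarrow> V t \<le> V s"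
    and growth: "\<And>s t. s \<le> t \<Longrightarrow> V s \<le> exp (k * (t - s)) * V t"
    and mid: "\<And>s t. V s * V t \<le> (V ((s + t) / 2))\<^sup>2"
  shows "log_concave_fun V"
proof -
  define g where "g t = ln (V t)" for t
  have gl: "\<bar>g s - g t\<bar> \<le> \<bar>k\<bar> * \<bar>s - t\<bar>" for s t
  proof (induction s t rule: linorder_wlog)
    case (le s t)
    have "g s \<le> ln (exp (k * (t - s)) * V t)"
      unfolding g_def using growth[OF le] pos[of s] pos[of t] by (simp add: ln_le_cancel_iff)
    also have "\<dots> = k * (t - s) + g t" using pos[of t] by (simp add: g_def ln_mult)
    finally have "g s - g t \<le> k * (t - s)" by simp
    also have "\<dots> \<le> \<bar>k\<bar> * \<bar>s - t\<bar>" using le by (simp add: mult_right_mono)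
    finally have "g s - g t \<le> \<bar>k\<bar> * \<bar>s - t\<bar>" .
    moreover have "g t \<le> g s" unfolding g_def using anti[OF le] pos by (simp add: ln_le_cancel_iff)
    ultimately show ?case by simp
  qed (simp add: abs_minus_commute)
  have "(\<bar>k\<bar>)-lipschitz_on UNIV g"
    by (rule lipschitz_onI) (use gl in \<open>auto simp: dist_real_def\<close>)
  then have cont: "continuous_on UNIV g" by (rule lipschitz_on_continuous_on)
  have gm: "g s + g t \<le> 2 * g ((s + t) / 2)" for s t
  proof -
    have "ln (V s * V t) \<le> ln ((V ((s + t) / 2))\<^sup>2)"
      using mid[of s t] pos[of s] pos[of t] by (intro ln_mono) auto
    then show ?thesis using pos[of s] pos[of t] pos[of "(s + t) / 2"] by (simp add: g_def ln_mult ln_realpow)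
  qed
  have conc: "(1 - u) * g x + u * g y \<le> g ((1 - u) * x + u * y)" if u: "0 \<le> u" "u \<le> 1" for u x y
  proof -
    define h where "h u = g ((1 - u) * x + u * y) - ((1 - u) * g x + u * g y)" for u
    have "continuous_on {0..1} h"
      unfolding h_def by (intro continuous_intros continuous_on_compose2[OF cont]) auto
    then obtain m where m: "m \<in> {0..1}" "\<And>v. v \<in> {0..1} \<Longrightarrow> h m \<le> h v"
      using continuous_attains_inf[of "{0..1::real}" h] by auto
    have h01: "h 0 = 0" "h 1 = 0" by (simp_all add: h_def)
    have hm: "h v + h w \<le> 2 * h ((v + w) / 2)" for v w
    proof -
      have "((1 - v) * x + v * y + ((1 - w) * x + w * y)) / 2 = (1 - (v + w) / 2) * x + (v + w) / 2 * y"
        by (simp add: field_simps)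
      then have "g ((1 - v) * x + v * y) + g ((1 - w) * x + w * y) \<le> 2 * g ((1 - (v + w) / 2) * x + (v + w) / 2 * y)"
        using gm[of "(1 - v) * x + v * y" "(1 - w) * x + w * y"] by metis
      moreover have "((1 - v) * g x + v * g y) + ((1 - w) * g x + w * g y)
        = 2 * ((1 - (v + w) / 2) * g x + (v + w) / 2 * g y)" by (simp add: field_simps)
      moreover have "(A - X) + (B - Y) \<le> 2 * (C - Z)" if "A + B \<le> 2 * C" "X + Y = 2 * Z" for A B C X Y Z :: real
        using that by simp
      ultimately show ?thesis unfolding h_def by blast
    qed
    \<comment> \<open>The minimum point \<open>m\<close> of the difference from the chord is the
      midpoint of the nearer endpoint, where \<open>h\<close> vanishes, and a point where
      \<open>h\<close> is at least \<open>h m\<close>. Midpoint concavity then bounds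
      \<open>h m\<close> below by 0.\<close>
    have "0 \<le> h m"
    proof (cases "m \<le> 1/2")
      case True
      have "h 0 + h (2 * m) \<le> 2 * h m" using hm[of 0 "2 * m"] by simp
      moreover have "h m \<le> h (2 * m)" using True m by (intro m(2)) auto
      ultimately show ?thesis using h01 by simp
    next
      case False
      have "h 1 + h (2 * m - 1) \<le> 2 * h m" using hm[of 1 "2 * m - 1"] by simp
      moreover have "h m \<le> h (2 * m - 1)" using False m by (intro m(2)) auto
      ultimately show ?thesis using h01 by simp
    qed
    also have "h m \<le> h u" using u by (intro m(2)) auto
    finally show ?thesis by (simp add: h_def)
  qed
  have "ext_ln (V t) = ereal (g t)" for t using pos[of t] by (simp add: ext_ln_def g_def)
  then show ?thesis
    using conc pos by (auto simp: log_concave_fun_def less_imp_le)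
qed

lemma log_concave_fun_lp_ball:
  fixes a b :: "'a::euclidean_space \<Rightarrow> real"
  assumes p: "p \<ge> 1" and a: "is_norm a" and b: "is_seminorm b"
    and mid: "\<And>s t. emeasure lborel (lp_ball p a b s) * emeasure lborel (lp_ball p a b t)
      \<le> (emeasure lborel (lp_ball p a b ((s + t) / 2)))\<^sup>2"
  shows "log_concave_fun (\<lambda>t. measure lebesgue (lp_ball p a b t))"
proof (rule log_concave_fun_from_midpoint)
  note [measurable] = lp_ball_borel[OF p a b]
  let ?V = "\<lambda>t. measure lebesgue (lp_ball p a b t)"
  have V: "emeasure lborel (lp_ball p a b t) = ennreal (?V t)" for t
    using emeasure_lp_ball_finite[OF p a b, of t] by (simp add: emeasure_eq_ennreal_measure)
  show "0 < ?V t" for t using emeasure_lp_ball_pos[OF p a b, of t] by (simp add: V)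
  show "?V t \<le> ?V s" if "s \<le> t" for s t
    using emeasure_mono[OF lp_ball_antimono[OF p a b that], of lborel] by (simp add: V)
  show "?V s \<le> exp (real DIM('a) / p * (t - s)) * ?V t" if "s \<le> t" for s t
    using emeasure_lp_ball_le[OF p a b that] by (simp add: V flip: ennreal_mult)
  show "?V s * ?V t \<le> (?V ((s + t) / 2))\<^sup>2" for s t
    using mid[of s t] by (simp add: V ennreal_power flip: ennreal_mult)
qed

lemma polar_body_Lp_sum:
  fixes K L :: "'a::euclidean_space set"
  assumes p: "p \<ge> 1" and a: "is_norm (support_fun K)" and b: "is_seminorm (support_fun L)"
  shows "polar_body (Lp_sum p K (exp t) L) = lp_ball p (support_fun K) (support_fun L) t"
  unfolding lp_ball_gauge[OF assms] Lp_sum_def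
  using polar_body_THE_support_fun[OF is_norm_lp_gauge[OF assms, of t]] by (simp add: lp_energy_def)

section \<open>Unconditional bodies\<close>

text \<open>Uniqueness of Haar measure, by Fubini: both sides count the pairs \<open>(x, y)\<close> with
  \<open>f x \<in> A\<close> and \<open>y - f x\<close> in the unit ball.\<close>

lemma emeasure_lborel_linear_vimage:
  fixes f :: "'a::euclidean_space \<Rightarrow> 'b::euclidean_space"
  assumes f: "linear f" "bij f"
  obtains k where "0 < k" "\<And>A. A \<in> sets borel \<Longrightarrow> emeasure lborel (f -` A) = ennreal k * emeasure lborel A"
proof -
  have cont: "continuous_on UNIV f" using f(1) by (simp add: linear_continuous_on linear_conv_bounded_linear)
  have mf [measurable]: "f \<in> borel_measurable borel" by (rule borel_measurable_continuous_onI[OF cont])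
  define C where "C = cball (0::'b) 1"
  have [measurable]: "C \<in> sets borel" by (simp add: C_def)
  define E where "E = {x. - f x \<in> C}"
  have [measurable]: "E \<in> sets borel" unfolding E_def by measurable
  have key: "emeasure lborel (f -` A) * emeasure lborel C = emeasure lborel A * emeasure lborel E"
    if [measurable]: "A \<in> sets borel" for A
  proof -
    define iA iC iE where "iA = (indicator A :: 'b \<Rightarrow> ennreal)"
      and "iC = (indicator C :: 'b \<Rightarrow> ennreal)" and "iE = (indicator E :: 'a \<Rightarrow> ennreal)"
    have [measurable]: "iA \<in> borel_measurable borel" "iC \<in> borel_measurable borel" "iE \<in> borel_measurable borel"
      by (simp_all add: iA_def iC_def iE_def)
    have int: "(\<integral>\<^sup>+x. iA x \<partial>lborel) = emeasure lborel A" "(\<integral>\<^sup>+x. iC x \<partial>lborel) = emeasure lborel C"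
      "(\<integral>\<^sup>+x. iE x \<partial>lborel) = emeasure lborel E" by (simp_all add: iA_def iC_def iE_def)
    have vA [measurable]: "f -` A \<in> sets borel" using measurable_sets[OF mf that] by simp
    have "emeasure lborel (f -` A) * emeasure lborel C
      = (\<integral>\<^sup>+x. iA (f x) * (\<integral>\<^sup>+y. iC y \<partial>lborel) \<partial>lborel)"
    proof -
      have "(\<integral>\<^sup>+x. iA (f x) \<partial>lborel) = (\<integral>\<^sup>+x. indicator (f -` A) x \<partial>lborel)"
        by (intro nn_integral_cong) (auto simp: indicator_def iA_def)
      then show ?thesis by (simp add: nn_integral_multc int)
    qed
    also have "\<dots> = (\<integral>\<^sup>+x. (\<integral>\<^sup>+y. iA (f x) * iC (y - f x) \<partial>lborel) \<partial>lborel)"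
    proof (rule nn_integral_cong)
      fix x
      have "(\<integral>\<^sup>+y. iC y \<partial>lborel) = (\<integral>\<^sup>+y. iC (y - f x) \<partial>lborel)"
        by (subst nn_integral_lborel_affine[where c = 1 and t = "- f x"]) auto
      then show "iA (f x) * (\<integral>\<^sup>+y. iC y \<partial>lborel)
        = (\<integral>\<^sup>+y. iA (f x) * iC (y - f x) \<partial>lborel)"
        by (simp add: nn_integral_cmult)
    qed
    also have "\<dots> = (\<integral>\<^sup>+y. (\<integral>\<^sup>+x. iA (f x) * iC (y - f x) \<partial>lborel) \<partial>lborel)"
      by (rule lborel_pair.Fubini'[symmetric]) measurable
    also have "\<dots> = (\<integral>\<^sup>+y. (\<integral>\<^sup>+x. iA (f x + y) * iE x \<partial>lborel) \<partial>lborel)"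
    proof (rule nn_integral_cong)
      fix y
      \<comment> \<open>Translating by a preimage of \<open>y\<close> turns the condition on
        \<open>y - f x\<close> into membership of \<open>x\<close> in the fixed set
        \<open>E\<close>, so the double integral factors.\<close>
      obtain z where z: "f z = y" using f(2) by (metis bij_pointE)
      have "(\<integral>\<^sup>+x. iA (f x) * iC (y - f x) \<partial>lborel)
        = ennreal (\<bar>1\<bar> ^ DIM('a)) * (\<integral>\<^sup>+x. iA (f (z + 1 *\<^sub>R x)) * iC (y - f (z + 1 *\<^sub>R x)) \<partial>lborel)"
        by (rule nn_integral_lborel_affine) auto
      also have "\<dots> = (\<integral>\<^sup>+x. iA (f x + y) * iE x \<partial>lborel)"
        by (simp add: linear_add[OF f(1)] z E_def iE_def iC_def add.commute indicator_def)
      finally show "(\<integral>\<^sup>+x. iA (f x) * iC (y - f x) \<partial>lborel)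
        = (\<integral>\<^sup>+x. iA (f x + y) * iE x \<partial>lborel)" .
    qed
    also have "\<dots> = (\<integral>\<^sup>+x. (\<integral>\<^sup>+y. iA (f x + y) * iE x \<partial>lborel) \<partial>lborel)"
      by (rule lborel_pair.Fubini') measurable
    also have "\<dots> = (\<integral>\<^sup>+x. emeasure lborel A * iE x \<partial>lborel)"
    proof (rule nn_integral_cong)
      fix x
      have "(\<integral>\<^sup>+y. iA (f x + y) \<partial>lborel) = (\<integral>\<^sup>+y. iA y \<partial>lborel)"
        by (subst (2) nn_integral_lborel_affine[where c = 1 and t = "f x"]) auto
      then show "(\<integral>\<^sup>+y. iA (f x + y) * iE x \<partial>lborel) = emeasure lborel A * iE x"
        by (simp add: nn_integral_multc int)
    qed
    also have "\<dots> = emeasure lborel A * emeasure lborel E" by (simp add: nn_integral_cmult int)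
    finally show ?thesis .
  qed
  have inj: "inj f" using f(2) by (rule bij_is_inj)
  obtain B where B: "B > 0" "\<And>x. norm x \<le> B * norm (f x)"
  proof -
    obtain g where g: "linear g" "\<And>x. g (f x) = x"
      using linear_injective_left_inverse[OF f(1) inj] by (metis comp_apply id_apply)
    obtain B where "B > 0" "\<And>x. norm (g x) \<le> B * norm x"
      using linear_bounded_pos[OF g(1)] by blast
    then show ?thesis using that g(2) by metis
  qed
  have "E \<subseteq> cball 0 B"
  proof
    fix x assume "x \<in> E"
    then have "norm (f x) \<le> 1" by (simp add: E_def C_def)
    then have "B * norm (f x) \<le> B * 1" using B(1) by (intro mult_left_mono) auto
    then show "x \<in> cball 0 B" using B(2)[of x] by simp
  qed
  then have Efin: "emeasure lborel E < \<infinity>"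
    using emeasure_mono[of E "cball 0 B" lborel] emeasure_lborel_cball_finite[of "0::'a" B] by (auto intro: le_less_trans)
  have Cfin: "emeasure lborel C < \<infinity>" unfolding C_def by (rule emeasure_lborel_cball_finite)
  have pos: "0 < emeasure lborel (S::'c::euclidean_space set)" if "cball 0 r \<subseteq> S" "0 < r" "S \<in> sets borel" for S r
  proof -
    have "0 < emeasure lborel (cball (0::'c) r)"
    proof (rule ccontr)
      assume "\<not> 0 < emeasure lborel (cball (0::'c) r)"
      then have "measure lborel (cball (0::'c) r) = 0" by (simp add: measure_def)
      then show False using content_cball_pos[OF that(2), of "0::'c"] by simp
    qed
    also have "\<dots> \<le> emeasure lborel S" using that by (intro emeasure_mono) auto
    finally show ?thesis .
  qed
  have Cpos: "0 < emeasure lborel C" by (rule pos[of 1]) (auto simp: C_def)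
  obtain b where b: "b > 0" "\<And>x. norm (f x) \<le> b * norm x" using linear_bounded_pos[OF f(1)] by blast
  have "cball 0 (1 / b) \<subseteq> E"
  proof
    fix x assume "x \<in> cball (0::'a) (1 / b)"
    then have "b * norm x \<le> 1" using b(1) by (simp add: field_simps)
    then show "x \<in> E" using b(2)[of x] by (simp add: E_def C_def)
  qed
  then have Epos: "0 < emeasure lborel E" using b(1) pos[of "1 / b" E] by simp
  obtain e where e: "emeasure lborel E = ennreal e" "e > 0" using Efin Epos by (cases "emeasure lborel E") auto
  obtain c where c: "emeasure lborel C = ennreal c" "c > 0" using Cfin Cpos by (cases "emeasure lborel C") auto
  have "emeasure lborel (f -` A) = ennreal (e / c) * emeasure lborel A" if "A \<in> sets borel" for A
  proof -
    have "ennreal c * emeasure lborel (f -` A) = ennreal c * (ennreal (e / c) * emeasure lborel A)"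
    proof -
      have ec: "ennreal e = ennreal c * ennreal (e / c)" using c(2) e(2) by (simp flip: ennreal_mult')
      have "emeasure lborel (f -` A) * ennreal c = emeasure lborel A * (ennreal c * ennreal (e / c))"
        using key[OF that] unfolding e(1) c(1) ec .
      then show ?thesis by (simp only: mult_ac)
    qed
    then show ?thesis using c(2) by (simp add: ennreal_mult_cancel_left)
  qed
  then show ?thesis using that[of "e / c"] e(2) c(2) by simp
qed

text \<open>All volumes change by one factor \<open>k\<close>, which occurs squared on both sides.
  This allows coordinates adapted to the bodies: a given orthonormal basis becomes the standard one,
  a segment becomes parallel to an axis, and planar bodies move to
  \<open>real \<times> real\<close>.\<close>

lemma midpoint_volume_linear_image:
  fixes f :: "'a::euclidean_space \<Rightarrow> 'b::euclidean_space" and a b :: "'b \<Rightarrow> real"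
  assumes f: "linear f" "bij f" and p: "p \<ge> 1" and a: "is_norm a" and b: "is_seminorm b"
    and mid: "emeasure lborel (lp_ball p (\<lambda>x. a (f x)) (\<lambda>x. b (f x)) s) * emeasure lborel (lp_ball p (\<lambda>x. a (f x)) (\<lambda>x. b (f x)) t)
    \<le> (emeasure lborel (lp_ball p (\<lambda>x. a (f x)) (\<lambda>x. b (f x)) ((s + t) / 2)))\<^sup>2"
  shows "emeasure lborel (lp_ball p a b s) * emeasure lborel (lp_ball p a b t)
    \<le> (emeasure lborel (lp_ball p a b ((s + t) / 2)))\<^sup>2"
proof -
  obtain k where k: "0 < k" "\<And>A. A \<in> sets borel \<Longrightarrow> emeasure lborel (f -` A) = ennreal k * emeasure lborel A"
    using emeasure_lborel_linear_vimage[OF f] by blast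
  have "lp_ball p (\<lambda>x. a (f x)) (\<lambda>x. b (f x)) t = f -` lp_ball p a b t" for t
    by (auto simp: lp_ball_def lp_energy_def)
  then have eq: "emeasure lborel (lp_ball p (\<lambda>x. a (f x)) (\<lambda>x. b (f x)) t) = ennreal k * emeasure lborel (lp_ball p a b t)" for t
    using k(2) lp_ball_borel[OF p a b] by simp
  have "(ennreal k)\<^sup>2 * (emeasure lborel (lp_ball p a b s) * emeasure lborel (lp_ball p a b t))
    \<le> (ennreal k)\<^sup>2 * (emeasure lborel (lp_ball p a b ((s + t) / 2)))\<^sup>2"
    using mid unfolding eq by (simp add: power2_eq_square mult_ac)
  then show ?thesis using k(1) by (subst (asm) ennreal_mult_le_mult_iff) (auto simp: ennreal_power)
qed

definition refl_coord :: "'a::euclidean_space \<Rightarrow> 'a \<Rightarrow> 'a" where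
  "refl_coord u x = x - (2 * (x \<bullet> u)) *\<^sub>R u"

lemma inner_refl_coord:
  assumes "u \<in> Basis" "v \<in> Basis"
  shows "refl_coord u x \<bullet> v = (if v = u then - (x \<bullet> u) else x \<bullet> v)"
  using assms by (simp add: refl_coord_def inner_diff_left inner_Basis)

text \<open>Changing one coordinate without increasing its modulus produces a convex combination of
  the point and its reflection: if \<open>l\<close> is the ratio of the new to the old coordinate,
  the weights are \<open>(1 + l) / 2\<close> and \<open>(1 - l) / 2\<close>. The points
  \<open>w B\<close> lead from \<open>y\<close> to \<open>x\<close> one coordinate at a
  time.\<close>

lemma unconditional_seminorm_mono:
  fixes n :: "'a::euclidean_space \<Rightarrow> real"
  assumes n: "is_seminorm n" and unc: "\<And>u x. u \<in> Basis \<Longrightarrow> n (refl_coord u x) = n x"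
    and le: "\<And>u. u \<in> Basis \<Longrightarrow> \<bar>x \<bullet> u\<bar> \<le> \<bar>y \<bullet> u\<bar>"
  shows "n x \<le> n y"
proof -
  have step: "n (z + (c - z \<bullet> u) *\<^sub>R u) \<le> n z" if u: "u \<in> Basis" and c: "\<bar>c\<bar> \<le> \<bar>z \<bullet> u\<bar>" for z c u
  proof (cases "z \<bullet> u = 0")
    case True
    then show ?thesis using c by simp
  next
    case False
    define l where "l = c / (z \<bullet> u)"
    have l: "\<bar>l\<bar> \<le> 1" using c False by (simp add: l_def)
    have "z + (c - z \<bullet> u) *\<^sub>R u = ((1 + l) / 2) *\<^sub>R z + ((1 - l) / 2) *\<^sub>R refl_coord u z"
    proof (rule euclidean_eqI)
      fix v :: 'a assume v: "v \<in> Basis"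
      show "(z + (c - z \<bullet> u) *\<^sub>R u) \<bullet> v = (((1 + l) / 2) *\<^sub>R z + ((1 - l) / 2) *\<^sub>R refl_coord u z) \<bullet> v"
        using u v False by (cases "v = u") (simp_all add: inner_add_left inner_diff_left scaleR_diff_left inner_refl_coord inner_Basis l_def field_simps)
    qed
    then have "n (z + (c - z \<bullet> u) *\<^sub>R u) \<le> \<bar>(1 + l) / 2\<bar> * n z + \<bar>(1 - l) / 2\<bar> * n z"
      using seminorm_combine[OF n, of "(1 + l) / 2" z "(1 - l) / 2" "refl_coord u z"] unc[OF u] by simp
    also have "\<dots> = n z" using l by (simp add: abs_le_iff field_simps)
    finally show ?thesis .
  qed
  define w where "w B = (\<Sum>v\<in>Basis. (if v \<in> B then x \<bullet> v else y \<bullet> v) *\<^sub>R v)" for B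
  have wi: "w B \<bullet> v = (if v \<in> B then x \<bullet> v else y \<bullet> v)" if "v \<in> Basis" for B v
    unfolding w_def by (rule inner_sum_left_Basis[OF that])
  have le_w: "n (w B) \<le> n y" if "finite B" "B \<subseteq> Basis" for B
    using that
  proof (induction B rule: finite_induct)
    case empty
    have "w {} = y" by (rule euclidean_eqI) (simp add: wi)
    then show ?case by simp
  next
    case (insert u B)
    have u: "u \<in> Basis" using insert by auto
    have "w (insert u B) = w B + (x \<bullet> u - w B \<bullet> u) *\<^sub>R u"
      by (rule euclidean_eqI) (use u in \<open>auto simp: wi inner_add_left inner_Basis\<close>)
    moreover have "n (w B + (x \<bullet> u - w B \<bullet> u) *\<^sub>R u) \<le> n (w B)"
      using insert.hyps(2) u le[OF u] by (intro step) (auto simp: wi)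
    ultimately show ?case using insert by auto
  qed
  have "w Basis = x" by (rule euclidean_eqI) (simp add: wi)
  then show ?thesis using le_w[OF finite_Basis order_refl] by simp
qed

definition geometric_mean :: "'a::euclidean_space \<Rightarrow> 'a \<Rightarrow> 'a" where
  "geometric_mean x y = (\<Sum>u\<in>Basis. sqrt ((x \<bullet> u) * (y \<bullet> u)) *\<^sub>R u)"

lemma inner_geometric_mean: "u \<in> Basis \<Longrightarrow> geometric_mean x y \<bullet> u = sqrt ((x \<bullet> u) * (y \<bullet> u))"
  unfolding geometric_mean_def by (rule inner_sum_left_Basis)

text \<open>For each positive \<open>l\<close> the geometric mean is coordinatewise below half of
  \<open>l\<close> times \<open>x\<close> plus \<open>1 / l\<close> times \<open>y\<close>, so
  monotonicity bounds its norm by half of \<open>l * n x + n y / l\<close>. The choice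
  \<open>l = sqrt (n y / n x)\<close> makes the two terms equal.\<close>

lemma unconditional_norm_geometric_mean:
  fixes n :: "'a::euclidean_space \<Rightarrow> real"
  assumes n: "is_norm n" and unc: "\<And>u x. u \<in> Basis \<Longrightarrow> n (refl_coord u x) = n x"
    and pos: "\<And>u. u \<in> Basis \<Longrightarrow> 0 < x \<bullet> u" "\<And>u. u \<in> Basis \<Longrightarrow> 0 < y \<bullet> u"
  shows "n (geometric_mean x y) \<le> sqrt (n x * n y)"
proof -
  have s: "is_seminorm n" by (rule is_norm_seminorm[OF n])
  have "x \<noteq> 0" "y \<noteq> 0" using pos nonempty_Basis by (metis all_not_in_conv inner_zero_left less_irrefl)+
  then have nxy: "n x > 0" "n y > 0" using is_norm_pos[OF n] by auto
  define l where "l = sqrt (n y / n x)"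
  have l: "l > 0" "l * n x = sqrt (n x * n y)" "(1 / l) * n y = sqrt (n x * n y)"
  proof -
    show "l > 0" using nxy by (simp add: l_def)
    have l2: "l\<^sup>2 = n y / n x" using nxy by (simp add: l_def)
    have "(l * n x)\<^sup>2 = n x * n y" "((1 / l) * n y)\<^sup>2 = n x * n y"
      using nxy by (simp_all add: power_mult_distrib power_divide l2) (simp_all add: power2_eq_square)
    then show "l * n x = sqrt (n x * n y)" "(1 / l) * n y = sqrt (n x * n y)"
      using nxy \<open>l > 0\<close> by (auto intro!: real_sqrt_unique[symmetric])
  qed
  let ?z = "(l / 2) *\<^sub>R x + (1 / l / 2) *\<^sub>R y"
  have "n (geometric_mean x y) \<le> n ?z"
  proof (rule unconditional_seminorm_mono[OF s unc])
    fix u :: 'a assume u: "u \<in> Basis"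
    have p: "x \<bullet> u > 0" "y \<bullet> u > 0" using pos u by auto
    have "sqrt ((x \<bullet> u) * (y \<bullet> u)) = sqrt ((l * (x \<bullet> u)) * ((1 / l) * (y \<bullet> u)))" using l(1) by simp
    also have "\<dots> \<le> (l * (x \<bullet> u) + (1 / l) * (y \<bullet> u)) / 2"
      using p l(1) by (intro arith_geo_mean_sqrt) auto
    also have "\<dots> = ?z \<bullet> u" by (simp add: inner_add_left add_divide_distrib)
    finally show "\<bar>geometric_mean x y \<bullet> u\<bar> \<le> \<bar>?z \<bullet> u\<bar>" using p u by (simp add: inner_geometric_mean)
  qed
  also have "\<dots> \<le> (l / 2) * n x + (1 / l / 2) * n y" using seminorm_combine[OF s, of "l / 2" x "1 / l / 2" y] l(1) by simp
  also have "\<dots> = sqrt (n x * n y)" using l(2,3) by simp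
  finally show ?thesis .
qed

lemma emeasure_refl_coord_vimage:
  fixes S :: "'a::euclidean_space set"
  assumes u: "u \<in> Basis" and [measurable]: "S \<in> sets borel"
  shows "emeasure lborel (refl_coord u -` S) = emeasure lborel S"
proof -
  define c where "c = (\<lambda>v. if v = u then - 1 else (1::real))"
  have T: "refl_coord u = (\<lambda>x. 0 + (\<Sum>j\<in>Basis. (c j * (x \<bullet> j)) *\<^sub>R j))"
    by (rule ext, rule euclidean_eqI) (use u in \<open>simp add: inner_refl_coord c_def\<close>)
  have [measurable]: "refl_coord u \<in> borel_measurable borel" unfolding refl_coord_def[abs_def] by measurable
  have "lborel = density (distr lborel borel (refl_coord u)) (\<lambda>_. (\<Prod>j\<in>(Basis::'a set). \<bar>c j\<bar>))"
    unfolding T by (rule lborel_affine_euclidean) (auto simp: c_def)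
  also have "(\<Prod>j\<in>(Basis::'a set). \<bar>c j\<bar>) = 1" by (intro prod.neutral) (auto simp: c_def)
  finally have "lborel = distr lborel borel (refl_coord u)" by (simp add: density_1)
  then have "emeasure lborel S = emeasure (distr lborel borel (refl_coord u)) S" by simp
  also have "\<dots> = emeasure lborel (refl_coord u -` S)" by (subst emeasure_distr) auto
  finally show ?thesis by simp
qed

text \<open>Each reflection splits the set into two parts of equal measure and a null set in the
  mirror. Hence the positive orthant, the domain of the multiplicative inequality, determines the
  whole volume.\<close>

lemma emeasure_unconditional_orthant:
  fixes S :: "'a::euclidean_space set"
  assumes [measurable]: "S \<in> sets borel" and unc: "\<And>u. u \<in> Basis \<Longrightarrow> refl_coord u -` S = S"
    and B: "finite B" "B \<subseteq> Basis"
  shows "emeasure lborel S = 2 ^ card B * emeasure lborel (S \<inter> {x. \<forall>u\<in>B. 0 < x \<bullet> u})"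
  using B
proof (induction B rule: finite_induct)
  case (insert v B)
  let ?T = "S \<inter> {x. \<forall>u\<in>B. 0 < x \<bullet> u}"
  have v: "v \<in> Basis" "B \<subseteq> Basis" "finite B" using insert by auto
  have "{x. \<forall>u\<in>B. 0 < x \<bullet> u} = (\<Inter>u\<in>B. {x. 0 < x \<bullet> u})" by auto
  then have [measurable]: "{x::'a. \<forall>u\<in>B. 0 < x \<bullet> u} \<in> sets borel" using v(3)
    by (cases "B = {}") (auto intro!: sets.finite_INT)
  have "refl_coord v -` (?T \<inter> {x. x \<bullet> v < 0}) = ?T \<inter> {x. 0 < x \<bullet> v}"
    using unc[OF v(1)] v insert.hyps(2) by (auto simp: inner_refl_coord subset_iff)
  then have eq: "emeasure lborel (?T \<inter> {x. x \<bullet> v < 0}) = emeasure lborel (?T \<inter> {x. 0 < x \<bullet> v})"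
    using emeasure_refl_coord_vimage[OF v(1), of "?T \<inter> {x. x \<bullet> v < 0}"] by simp
  have "negligible {x::'a. x \<bullet> v = 0}" using v(1) by (rule negligible_standard_hyperplane)
  then have "{x::'a. x \<bullet> v = 0} \<in> null_sets lborel"
    using borel_closed[OF closed_Collect_eq[of "\<lambda>x::'a. x \<bullet> v" "\<lambda>_. 0"]]
    by (simp add: negligible_iff_null_sets null_sets_completion_iff continuous_on_inner continuous_on_id continuous_on_const)
  then have null: "?T \<inter> {x. x \<bullet> v = 0} \<in> null_sets lborel" by (rule null_sets_subset) auto
  have "emeasure lborel ?T = emeasure lborel (?T \<inter> {x. 0 < x \<bullet> v} \<union> ?T \<inter> {x. x \<bullet> v < 0} \<union> ?T \<inter> {x. x \<bullet> v = 0})"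
    by (intro arg_cong2[where f = emeasure]) auto
  also have "\<dots> = emeasure lborel (?T \<inter> {x. 0 < x \<bullet> v} \<union> ?T \<inter> {x. x \<bullet> v < 0})"
    by (rule emeasure_Un_null_set) (use null in auto)
  also have "\<dots> = emeasure lborel (?T \<inter> {x. 0 < x \<bullet> v}) + emeasure lborel (?T \<inter> {x. x \<bullet> v < 0})"
    by (rule plus_emeasure[symmetric]) auto
  also have "\<dots> = 2 * emeasure lborel (?T \<inter> {x. 0 < x \<bullet> v})" by (simp add: eq mult_2)
  also have "?T \<inter> {x. 0 < x \<bullet> v} = S \<inter> {x. \<forall>u\<in>insert v B. 0 < x \<bullet> u}" by auto
  finally show ?case using insert by (simp add: mult_ac)
qed simp

text \<open>\<open>exp ((s + t) / 2)\<close> is the geometric mean of the weights, just as the norms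
  at the geometric mean are bounded by geometric means. So the energy at the geometric mean of two
  points is at most the average of their energies, and the indicators of the balls themselves, cut
  down to the orthant, satisfy the multiplicative hypothesis.\<close>

lemma midpoint_volume_unconditional_Basis:
  fixes a b :: "'a::euclidean_space \<Rightarrow> real"
  assumes p: "p \<ge> 1" and a: "is_norm a" and b: "is_norm b"
    and unca: "\<And>u x. u \<in> Basis \<Longrightarrow> a (refl_coord u x) = a x"
    and uncb: "\<And>u x. u \<in> Basis \<Longrightarrow> b (refl_coord u x) = b x"
  shows "emeasure lborel (lp_ball p a b s) * emeasure lborel (lp_ball p a b t)
    \<le> (emeasure lborel (lp_ball p a b ((s + t) / 2)))\<^sup>2"
proof -
  have sb: "is_seminorm b" and sa: "is_seminorm a" using a b by (auto intro: is_norm_seminorm)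
  note [measurable] = lp_ball_borel[OF p a sb]
  define P where "P = {x :: 'a. \<forall>u\<in>Basis. 0 < x \<bullet> u}"
  have "P = (\<Inter>u\<in>Basis. {x. 0 < x \<bullet> u})" by (auto simp: P_def)
  then have [measurable]: "P \<in> sets borel" by (auto intro!: sets.finite_INT)
  let ?B = "\<lambda>t. lp_ball p a b t"
  have mean: "geometric_mean x y \<in> ?B ((s + t) / 2)" if "x \<in> ?B s \<inter> P" "y \<in> ?B t \<inter> P" for x y
  proof -
    have pos: "\<And>u. u \<in> Basis \<Longrightarrow> 0 < x \<bullet> u" "\<And>u. u \<in> Basis \<Longrightarrow> 0 < y \<bullet> u" using that by (auto simp: P_def)
    have pw: "n (geometric_mean x y) powr p \<le> sqrt (n x powr p * n y powr p)"
      if "is_norm n" "\<And>u x. u \<in> Basis \<Longrightarrow> n (refl_coord u x) = n x" for n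
    proof -
      have nn: "0 \<le> n z" for z using that(1) by (intro seminorm_nonneg is_norm_seminorm)
      have "n (geometric_mean x y) powr p \<le> sqrt (n x * n y) powr p"
        using unconditional_norm_geometric_mean[OF that pos] p nn by (intro powr_mono2) auto
      also have "\<dots> = sqrt (n x powr p * n y powr p)"
        using nn by (simp add: powr_half_sqrt[symmetric] powr_powr powr_mult mult.commute)
      finally show ?thesis .
    qed
    have e: "exp ((s + t) / 2) = sqrt (exp s * exp t)"
      by (intro real_sqrt_unique[symmetric]) (auto simp: power2_eq_square simp flip: exp_add)
    have "exp ((s + t) / 2) * b (geometric_mean x y) powr p \<le> exp ((s + t) / 2) * sqrt (b x powr p * b y powr p)"
      by (intro mult_left_mono pw b uncb) auto
    also have "\<dots> = sqrt ((exp s * b x powr p) * (exp t * b y powr p))"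
      unfolding e real_sqrt_mult[symmetric] by (simp add: mult_ac)
    also have "\<dots> \<le> (exp s * b x powr p + exp t * b y powr p) / 2"
      by (intro arith_geo_mean_sqrt) auto
    finally have 1: "exp ((s + t) / 2) * b (geometric_mean x y) powr p \<le> (exp s * b x powr p + exp t * b y powr p) / 2" .
    have "a (geometric_mean x y) powr p \<le> (a x powr p + a y powr p) / 2"
      using pw[OF a unca] arith_geo_mean_sqrt[of "a x powr p" "a y powr p"] by simp
    with 1 show ?thesis using that by (simp add: lp_ball_def lp_energy_def)
  qed
  have "(\<integral>\<^sup>+x. indicator (?B s \<inter> P) x \<partial>lborel) * (\<integral>\<^sup>+x. indicator (?B t \<inter> P) x \<partial>lborel)
    \<le> (\<integral>\<^sup>+x. indicator (?B ((s + t) / 2) \<inter> P) x \<partial>lborel)\<^sup>2"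
  proof (rule prekopa_leindlerD[OF prekopa_leindler_lborel[OF prekopa_leindler_real_mult]])
    fix x y :: 'a
    assume xy: "x \<in> {x. \<forall>b\<in>Basis. x \<bullet> b \<in> {0<..}}" "y \<in> {x. \<forall>b\<in>Basis. x \<bullet> b \<in> {0<..}}"
    have "geometric_mean x y \<in> P" using xy by (simp add: P_def inner_geometric_mean)
    then have "(\<Sum>b\<in>Basis. sqrt ((x \<bullet> b) * (y \<bullet> b)) *\<^sub>R b) \<in> ?B ((s + t) / 2) \<inter> P"
      if "x \<in> ?B s \<inter> P" "y \<in> ?B t \<inter> P"
      using mean[OF that] by (simp add: geometric_mean_def)
    then show "indicator (?B s \<inter> P) x * indicator (?B t \<inter> P) y
      \<le> (indicator (?B ((s + t) / 2) \<inter> P) (\<Sum>b\<in>Basis. sqrt ((x \<bullet> b) * (y \<bullet> b)) *\<^sub>R b) :: ennreal)\<^sup>2"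
      by (cases "x \<in> ?B s \<inter> P \<and> y \<in> ?B t \<inter> P") (auto simp: indicator_def)
  qed (auto simp: P_def)
  then have le: "emeasure lborel (?B s \<inter> P) * emeasure lborel (?B t \<inter> P) \<le> (emeasure lborel (?B ((s + t) / 2) \<inter> P))\<^sup>2"
    by simp
  have orth: "emeasure lborel (?B t) = 2 ^ DIM('a) * emeasure lborel (?B t \<inter> P)" for t
    unfolding P_def
  proof (rule emeasure_unconditional_orthant)
    show "refl_coord u -` lp_ball p a b t = lp_ball p a b t" if "u \<in> Basis" for u
      using that by (auto simp: lp_ball_def lp_energy_def unca uncb)
  qed auto
  have "(2 ^ DIM('a))\<^sup>2 * (emeasure lborel (?B s \<inter> P) * emeasure lborel (?B t \<inter> P))
    \<le> (2 ^ DIM('a))\<^sup>2 * (emeasure lborel (?B ((s + t) / 2) \<inter> P))\<^sup>2"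
    by (rule mult_left_mono[OF le]) simp
  then show ?thesis unfolding orth by (simp add: power2_eq_square mult_ac)
qed

text \<open>The linear map carrying \<open>Basis\<close> to \<open>B\<close> conjugates the
  coordinate reflections to the reflections of \<open>B\<close>.\<close>

lemma midpoint_volume_unconditional:
  fixes a b :: "'a::euclidean_space \<Rightarrow> real"
  assumes p: "p \<ge> 1" and a: "is_norm a" and b: "is_norm b" and B: "orthonormal_basis B"
    and unca: "\<And>u x. u \<in> B \<Longrightarrow> a (x - (2 * (x \<bullet> u)) *\<^sub>R u) = a x"
    and uncb: "\<And>u x. u \<in> B \<Longrightarrow> b (x - (2 * (x \<bullet> u)) *\<^sub>R u) = b x"
  shows "emeasure lborel (lp_ball p a b s) * emeasure lborel (lp_ball p a b t)
    \<le> (emeasure lborel (lp_ball p a b ((s + t) / 2)))\<^sup>2"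
proof -
  have orth: "pairwise orthogonal B" and norm1: "\<And>u. u \<in> B \<Longrightarrow> norm u = 1" and span: "span B = UNIV"
    using B by (auto simp: orthonormal_basis_def)
  have "0 \<notin> B" using norm1 by force
  then have ind: "independent B" using orth pairwise_orthogonal_independent by blast
  then have fin: "finite B" by (rule independent_imp_finite)
  have "card B = DIM('a)" using ind span by (metis dim_UNIV dim_eq_card_independent dim_span)
  then obtain \<phi> where \<phi>: "bij_betw \<phi> (Basis :: 'a set) B"
    using finite_same_card_bij[OF finite_Basis fin] by auto
  define f where "f x = (\<Sum>v\<in>Basis. (x \<bullet> v) *\<^sub>R \<phi> v)" for x :: 'a
  have lin: "linear f"
    by (rule linearI) (simp_all add: f_def inner_add_left scaleR_add_left sum.distrib scaleR_sum_right)
  have \<phi>i: "\<phi> u \<bullet> \<phi> v = (if u = v then 1 else 0)" if "u \<in> Basis" "v \<in> Basis" for u v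
  proof (cases "u = v")
    case True
    then show ?thesis using norm1[of "\<phi> v"] \<phi> that by (auto simp: bij_betw_def dot_square_norm)
  next
    case False
    then have "\<phi> u \<noteq> \<phi> v" using \<phi> that by (auto simp: bij_betw_def inj_on_def)
    moreover have "\<phi> u \<in> B" "\<phi> v \<in> B" using \<phi> that by (auto simp: bij_betw_def)
    ultimately show ?thesis using orth False by (auto simp: pairwise_def orthogonal_def)
  qed
  have fi: "f x \<bullet> \<phi> u = x \<bullet> u" if "u \<in> Basis" for x u
    using that by (simp add: f_def inner_sum_left \<phi>i if_distrib cong: if_cong)
  have "inj f"
  proof (rule injI)
    fix x y assume "f x = f y"
    then have "x \<bullet> u = y \<bullet> u" if "u \<in> Basis" for u using fi[OF that] by metis
    then show "x = y" by (rule euclidean_eqI)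
  qed
  then have bij: "bij f" using linear_injective_imp_surjective[OF lin] by (simp add: bij_def)
  have refl: "f (refl_coord u x) = f x - (2 * (f x \<bullet> \<phi> u)) *\<^sub>R \<phi> u" if "u \<in> Basis" for u x
  proof -
    have "f u = \<phi> u" using that by (simp add: f_def inner_Basis if_distrib[of "\<lambda>r. r *\<^sub>R _"] cong: if_cong)
    then show ?thesis using that by (simp add: refl_coord_def linear_diff[OF lin] linear_cmul[OF lin] fi)
  qed
  have \<phi>B: "\<phi> u \<in> B" if "u \<in> Basis" for u using \<phi> that by (auto simp: bij_betw_def)
  show ?thesis
  proof (rule midpoint_volume_linear_image[OF lin bij p a is_norm_seminorm[OF b]],
      rule midpoint_volume_unconditional_Basis[OF p])
    show "is_norm (\<lambda>x. a (f x))" "is_norm (\<lambda>x. b (f x))"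
      using a b lin \<open>inj f\<close> by (auto intro: is_norm_linear_image)
  qed (simp_all add: refl unca uncb \<phi>B)
qed

section \<open>Segments\<close>

text \<open>The hyperplane orthogonal to a basis vector is not a type of its own; its Lebesgue
  measure is represented by the product over the remaining basis vectors, and this is the dilation
  rule there.\<close>

lemma nn_integral_PiM_scale:
  fixes c :: real and f :: "('i \<Rightarrow> real) \<Rightarrow> ennreal"
  assumes "finite I" and "f \<in> borel_measurable (\<Pi>\<^sub>M i\<in>I. lborel)" and c: "c \<noteq> 0"
  shows "(\<integral>\<^sup>+\<omega>. f \<omega> \<partial>(\<Pi>\<^sub>M i\<in>I. lborel))
    = ennreal (\<bar>c\<bar> ^ card I) * (\<integral>\<^sup>+\<omega>. f (\<lambda>i\<in>I. c * \<omega> i) \<partial>(\<Pi>\<^sub>M i\<in>I. lborel))"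
  using assms(1,2)
proof (induction I arbitrary: f rule: finite_induct)
  case empty
  interpret product_sigma_finite "\<lambda>_::'i. lborel :: real measure" by standard
  show ?case by (simp add: nn_integral_empty restrict_def del: nn_integral_const)
next
  case (insert i I)
  interpret product_sigma_finite "\<lambda>_::'i. lborel :: real measure" by standard
  interpret I: finite_product_sigma_finite "\<lambda>_::'i. lborel :: real measure" I by standard (rule insert)
  note [measurable] = insert.prems
  have [measurable]: "(\<lambda>\<omega>. \<lambda>j\<in>insert i I. c * \<omega> j) \<in> (\<Pi>\<^sub>M j\<in>insert i I. lborel) \<rightarrow>\<^sub>M (\<Pi>\<^sub>M j\<in>insert i I. lborel)"
    by measurable
  have "(\<integral>\<^sup>+\<omega>. f \<omega> \<partial>(\<Pi>\<^sub>M i\<in>insert i I. lborel)) = (\<integral>\<^sup>+x. (\<integral>\<^sup>+y. f (x(i := y)) \<partial>lborel) \<partial>(\<Pi>\<^sub>M i\<in>I. lborel))"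
    by (rule product_nn_integral_insert) (use insert in auto)
  also have "\<dots> = (\<integral>\<^sup>+x. ennreal \<bar>c\<bar> * (\<integral>\<^sup>+y. f (x(i := c * y)) \<partial>lborel) \<partial>(\<Pi>\<^sub>M i\<in>I. lborel))"
  proof (rule nn_integral_cong)
    fix x assume x [measurable]: "x \<in> space (\<Pi>\<^sub>M i\<in>I. (lborel :: real measure))"
    have "(\<lambda>y. f (x(i := y))) \<in> borel_measurable lborel" by measurable
    then have "(\<lambda>y. f (x(i := y))) \<in> borel_measurable borel" by simp
    from nn_integral_real_affine[OF this c, of 0]
    show "(\<integral>\<^sup>+y. f (x(i := y)) \<partial>lborel) = ennreal \<bar>c\<bar> * (\<integral>\<^sup>+y. f (x(i := c * y)) \<partial>lborel)" by simp
  qed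
  also have "\<dots> = ennreal \<bar>c\<bar> * (\<integral>\<^sup>+x. (\<integral>\<^sup>+y. f (x(i := c * y)) \<partial>lborel) \<partial>(\<Pi>\<^sub>M i\<in>I. lborel))"
    by (rule nn_integral_cmult) measurable
  also have "(\<integral>\<^sup>+x. (\<integral>\<^sup>+y. f (x(i := c * y)) \<partial>lborel) \<partial>(\<Pi>\<^sub>M i\<in>I. lborel))
    = ennreal (\<bar>c\<bar> ^ card I) * (\<integral>\<^sup>+x. (\<integral>\<^sup>+y. f ((\<lambda>j\<in>I. c * x j)(i := c * y)) \<partial>lborel) \<partial>(\<Pi>\<^sub>M i\<in>I. lborel))"
    by (rule insert.IH) measurable
  also have "(\<integral>\<^sup>+x. (\<integral>\<^sup>+y. f ((\<lambda>j\<in>I. c * x j)(i := c * y)) \<partial>lborel) \<partial>(\<Pi>\<^sub>M i\<in>I. lborel))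
    = (\<integral>\<^sup>+x. (\<integral>\<^sup>+y. f (\<lambda>j\<in>insert i I. c * (x(i := y)) j) \<partial>lborel) \<partial>(\<Pi>\<^sub>M i\<in>I. lborel))"
    using insert.hyps(2) by (intro nn_integral_cong arg_cong[where f = f]) (auto simp: fun_eq_iff)
  also have "\<dots> = (\<integral>\<^sup>+\<omega>. f (\<lambda>j\<in>insert i I. c * \<omega> j) \<partial>(\<Pi>\<^sub>M i\<in>insert i I. lborel))"
    by (rule product_nn_integral_insert[symmetric]) (use insert in auto)
  finally show ?case
    by (simp only: card_insert_disjoint[OF insert.hyps] power_Suc ennreal_mult'[OF abs_ge_zero] mult.assoc)
qed

text \<open>Evenness and midpoint log-concavity only reach the dyadic multiples of \<open>s\<close>; the growth
  condition bridges the gap to an arbitrary \<open>r\<close>.\<close>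

lemma even_log_concave_antimono:
  fixes G :: "real \<Rightarrow> ennreal"
  assumes mid: "\<And>x y. G x * G y \<le> (G ((x + y) / 2))\<^sup>2" and even: "\<And>x. G (- x) = G x"
    and growth: "\<And>c x. 1 \<le> c \<Longrightarrow> G (c * x) \<le> ennreal (c ^ n) * G x"
    and rs: "0 \<le> r" "r \<le> s"
  shows "G s \<le> G r"
proof -
  have midle: "G s \<le> G ((x + y) / 2)" if "G s \<le> G x" "G s \<le> G y" for x y
  proof -
    have "(G s)\<^sup>2 \<le> G x * G y" unfolding power2_eq_square by (rule mult_mono) (use that in auto)
    then have "(G s)\<^sup>2 \<le> (G ((x + y) / 2))\<^sup>2" using mid by (rule order.trans)
    then show ?thesis by (simp add: ennreal_power2_le_iff)
  qed
  \<comment> \<open>The points descend from \<open>s\<close> at \<open>j = 0\<close> to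
    \<open>- s\<close> at \<open>j = 2 ^ Suc k\<close>; at both ends the value is
    \<open>G s\<close>.\<close>
  have dyadic: "G s \<le> G (s - s * real j / 2 ^ k)" if "j \<le> 2 ^ Suc k" for j k :: nat
    using that
  proof (induction k arbitrary: j)
    case 0
    then consider "j = 0" | "j = 1" | "j = 2" by (auto simp: le_Suc_eq numeral_2_eq_2)
    then show ?case
    proof cases
      case 2
      then show ?thesis using midle[of s "- s"] even by simp
    qed (use even in auto)
  next
    case (Suc k)
    show ?case
    proof (cases "even j")
      case True
      then obtain i where i: "j = 2 * i" by blast
      then show ?thesis using Suc.IH[of i] Suc.prems by simp
    next
      case False
      then obtain i where i: "j = 2 * i + 1" by (metis oddE)
      then have "G s \<le> G (s - s * real i / 2 ^ k)" "G s \<le> G (s - s * real (Suc i) / 2 ^ k)"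
        using Suc.prems by (auto intro!: Suc.IH simp del: of_nat_Suc)
      from midle[OF this] have "G s \<le> G ((s - s * real i / 2 ^ k + (s - s * real (Suc i) / 2 ^ k)) / 2)" .
      also have "(s - s * real i / 2 ^ k + (s - s * real (Suc i) / 2 ^ k)) / 2 = s - s * real j / 2 ^ Suc k"
        by (simp add: i field_simps)
      finally show ?thesis .
    qed
  qed
  show ?thesis
  proof (cases "r = 0")
    case True
    then show ?thesis using dyadic[of 1 0] by simp
  next
    case False
    then have r: "r > 0" "s > 0" using rs by auto
    define d where "d k = 1 + s / (r * 2 ^ k)" for k :: nat
    have le: "G s \<le> G r * ennreal (d k ^ n)" for k
    proof -
      \<comment> \<open>\<open>s * real m / 2 ^ k\<close> is the first multiple of
        \<open>s / 2 ^ k\<close> that is not below \<open>r\<close>. Its ratio \<open>c\<close> to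
        \<open>r\<close> lies between 1 and \<open>d k\<close>, and \<open>d k\<close> tends to
        1.\<close>
      define m where "m = nat \<lceil>r * 2 ^ k / s\<rceil>"
      have m: "r * 2 ^ k / s \<le> real m" "real m \<le> r * 2 ^ k / s + 1"
        using r by (auto simp: m_def)
      have "r * 2 ^ k / s \<le> 2 ^ k" using rs r by (simp add: field_simps)
      then have "\<lceil>r * 2 ^ k / s\<rceil> \<le> 2 ^ k" by (simp add: ceiling_le_iff)
      then have m2: "m \<le> 2 ^ k" by (simp add: m_def nat_le_iff)
      define c where "c = s * real m / (r * 2 ^ k)"
      have c1: "1 \<le> c" using m(1) r by (simp add: c_def field_simps)
      have c2: "c \<le> d k" using m(2) r by (simp add: c_def d_def field_simps)
      have "G s \<le> G (s - s * real (2 ^ k - m) / 2 ^ k)" by (rule dyadic) simp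
      also have "s - s * real (2 ^ k - m) / 2 ^ k = c * r"
        using m2 r by (simp add: c_def of_nat_diff field_simps)
      also have "G (c * r) \<le> ennreal (c ^ n) * G r" by (rule growth[OF c1])
      also have "\<dots> \<le> ennreal (d k ^ n) * G r"
        using c1 c2 by (intro mult_right_mono ennreal_leI power_mono) auto
      finally show ?thesis by (simp add: mult.commute)
    qed
    show ?thesis
    proof (cases "G r = top")
      case False
      have lim0: "(\<lambda>k. (1/2::real) ^ k) \<longlonglongrightarrow> 0" by (rule LIMSEQ_realpow_zero) auto
      have "(\<lambda>k. (1 + s / r * (1/2) ^ k) ^ n) \<longlonglongrightarrow> (1 + s / r * 0) ^ n"
        by (intro tendsto_power tendsto_add tendsto_mult tendsto_const lim0)
      moreover have "(1 + s / r * (1/2) ^ k) ^ n = d k ^ n" for k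
        by (simp add: d_def power_divide)
      ultimately have "(\<lambda>k. d k ^ n) \<longlonglongrightarrow> 1" by simp
      then have "(\<lambda>k. G r * ennreal (d k ^ n)) \<longlonglongrightarrow> G r * ennreal 1"
        using False by (intro ennreal_tendsto_cmult tendsto_ennrealI) (auto simp: less_top)
      then show ?thesis using le by (intro LIMSEQ_le_const[of _ "G r"]) auto
    qed simp
  qed
qed

lemma seminorm_powr_midpoint:
  assumes n: "is_seminorm n" and p: "p \<ge> 1"
  shows "2 * n ((1/2) *\<^sub>R (x + y)) powr p \<le> n x powr p + n y powr p"
proof -
  have "n ((1/2) *\<^sub>R (x + y)) \<le> 1/2 * n x + 1/2 * n y"
    using seminorm_combine[OF n, of "1/2" x "1/2" y] by (simp add: scaleR_add_right)
  then have "n ((1/2) *\<^sub>R (x + y)) powr p \<le> (1/2 * n x + 1/2 * n y) powr p"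
    using seminorm_nonneg[OF n] p by (intro powr_mono2) auto
  also have "\<dots> \<le> 1/2 * n x powr p + 1/2 * n y powr p"
    by (rule powr_convex_combination) (use p seminorm_nonneg[OF n] in auto)
  finally show ?thesis by simp
qed

lemma nn_integral_even_real:
  fixes f :: "real \<Rightarrow> ennreal"
  assumes [measurable]: "f \<in> borel_measurable borel" and even: "\<And>x. f (- x) = f x"
  shows "(\<integral>\<^sup>+x. f x \<partial>lborel) = 2 * (\<integral>\<^sup>+x. f x * indicator {0<..} x \<partial>lborel)"
proof -
  have "AE x in lborel. x \<noteq> (0::real)" by (rule AE_lborel_singleton)
  then have "(\<integral>\<^sup>+x. f x \<partial>lborel) = (\<integral>\<^sup>+x. f x * indicator {0<..} x + f x * indicator {..<0} x \<partial>lborel)"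
    by (intro nn_integral_cong_AE) (auto simp: indicator_def)
  also have "\<dots> = (\<integral>\<^sup>+x. f x * indicator {0<..} x \<partial>lborel) + (\<integral>\<^sup>+x. f x * indicator {..<0} x \<partial>lborel)"
    by (rule nn_integral_add) auto
  also have "(\<integral>\<^sup>+x. f x * indicator {..<0} x \<partial>lborel)
    = ennreal \<bar>- 1\<bar> * (\<integral>\<^sup>+x. f (0 + - 1 * x) * indicator {..<0} (0 + - 1 * x) \<partial>lborel)"
    by (rule nn_integral_real_affine) auto
  also have "\<dots> = (\<integral>\<^sup>+x. f x * indicator {0<..} x \<partial>lborel)"
    by (simp add: even indicator_def)
  finally show ?thesis by (simp add: mult_2)
qed

text \<open>Integration over the hyperplanes orthogonal to \<open>e\<close> leaves the product of
  \<open>w t r\<close> and the marginal \<open>F r\<close>. The factor \<open>w\<close> is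
  compatible with geometric means, while \<open>F\<close> is known to be log-concave along
  arithmetic means only. Since \<open>F\<close> decreases on the half-line and
  \<open>sqrt (x * y) \<le> (x + y) / 2\<close>, it satisfies the multiplicative condition as
  well.\<close>

lemma midpoint_volume_coordinate_functional:
  fixes a :: "'a::euclidean_space \<Rightarrow> real" and e :: 'a
  assumes p: "p \<ge> 1" and a: "is_norm a" and e: "e \<in> Basis" and k: "0 \<le> (\<kappa> :: real)"
  defines "b \<equiv> \<lambda>x. \<kappa> * \<bar>x \<bullet> e\<bar>"
  shows "emeasure lborel (lp_ball p a b s) * emeasure lborel (lp_ball p a b t)
    \<le> (emeasure lborel (lp_ball p a b ((s + t) / 2)))\<^sup>2"
proof -
  have sa: "is_seminorm a" by (rule is_norm_seminorm[OF a])
  have "\<kappa> * \<bar>x \<bullet> e + y \<bullet> e\<bar> \<le> \<kappa> * \<bar>x \<bullet> e\<bar> + \<kappa> * \<bar>y \<bullet> e\<bar>" for x y :: 'a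
    using mult_left_mono[OF abs_triangle_ineq k] by (simp add: distrib_left)
  then have sb: "is_seminorm b"
    by (auto simp: is_seminorm_def b_def inner_add_left abs_mult)
  note [measurable] = seminorm_measurable[OF sa] seminorm_measurable[OF sb] lp_energy_measurable[OF p a sb]
  define I where "I = Basis - {e}"
  have I: "finite I" "e \<notin> I" "insert e I = Basis" using e by (auto simp: I_def)
  let ?M = "\<Pi>\<^sub>M i\<in>I. (lborel :: real measure)"
  interpret product_sigma_finite "\<lambda>_::'a. lborel :: real measure" by standard
  interpret I: finite_product_sigma_finite "\<lambda>_::'a. lborel :: real measure" I by standard (rule I)
  define pt where "pt \<omega> r = r *\<^sub>R e + (\<Sum>v\<in>I. \<omega> v *\<^sub>R v)" for \<omega> :: "'a \<Rightarrow> real" and r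
  define F where "F r = (\<integral>\<^sup>+\<omega>. ennreal (exp (- (a (pt \<omega> r) powr p))) \<partial>?M)" for r
  have pt_meas [measurable]: "(\<lambda>\<omega>. pt \<omega> r) \<in> borel_measurable ?M" for r unfolding pt_def by measurable
  have F_meas [measurable]: "F \<in> borel_measurable borel"
  proof -
    have "(\<lambda>(r, \<omega>). ennreal (exp (- (a (pt \<omega> r) powr p)))) \<in> borel_measurable (borel \<Otimes>\<^sub>M ?M)"
      unfolding pt_def by measurable
    then show ?thesis unfolding F_def by (rule I.borel_measurable_nn_integral)
  qed
  have F_mid: "F x * F y \<le> (F ((x + y) / 2))\<^sup>2" for x y
    unfolding F_def
  proof (rule prekopa_leindlerD[OF prekopa_leindler_PiM])
    show "product_sigma_finite (\<lambda>_::'a. lborel :: real measure)" by (rule product_sigma_finite_axioms)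
    show "prekopa_leindler lborel UNIV (\<lambda>x y :: real. (x + y) / 2)" by (rule prekopa_leindler_real)
    fix \<omega> \<omega>' :: "'a \<Rightarrow> real"
    let ?\<mu> = "\<lambda>i\<in>I. (\<omega> i + \<omega>' i) / 2"
    have "pt ?\<mu> ((x + y) / 2) = (1/2) *\<^sub>R (pt \<omega> x + pt \<omega>' y)"
      by (simp add: pt_def scaleR_add_right scaleR_add_left scaleR_sum_right sum.distrib add_divide_distrib)
    then have "2 * a (pt ?\<mu> ((x + y) / 2)) powr p \<le> a (pt \<omega> x) powr p + a (pt \<omega>' y) powr p"
      using seminorm_powr_midpoint[OF sa p] by simp
    then show "ennreal (exp (- (a (pt \<omega> x) powr p))) * ennreal (exp (- (a (pt \<omega>' y) powr p)))
      \<le> (ennreal (exp (- (a (pt ?\<mu> ((x + y) / 2)) powr p))))\<^sup>2"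
      by (simp add: ennreal_power power2_eq_square flip: ennreal_mult exp_add)
  qed (use I in \<open>auto simp: space_PiM PiE_iff\<close>)
  \<comment> \<open>The value \<open>c = - 1\<close> yields evenness of \<open>F\<close>, and
    \<open>c \<ge> 1\<close> the growth condition.\<close>
  have F_scale: "F (c * x) \<le> ennreal (\<bar>c\<bar> ^ card I) * F x" if c: "1 \<le> \<bar>c\<bar>" for c x
  proof -
    have "F (c * x) = ennreal (\<bar>c\<bar> ^ card I) * (\<integral>\<^sup>+\<omega>. ennreal (exp (- (a (pt (\<lambda>i\<in>I. c * \<omega> i) (c * x)) powr p))) \<partial>?M)"
      unfolding F_def by (rule nn_integral_PiM_scale) (use c I in auto)
    also have "\<dots> \<le> ennreal (\<bar>c\<bar> ^ card I) * F x"
      unfolding F_def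
    proof (intro mult_left_mono nn_integral_mono ennreal_leI)
      fix \<omega>
      have "pt (\<lambda>i\<in>I. c * \<omega> i) (c * x) = c *\<^sub>R pt \<omega> x"
        by (simp add: pt_def scaleR_add_right scaleR_sum_right)
      then have "a (pt \<omega> x) \<le> a (pt (\<lambda>i\<in>I. c * \<omega> i) (c * x))"
        using c seminorm_nonneg[OF sa, of "pt \<omega> x"] by (simp add: is_seminormD(2)[OF sa] mult_le_cancel_right1)
      then show "exp (- (a (pt (\<lambda>i\<in>I. c * \<omega> i) (c * x)) powr p)) \<le> exp (- (a (pt \<omega> x) powr p))"
        using seminorm_nonneg[OF sa] p by (simp add: powr_mono2)
    qed simp
    finally show ?thesis .
  qed
  have F_even: "F (- x) = F x" for x
    using F_scale[of "- 1" x] F_scale[of "- 1" "- x"] by (simp add: antisym)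
  have F_anti: "F y \<le> F x" if "0 \<le> x" "x \<le> y" for x y
  proof (rule even_log_concave_antimono[OF F_mid F_even _ that])
    show "F (c * x) \<le> ennreal (c ^ card I) * F x" if "1 \<le> c" for c x
      using F_scale[of c x] that by simp
  qed
  define w where "w t r = ennreal (exp (- (exp t * (\<kappa> * \<bar>r\<bar>) powr p)))" for t r
  have [measurable]: "w t \<in> borel_measurable borel" for t unfolding w_def by measurable
  have int: "(\<integral>\<^sup>+x. ennreal (exp (- lp_energy p a b t x)) \<partial>lborel) = 2 * (\<integral>\<^sup>+r. w t r * F r * indicator {0<..} r \<partial>lborel)" for t
  proof -
    have "(\<integral>\<^sup>+x. ennreal (exp (- lp_energy p a b t x)) \<partial>lborel)
      = (\<integral>\<^sup>+\<omega>. ennreal (exp (- lp_energy p a b t (\<Sum>v\<in>Basis. \<omega> v *\<^sub>R v))) \<partial>(\<Pi>\<^sub>M i\<in>insert e I. lborel))"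
      unfolding I(3) by (rule nn_integral_lborel_PiM) measurable
    also have "\<dots> = (\<integral>\<^sup>+r. (\<integral>\<^sup>+\<omega>. ennreal (exp (- lp_energy p a b t (\<Sum>v\<in>Basis. fun_upd \<omega> e r v *\<^sub>R v))) \<partial>?M) \<partial>lborel)"
      by (rule product_nn_integral_insert_rev) (use I in auto)
    also have "\<dots> = (\<integral>\<^sup>+r. w t r * F r \<partial>lborel)"
    proof (rule nn_integral_cong)
      fix r :: real
      have S: "(\<Sum>v\<in>Basis. fun_upd \<omega> e r v *\<^sub>R v) = pt \<omega> r" for \<omega>
        unfolding I(3)[symmetric] pt_def using I(1,2) by (simp add: sum.insert) (intro sum.cong, auto)
      have "pt \<omega> r \<bullet> e = r" for \<omega>
        using e by (simp add: pt_def inner_add_left inner_sum_left inner_Basis I_def)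
      then have "ennreal (exp (- lp_energy p a b t (pt \<omega> r))) = w t r * ennreal (exp (- (a (pt \<omega> r) powr p)))" for \<omega>
        by (simp add: lp_energy_def b_def w_def flip: ennreal_mult exp_add)
      then show "(\<integral>\<^sup>+\<omega>. ennreal (exp (- lp_energy p a b t (\<Sum>v\<in>Basis. fun_upd \<omega> e r v *\<^sub>R v))) \<partial>?M) = w t r * F r"
        unfolding S F_def by (simp add: nn_integral_cmult)
    qed
    also have "\<dots> = 2 * (\<integral>\<^sup>+r. w t r * F r * indicator {0<..} r \<partial>lborel)"
      by (rule nn_integral_even_real) (auto simp: F_even w_def)
    finally show ?thesis .
  qed
  have w_mid: "w s x * w t y \<le> (w ((s + t) / 2) (sqrt (x * y)))\<^sup>2" if "0 < x" "0 < y" for x y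
  proof -
    have e: "exp ((s + t) / 2) = sqrt (exp s * exp t)"
      by (intro real_sqrt_unique[symmetric]) (auto simp: power2_eq_square simp flip: exp_add)
    have "(\<kappa> * \<bar>sqrt (x * y)\<bar>) = sqrt ((\<kappa> * x) * (\<kappa> * y))"
      using that k by (intro real_sqrt_unique[symmetric]) (auto simp: power_mult_distrib power2_eq_square)
    then have "exp ((s + t) / 2) * (\<kappa> * \<bar>sqrt (x * y)\<bar>) powr p = sqrt ((exp s * (\<kappa> * x) powr p) * (exp t * (\<kappa> * y) powr p))"
    proof -
      have "sqrt (A * B) powr p = sqrt (A powr p * B powr p)" if "0 \<le> A" "0 \<le> B" for A B :: real
        using that by (simp add: powr_half_sqrt[symmetric] powr_powr powr_mult mult.commute)
      from this[of "\<kappa> * x" "\<kappa> * y"] show ?thesis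
        using that k \<open>\<kappa> * \<bar>sqrt (x * y)\<bar> = sqrt ((\<kappa> * x) * (\<kappa> * y))\<close>
        unfolding e by (simp add: real_sqrt_mult[symmetric] mult_ac)
    qed
    also have "\<dots> \<le> (exp s * (\<kappa> * x) powr p + exp t * (\<kappa> * y) powr p) / 2"
      by (rule arith_geo_mean_sqrt) auto
    finally show ?thesis using that
      by (simp add: w_def ennreal_power power2_eq_square flip: ennreal_mult exp_add)
  qed
  have "(\<integral>\<^sup>+r. w s r * F r * indicator {0<..} r \<partial>lborel) * (\<integral>\<^sup>+r. w t r * F r * indicator {0<..} r \<partial>lborel)
    \<le> (\<integral>\<^sup>+r. w ((s + t) / 2) r * F r * indicator {0<..} r \<partial>lborel)\<^sup>2"
  proof (rule prekopa_leindlerD[OF prekopa_leindler_real_mult])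
    fix x y :: real assume "x \<in> {0<..}" "y \<in> {0<..}"
    then have xy: "0 < x" "0 < y" by auto
    have "F x * F y \<le> (F ((x + y) / 2))\<^sup>2" by (rule F_mid)
    also have "\<dots> \<le> (F (sqrt (x * y)))\<^sup>2"
      using xy arith_geo_mean_sqrt[of x y] by (intro power_mono F_anti) auto
    finally have "(w s x * w t y) * (F x * F y) \<le> (w ((s + t) / 2) (sqrt (x * y)))\<^sup>2 * (F (sqrt (x * y)))\<^sup>2"
      by (intro mult_mono w_mid xy) auto
    then show "w s x * F x * indicator {0<..} x * (w t y * F y * indicator {0<..} y)
      \<le> (w ((s + t) / 2) (sqrt (x * y)) * F (sqrt (x * y)) * indicator {0<..} (sqrt (x * y)))\<^sup>2"
      using xy by (simp add: power_mult_distrib mult_ac)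
  qed auto
  then have "4 * ((\<integral>\<^sup>+r. w s r * F r * indicator {0<..} r \<partial>lborel) * (\<integral>\<^sup>+r. w t r * F r * indicator {0<..} r \<partial>lborel))
    \<le> 4 * (\<integral>\<^sup>+r. w ((s + t) / 2) r * F r * indicator {0<..} r \<partial>lborel)\<^sup>2"
    by (rule mult_left_mono) simp
  then show ?thesis
    by (intro midpoint_volume_from_integral[OF p a sb]) (simp add: int power_mult_distrib mult_ac)
qed

lemma midpoint_volume_linear_functional:
  fixes a :: "real ^ 'n \<Rightarrow> real" and v :: "real ^ 'n"
  assumes p: "p \<ge> 1" and a: "is_norm a"
  defines "b \<equiv> \<lambda>x. \<bar>x \<bullet> v\<bar>"
  shows "emeasure lborel (lp_ball p a b s) * emeasure lborel (lp_ball p a b t)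
    \<le> (emeasure lborel (lp_ball p a b ((s + t) / 2)))\<^sup>2"
proof -
  \<comment> \<open>Any coordinate will do: an orthogonal map takes \<open>norm v\<close> times its
    axis vector to \<open>v\<close>, also when \<open>v = 0\<close>.\<close>
  fix k :: 'n
  let ?e = "axis k (1::real)"
  have "norm v = norm (norm v *\<^sub>R ?e)" by simp
  then obtain f where f: "orthogonal_transformation f" "f (norm v *\<^sub>R ?e) = v"
    using orthogonal_transformation_exists[of "norm v *\<^sub>R ?e" v] by metis
  have lin: "linear f" and bij: "bij f"
    using f(1) by (auto intro: orthogonal_transformation_linear orthogonal_transformation_bij)
  have "is_seminorm b"
    unfolding b_def is_seminorm_def by (auto simp: inner_add_left abs_mult)
  then show ?thesis
  proof (rule midpoint_volume_linear_image[OF lin bij p a])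
    have "b (f x) = norm v * \<bar>x \<bullet> ?e\<bar>" for x
    proof -
      have "f x \<bullet> v = f x \<bullet> f (norm v *\<^sub>R ?e)" by (simp add: f(2))
      also have "\<dots> = x \<bullet> (norm v *\<^sub>R ?e)" using f(1) by (simp add: orthogonal_transformation_def)
      finally show ?thesis by (simp add: b_def abs_mult)
    qed
    moreover have "is_norm (\<lambda>x. a (f x))"
      by (rule is_norm_linear_image[OF a lin]) (use bij in \<open>simp add: bij_def\<close>)
    ultimately show "emeasure lborel (lp_ball p (\<lambda>x. a (f x)) (\<lambda>x. b (f x)) s) * emeasure lborel (lp_ball p (\<lambda>x. a (f x)) (\<lambda>x. b (f x)) t)
      \<le> (emeasure lborel (lp_ball p (\<lambda>x. a (f x)) (\<lambda>x. b (f x)) ((s + t) / 2)))\<^sup>2"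
      using midpoint_volume_coordinate_functional[OF p, of "\<lambda>x. a (f x)" ?e "norm v" s t] by simp
  qed
qed

section \<open>The Euclidean ball\<close>

text \<open>In the product of the integral with its reflected copy the shift cancels, because
  \<open>x + y\<close> is the difference of \<open>x + w\<close> and \<open>- y + w\<close>. The
  additive inequality therefore bounds the square of the shifted integral by the square of the
  centred one. This is Anderson's inequality for a Gaussian.\<close>

lemma gaussian_shift_le:
  fixes \<psi> :: "'a::euclidean_space \<Rightarrow> real"
  assumes [measurable]: "\<psi> \<in> borel_measurable borel" and even: "\<And>x. \<psi> (- x) = \<psi> x"
    and mid: "\<And>x y. 2 * \<psi> ((1/2) *\<^sub>R (x + y)) \<le> \<psi> x + \<psi> y" and c: "0 \<le> c"
  shows "(\<integral>\<^sup>+v. ennreal (exp (- (\<psi> v + c * (norm (v + w))\<^sup>2))) \<partial>lborel)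
    \<le> (\<integral>\<^sup>+v. ennreal (exp (- (\<psi> v + c * (norm v)\<^sup>2))) \<partial>lborel)"
    (is "?F \<le> ?H")
proof -
  let ?f = "\<lambda>v. ennreal (exp (- (\<psi> v + c * (norm (v + w))\<^sup>2)))"
  have "?F = ennreal (\<bar>- 1\<bar> ^ DIM('a)) * (\<integral>\<^sup>+v. ?f (0 + (- 1) *\<^sub>R v) \<partial>lborel)"
    by (rule nn_integral_lborel_affine) auto
  then have "?F\<^sup>2 = ?F * (\<integral>\<^sup>+v. ?f (- v) \<partial>lborel)" by (simp add: power2_eq_square)
  also have "\<dots> \<le> ?H\<^sup>2"
  proof (rule prekopa_leindlerD[OF prekopa_leindler_additive])
    fix x y :: 'a
    let ?m = "(1/2) *\<^sub>R (x + y)"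
    have "2 * (norm ?m)\<^sup>2 \<le> (norm (x + w))\<^sup>2 + (norm (- y + w))\<^sup>2"
    proof -
      have "norm (x + y) \<le> norm (x + w) + norm (- y + w)"
        using norm_triangle_ineq4[of "x + w" "- y + w"] by simp
      then have "(norm (x + y))\<^sup>2 \<le> (norm (x + w) + norm (- y + w))\<^sup>2" by (rule power_mono) simp
      also have "\<dots> \<le> 2 * ((norm (x + w))\<^sup>2 + (norm (- y + w))\<^sup>2)"
        using zero_le_power2[of "norm (x + w) - norm (- y + w)"] by (simp add: power2_eq_square algebra_simps)
      finally show ?thesis by (simp add: power_divide)
    qed
    then have "c * (2 * (norm ?m)\<^sup>2) \<le> c * ((norm (x + w))\<^sup>2 + (norm (- y + w))\<^sup>2)"
      using c by (rule mult_left_mono)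
    then have "2 * (\<psi> ?m + c * (norm ?m)\<^sup>2) \<le> (\<psi> x + c * (norm (x + w))\<^sup>2) + (\<psi> (- y) + c * (norm (- y + w))\<^sup>2)"
      using mid[of x y] unfolding even by (simp add: distrib_left)
    then show "?f x * ?f (- y) \<le> (ennreal (exp (- (\<psi> ?m + c * (norm ?m)\<^sup>2))))\<^sup>2"
      by (simp add: power2_eq_square flip: ennreal_mult exp_add)
  qed auto
  finally show ?thesis by (simp add: ennreal_power2_le_iff)
qed

text \<open>For fixed \<open>x\<close>, completing the square in \<open>v\<close> turns the cross
  term into a shift of \<open>v\<close> by \<open>(C / B) *\<^sub>R x\<close>, at the cost of
  \<open>C\<^sup>2 / B\<close> in the coefficient of the square of \<open>norm x\<close>. Dropping
  the shift cannot decrease the inner integral.\<close>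

lemma gaussian_shear_le:
  fixes E :: "'a::euclidean_space \<Rightarrow> 'a \<Rightarrow> real"
  assumes meas: "\<And>x. E x \<in> borel_measurable borel" and even: "\<And>x v. E x (- v) = E x v"
    and mid: "\<And>x v w. 2 * E x ((1/2) *\<^sub>R (v + w)) \<le> E x v + E x w" and B: "0 < B"
  shows "(\<integral>\<^sup>+x. (\<integral>\<^sup>+v. ennreal (exp (- (E x v + A * (norm x)\<^sup>2 + B * (norm v)\<^sup>2 + 2 * C * (x \<bullet> v)))) \<partial>lborel) \<partial>lborel)
    \<le> (\<integral>\<^sup>+x. (\<integral>\<^sup>+v. ennreal (exp (- (E x v + (A - C\<^sup>2 / B) * (norm x)\<^sup>2 + B * (norm v)\<^sup>2))) \<partial>lborel) \<partial>lborel)"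
proof (rule nn_integral_mono)
  fix x :: 'a
  define \<psi> where "\<psi> v = E x v + (A - C\<^sup>2 / B) * (norm x)\<^sup>2" for v
  have eq: "E x v + A * (norm x)\<^sup>2 + B * (norm v)\<^sup>2 + 2 * C * (x \<bullet> v) = \<psi> v + B * (norm (v + (C / B) *\<^sub>R x))\<^sup>2" for v
  proof -
    have "(norm (v + (C / B) *\<^sub>R x))\<^sup>2 = (norm v)\<^sup>2 + 2 * (C / B) * (x \<bullet> v) + (C / B)\<^sup>2 * (norm x)\<^sup>2"
      unfolding power2_norm_eq_inner
      by (simp add: inner_add_left inner_add_right inner_commute power2_eq_square algebra_simps)
    moreover have "B * ((norm v)\<^sup>2 + 2 * (C / B) * (x \<bullet> v) + (C / B)\<^sup>2 * (norm x)\<^sup>2)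
      = B * (norm v)\<^sup>2 + 2 * C * (x \<bullet> v) + C\<^sup>2 / B * (norm x)\<^sup>2"
      using B by (simp add: field_simps power2_eq_square)
    ultimately show ?thesis by (simp add: \<psi>_def algebra_simps)
  qed
  have eq2: "E x v + (A - C\<^sup>2 / B) * (norm x)\<^sup>2 + B * (norm v)\<^sup>2 = \<psi> v + B * (norm v)\<^sup>2" for v
    by (simp add: \<psi>_def)
  show "(\<integral>\<^sup>+v. ennreal (exp (- (E x v + A * (norm x)\<^sup>2 + B * (norm v)\<^sup>2 + 2 * C * (x \<bullet> v)))) \<partial>lborel)
    \<le> (\<integral>\<^sup>+v. ennreal (exp (- (E x v + (A - C\<^sup>2 / B) * (norm x)\<^sup>2 + B * (norm v)\<^sup>2))) \<partial>lborel)"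
    unfolding eq eq2
  proof (rule gaussian_shift_le)
    show "\<psi> \<in> borel_measurable borel" unfolding \<psi>_def using meas[of x] by measurable
    show "2 * \<psi> ((1/2) *\<^sub>R (v + w)) \<le> \<psi> v + \<psi> w" for v w
      using mid[of x v w] by (simp add: \<psi>_def)
  qed (use even B in \<open>auto simp: \<psi>_def\<close>)
qed

lemma nn_integral_sum_difference:
  fixes G :: "'a::euclidean_space \<Rightarrow> 'a \<Rightarrow> ennreal"
  assumes [measurable]: "case_prod G \<in> borel_measurable (borel \<Otimes>\<^sub>M borel)"
  shows "(\<integral>\<^sup>+x. (\<integral>\<^sup>+y. G x y \<partial>lborel) \<partial>lborel)
    = ennreal (2 ^ DIM('a)) * (\<integral>\<^sup>+u. (\<integral>\<^sup>+v. G (u + v) (u - v) \<partial>lborel) \<partial>lborel)"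
proof -
  have "(\<integral>\<^sup>+x. (\<integral>\<^sup>+y. G x y \<partial>lborel) \<partial>lborel)
    = (\<integral>\<^sup>+x. ennreal (2 ^ DIM('a)) * (\<integral>\<^sup>+v. G x (x - 2 *\<^sub>R v) \<partial>lborel) \<partial>lborel)"
  proof (rule nn_integral_cong)
    fix x
    have "(\<integral>\<^sup>+y. G x y \<partial>lborel) = ennreal (\<bar>- 2\<bar> ^ DIM('a)) * (\<integral>\<^sup>+v. G x (x + (- 2) *\<^sub>R v) \<partial>lborel)"
      by (rule nn_integral_lborel_affine) auto
    then show "(\<integral>\<^sup>+y. G x y \<partial>lborel) = ennreal (2 ^ DIM('a)) * (\<integral>\<^sup>+v. G x (x - 2 *\<^sub>R v) \<partial>lborel)" by simp
  qed
  also have "\<dots> = ennreal (2 ^ DIM('a)) * (\<integral>\<^sup>+x. (\<integral>\<^sup>+v. G x (x - 2 *\<^sub>R v) \<partial>lborel) \<partial>lborel)"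
    by (rule nn_integral_cmult) measurable
  also have "(\<integral>\<^sup>+x. (\<integral>\<^sup>+v. G x (x - 2 *\<^sub>R v) \<partial>lborel) \<partial>lborel) = (\<integral>\<^sup>+v. (\<integral>\<^sup>+x. G x (x - 2 *\<^sub>R v) \<partial>lborel) \<partial>lborel)"
    by (rule lborel_pair.Fubini'[symmetric]) measurable
  also have "\<dots> = (\<integral>\<^sup>+v. (\<integral>\<^sup>+u. G (u + v) (u - v) \<partial>lborel) \<partial>lborel)"
  proof (rule nn_integral_cong)
    fix v :: 'a
    have "(\<integral>\<^sup>+x. G x (x - 2 *\<^sub>R v) \<partial>lborel) = ennreal (\<bar>1\<bar> ^ DIM('a)) * (\<integral>\<^sup>+u. G (v + 1 *\<^sub>R u) (v + 1 *\<^sub>R u - 2 *\<^sub>R v) \<partial>lborel)"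
      by (rule nn_integral_lborel_affine) auto
    then show "(\<integral>\<^sup>+x. G x (x - 2 *\<^sub>R v) \<partial>lborel) = (\<integral>\<^sup>+u. G (u + v) (u - v) \<partial>lborel)"
      by (simp add: scaleR_2 algebra_simps)
  qed
  also have "\<dots> = (\<integral>\<^sup>+u. (\<integral>\<^sup>+v. G (u + v) (u - v) \<partial>lborel) \<partial>lborel)"
    by (rule lborel_pair.Fubini') measurable
  finally show ?thesis .
qed

text \<open>After the rotation \<open>x = u + v\<close>, \<open>y = u - v\<close>, the function \<open>\<phi> (u + v) + \<phi> (u - v)\<close> is even in
  \<open>v\<close> alone, so removing the cross term by completing the square in \<open>v\<close> can only increase the
  integral. Rotating back and doing the same once more yields a pair of Gaussian weights with the
  same product whose ratio is much closer to \<open>1\<close>.\<close>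

lemma gaussian_weights_contract:
  fixes \<phi> :: "'a::euclidean_space \<Rightarrow> real"
  assumes [measurable]: "\<phi> \<in> borel_measurable borel" and even: "\<And>x. \<phi> (- x) = \<phi> x"
    and mid: "\<And>x y. 2 * \<phi> ((1/2) *\<^sub>R (x + y)) \<le> \<phi> x + \<phi> y" and pos: "0 < \<alpha>" "0 < \<beta>"
  defines "I \<equiv> \<lambda>\<alpha>. \<integral>\<^sup>+x. ennreal (exp (- (\<phi> x + \<alpha> * (norm x)\<^sup>2))) \<partial>lborel"
    and "c \<equiv> \<alpha> + \<beta>" and "d \<equiv> 4 * \<alpha> * \<beta> / (\<alpha> + \<beta>)"
  shows "I \<alpha> * I \<beta> \<le> I (c * d / (c + d)) * I ((c + d) / 4)"
proof -
  let ?k = "ennreal (2 ^ DIM('a))"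
  have cd: "c > 0" "d > 0" using pos by (simp_all add: c_def d_def)
  have prod: "I \<alpha> * I \<beta> = (\<integral>\<^sup>+x. (\<integral>\<^sup>+y. ennreal (exp (- (\<phi> x + \<phi> y + \<alpha> * (norm x)\<^sup>2 + \<beta> * (norm y)\<^sup>2))) \<partial>lborel) \<partial>lborel)" for \<alpha> \<beta>
  proof -
    have "I \<alpha> * I \<beta> = (\<integral>\<^sup>+x. ennreal (exp (- (\<phi> x + \<alpha> * (norm x)\<^sup>2))) * I \<beta> \<partial>lborel)"
      unfolding I_def by (rule nn_integral_multc[symmetric]) measurable
    also have "\<dots> = (\<integral>\<^sup>+x. (\<integral>\<^sup>+y. ennreal (exp (- (\<phi> x + \<phi> y + \<alpha> * (norm x)\<^sup>2 + \<beta> * (norm y)\<^sup>2))) \<partial>lborel) \<partial>lborel)"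
      unfolding I_def
      by (intro nn_integral_cong, subst nn_integral_cmult[symmetric])
         (auto intro!: nn_integral_cong simp: algebra_simps simp flip: ennreal_mult exp_add)
    finally show ?thesis .
  qed
  have "I \<alpha> * I \<beta> = ?k * (\<integral>\<^sup>+u. (\<integral>\<^sup>+v. ennreal (exp (- (\<phi> (u + v) + \<phi> (u - v) + \<alpha> * (norm (u + v))\<^sup>2 + \<beta> * (norm (u - v))\<^sup>2))) \<partial>lborel) \<partial>lborel)"
    unfolding prod by (rule nn_integral_sum_difference) measurable
  \<comment> \<open>Both squares now carry the coefficient \<open>c\<close>; the difference of the
    weights survives only in the cross term.\<close>
  also have "\<dots> = ?k * (\<integral>\<^sup>+u. (\<integral>\<^sup>+v. ennreal (exp (- ((\<phi> (u + v) + \<phi> (u - v)) + c * (norm u)\<^sup>2 + c * (norm v)\<^sup>2 + 2 * (\<alpha> - \<beta>) * (u \<bullet> v)))) \<partial>lborel) \<partial>lborel)"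
    by (simp add: c_def power2_norm_eq_inner inner_add_left inner_add_right inner_diff_left inner_diff_right inner_commute algebra_simps)
  also have "\<dots> \<le> ?k * (\<integral>\<^sup>+u. (\<integral>\<^sup>+v. ennreal (exp (- ((\<phi> (u + v) + \<phi> (u - v)) + (c - (\<alpha> - \<beta>)\<^sup>2 / c) * (norm u)\<^sup>2 + c * (norm v)\<^sup>2))) \<partial>lborel) \<partial>lborel)"
  proof (intro mult_left_mono gaussian_shear_le)
    fix u v w :: 'a
    have "(1/2) *\<^sub>R ((u + v) + (u + w)) = u + (1/2) *\<^sub>R (v + w)" "(1/2) *\<^sub>R ((u - v) + (u - w)) = u - (1/2) *\<^sub>R (v + w)"
      by (simp_all add: scaleR_add_right scaleR_diff_right scaleR_left_distrib[symmetric] algebra_simps)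
    then show "2 * (\<phi> (u + (1/2) *\<^sub>R (v + w)) + \<phi> (u - (1/2) *\<^sub>R (v + w))) \<le> \<phi> (u + v) + \<phi> (u - v) + (\<phi> (u + w) + \<phi> (u - w))"
      using mid[of "u + v" "u + w"] mid[of "u - v" "u - w"] by simp
  qed (use cd in auto)
  also have "c - (\<alpha> - \<beta>)\<^sup>2 / c = d"
    using pos by (simp add: c_def d_def field_simps power2_eq_square)
  also have "?k * (\<integral>\<^sup>+u. (\<integral>\<^sup>+v. ennreal (exp (- ((\<phi> (u + v) + \<phi> (u - v)) + d * (norm u)\<^sup>2 + c * (norm v)\<^sup>2))) \<partial>lborel) \<partial>lborel)
    = ?k * (\<integral>\<^sup>+u. (\<integral>\<^sup>+v. ennreal (exp (- (\<phi> (u + v) + \<phi> (u - v) + d * (norm ((1/2) *\<^sub>R ((u + v) + (u - v))))\<^sup>2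
        + c * (norm ((1/2) *\<^sub>R ((u + v) - (u - v))))\<^sup>2))) \<partial>lborel) \<partial>lborel)"
    by (simp flip: scaleR_2)
  \<comment> \<open>Undoing the change of variables cancels the factor
    \<open>2 ^ DIM('a)\<close>.\<close>
  also have "\<dots> = (\<integral>\<^sup>+x. (\<integral>\<^sup>+y. ennreal (exp (- (\<phi> x + \<phi> y + d * (norm ((1/2) *\<^sub>R (x + y)))\<^sup>2 + c * (norm ((1/2) *\<^sub>R (x - y)))\<^sup>2))) \<partial>lborel) \<partial>lborel)"
    by (rule nn_integral_sum_difference[symmetric]) measurable
  also have "\<dots> = (\<integral>\<^sup>+x. (\<integral>\<^sup>+y. ennreal (exp (- ((\<phi> x + \<phi> y) + (c + d) / 4 * (norm x)\<^sup>2 + (c + d) / 4 * (norm y)\<^sup>2 + 2 * ((d - c) / 4) * (x \<bullet> y)))) \<partial>lborel) \<partial>lborel)"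
  proof -
    have "\<phi> x + \<phi> y + d * (norm ((1/2) *\<^sub>R (x + y)))\<^sup>2 + c * (norm ((1/2) *\<^sub>R (x - y)))\<^sup>2
      = (\<phi> x + \<phi> y) + (c + d) / 4 * (norm x)\<^sup>2 + (c + d) / 4 * (norm y)\<^sup>2 + 2 * ((d - c) / 4) * (x \<bullet> y)" for x y
    proof -
      have "(norm (x + y))\<^sup>2 = (norm x)\<^sup>2 + (norm y)\<^sup>2 + 2 * (x \<bullet> y)" "(norm (x - y))\<^sup>2 = (norm x)\<^sup>2 + (norm y)\<^sup>2 - 2 * (x \<bullet> y)"
        unfolding power2_norm_eq_inner
        by (simp_all add: inner_add_left inner_add_right inner_diff_left inner_diff_right inner_commute)
      then show ?thesis by (simp add: power_divide) (simp add: field_simps)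
    qed
    then show ?thesis by (simp only:)
  qed
  also have "\<dots> \<le> (\<integral>\<^sup>+x. (\<integral>\<^sup>+y. ennreal (exp (- ((\<phi> x + \<phi> y) + ((c + d) / 4 - ((d - c) / 4)\<^sup>2 / ((c + d) / 4)) * (norm x)\<^sup>2 + (c + d) / 4 * (norm y)\<^sup>2))) \<partial>lborel) \<partial>lborel)"
    by (rule gaussian_shear_le) (use cd mid even in auto)
  \<comment> \<open>The new coefficients multiply to \<open>c * d / 4 = \<alpha> * \<beta>\<close>,
    so the product of the weights is preserved.\<close>
  also have "(c + d) / 4 - ((d - c) / 4)\<^sup>2 / ((c + d) / 4) = c * d / (c + d)"
  proof -
    have "((d - c) / 4)\<^sup>2 / ((c + d) / 4) = (d - c)\<^sup>2 / (4 * (c + d))" by (simp add: power_divide)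
    moreover have "(c + d) / 4 - (d - c)\<^sup>2 / (4 * (c + d)) = ((c + d)\<^sup>2 - (d - c)\<^sup>2) / (4 * (c + d))"
      using cd by (simp add: field_simps power2_eq_square)
    moreover have "(c + d)\<^sup>2 - (d - c)\<^sup>2 = 4 * (c * d)" by (simp add: power2_eq_square algebra_simps)
    moreover have "4 * (c * d) / (4 * (c + d)) = c * d / (c + d)" by (rule mult_divide_mult_cancel_left) simp
    ultimately show ?thesis by (simp only:)
  qed
  finally show ?thesis by (simp add: prod)
qed

text \<open>Every pass of \<open>gaussian_weights_contract\<close> turns the weights
  \<open>g / q\<close>, \<open>g * q\<close> into \<open>g / r\<close>, \<open>g * r\<close>, where
  \<open>r - 1\<close> is at most a quarter of \<open>q - 1\<close>. No finite number of passes
  reaches \<open>r = 1\<close>, so the last gap is bridged by \<open>emeasure_lp_ball_le\<close> and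
  a limit.\<close>

lemma midpoint_volume_euclidean:
  fixes a :: "'a::euclidean_space \<Rightarrow> real"
  assumes a: "is_norm a"
  shows "emeasure lborel (lp_ball 2 a norm s) * emeasure lborel (lp_ball 2 a norm t)
    \<le> (emeasure lborel (lp_ball 2 a norm ((s + t) / 2)))\<^sup>2"
proof -
  have sa: "is_seminorm a" by (rule is_norm_seminorm[OF a])
  have sn: "is_seminorm (norm :: 'a \<Rightarrow> real)" by (rule is_norm_seminorm[OF is_norm_norm])
  have p: "(2::real) \<ge> 1" by simp
  note [measurable] = seminorm_measurable[OF sa]
  define \<phi> where "\<phi> x = (a x)\<^sup>2" for x
  have [measurable]: "\<phi> \<in> borel_measurable borel" unfolding \<phi>_def by measurable
  have p2: "r powr 2 = r\<^sup>2" if "0 \<le> r" for r :: real using that by (simp add: powr_numeral)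
  have \<phi>: "\<phi> (- x) = \<phi> x" "2 * \<phi> ((1/2) *\<^sub>R (x + y)) \<le> \<phi> x + \<phi> y" for x y
    using seminorm_powr_midpoint[OF sa p, of x y] seminorm_nonneg[OF sa]
    by (simp_all add: \<phi>_def seminorm_minus[OF sa] p2)
  define I where "I \<alpha> = (\<integral>\<^sup>+x. ennreal (exp (- (\<phi> x + \<alpha> * (norm x)\<^sup>2))) \<partial>lborel)" for \<alpha>
  define V where "V t = emeasure lborel (lp_ball 2 a norm t)" for t
  define \<Gamma> where "\<Gamma> = ennreal (Gamma (real DIM('a) / 2 + 1))"
  have IV: "I (exp t) = \<Gamma> * V t" for t
    using nn_integral_exp_lp_energy[OF p a sn, of t] seminorm_nonneg[OF sa]
    by (simp add: I_def V_def \<Gamma>_def lp_energy_def \<phi>_def p2)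
  have step: "\<exists>r\<ge>1. r - 1 \<le> (q - 1) / 4 \<and> I (g / q) * I (g * q) \<le> I (g / r) * I (g * r)"
    if q: "1 \<le> q" and g: "0 < g" for q g :: real
  proof -
    \<comment> \<open>\<open>C\<close> and \<open>r\<close> are two Newton steps for the square root
      of 1 starting from \<open>q\<close>, one for each completion of the square: below,
      \<open>c = 2 * g * C\<close>, \<open>d = 2 * g / C\<close> and
      \<open>(c + d) / 4 = g * r\<close>.\<close>
    define C where "C = (q + 1 / q) / 2"
    have C1: "C - 1 = (q - 1)\<^sup>2 / (2 * q)" using q by (simp add: C_def field_simps power2_eq_square)
    have "(q - 1)\<^sup>2 / (2 * q) \<le> (q - 1) / 2"
    proof -
      have "(q - 1) * (q - 1) \<le> (q - 1) * q" using q by (intro mult_left_mono) auto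
      then show ?thesis using q by (simp add: field_simps power2_eq_square)
    qed
    moreover have "0 \<le> (q - 1)\<^sup>2 / (2 * q)" using q by simp
    ultimately have C: "1 \<le> C" "C - 1 \<le> (q - 1) / 2" using C1 by linarith+
    define r where "r = (C + 1 / C) / 2"
    have r1: "r - 1 = (C - 1)\<^sup>2 / (2 * C)" using C(1) by (simp add: r_def field_simps power2_eq_square)
    have "(C - 1)\<^sup>2 / (2 * C) \<le> (C - 1) / 2"
    proof -
      have "(C - 1) * (C - 1) \<le> (C - 1) * C" using C by (intro mult_left_mono) auto
      then show ?thesis using C by (simp add: field_simps power2_eq_square)
    qed
    moreover have "0 \<le> (C - 1)\<^sup>2 / (2 * C)" using C by simp
    ultimately have r: "1 \<le> r" "r - 1 \<le> (q - 1) / 4" using r1 C by argo+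
    define c d where "c = g / q + g * q" and "d = 4 * (g / q) * (g * q) / (g / q + g * q)"
    have c: "c = 2 * g * C" using q by (simp add: c_def C_def field_simps)
    have d: "d = 2 * g / C"
    proof -
      have "d = 4 * g\<^sup>2 / c" using q by (simp add: d_def c_def power2_eq_square)
      then show ?thesis using g C unfolding c by (simp add: field_simps power2_eq_square)
    qed
    have e1: "(c + d) / 4 = g * r" unfolding c d r_def using C g by (simp add: field_simps)
    have "c * d = 4 * g\<^sup>2" unfolding c d using C by (simp add: power2_eq_square)
    moreover have "c + d = 4 * (g * r)" using e1 by simp
    ultimately have e2: "c * d / (c + d) = g / r" using g r by (simp add: field_simps power2_eq_square)
    have "I (g / q) * I (g * q) \<le> I (c * d / (c + d)) * I ((c + d) / 4)"
      unfolding I_def c_def d_def by (rule gaussian_weights_contract) (use \<phi> g q in auto)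
    then show ?thesis using r unfolding e1 e2 by blast
  qed
  have iter: "\<exists>r\<ge>1. r - 1 \<le> (q - 1) / 4 ^ n \<and> I (g / q) * I (g * q) \<le> I (g / r) * I (g * r)"
    if q: "1 \<le> q" and g: "0 < g" for q g :: real and n :: nat
  proof (induction n)
    case (Suc n)
    then obtain r where r: "1 \<le> r" "r - 1 \<le> (q - 1) / 4 ^ n" "I (g / q) * I (g * q) \<le> I (g / r) * I (g * r)"
      by blast
    from step[OF r(1) g] obtain r' where r': "1 \<le> r'" "r' - 1 \<le> (r - 1) / 4" "I (g / r) * I (g * r) \<le> I (g / r') * I (g * r')"
      by blast
    have "(r - 1) / 4 \<le> (q - 1) / 4 ^ n / 4" using r(2) by (rule divide_right_mono) simp
    then have "r' - 1 \<le> (q - 1) / 4 ^ Suc n"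
      using r'(2) unfolding divide_divide_eq_left power_Suc2 by (rule order.trans[rotated])
    then show ?case using r'(1) r(3) r'(3) order.trans by blast
  qed (use q in auto)
  have \<Gamma>: "0 < \<Gamma>" "\<Gamma> < top"
    unfolding \<Gamma>_def using Gamma_real_pos[of "real DIM('a) / 2 + 1"] by (auto simp: add_nonneg_pos)
  have main: "V s * V t \<le> (V ((s + t) / 2))\<^sup>2" if st: "s \<le> t" for s t
  proof -
    define m h where "m = (s + t) / 2" and "h = (t - s) / 2"
    have e: "exp m / exp h = exp s" "exp m * exp h = exp t"
      by (simp_all add: m_def h_def field_simps flip: exp_diff exp_add)
    define z where "z n = 1 + (exp h - 1) / 4 ^ n" for n :: nat
    have le: "V s * V t \<le> (V m)\<^sup>2 * ennreal (z n ^ DIM('a))" for n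
    proof -
      have "1 \<le> exp h" using st by (simp add: h_def)
      from iter[OF this, of "exp m" n] obtain r
        where r: "1 \<le> r" "r - 1 \<le> (exp h - 1) / 4 ^ n" "I (exp m / exp h) * I (exp m * exp h) \<le> I (exp m / r) * I (exp m * r)"
        by auto
      have "exp m / r = exp (m - ln r)" "exp m * r = exp (m + ln r)"
        using r(1) by (simp_all add: exp_diff exp_add)
      then have "\<Gamma>\<^sup>2 * (V s * V t) \<le> \<Gamma>\<^sup>2 * (V (m - ln r) * V (m + ln r))"
        using r(3) unfolding e by (simp add: IV power2_eq_square mult_ac)
      then have "V s * V t \<le> V (m - ln r) * V (m + ln r)"
        using \<Gamma> by (subst (asm) ennreal_mult_le_mult_iff) (auto simp: power_eq_top_ennreal)
      \<comment> \<open>The ball at the larger parameter lies in the one at \<open>m\<close>; the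
        volume of the other exceeds that at \<open>m\<close> by at most a power of
        \<open>r\<close>.\<close>
      also have "\<dots> \<le> (ennreal (exp (real DIM('a) / 2 * (m - (m - ln r)))) * V m) * V m"
        unfolding V_def using r(1)
        by (intro mult_mono emeasure_lp_ball_le[OF p a sn] emeasure_mono lp_ball_antimono[OF p a sn])
           (auto simp: lp_ball_borel[OF p a sn])
      also have "exp (real DIM('a) / 2 * (m - (m - ln r))) \<le> z n ^ DIM('a)"
      proof -
        have "exp (real DIM('a) / 2 * (m - (m - ln r))) \<le> exp (real DIM('a) * ln r)"
          using r(1) by (simp add: mult_right_mono)
        also have "\<dots> = r ^ DIM('a)" using r(1) by (simp add: exp_of_nat_mult)
        also have "\<dots> \<le> z n ^ DIM('a)" using r by (intro power_mono) (auto simp: z_def)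
        finally show ?thesis .
      qed
      finally show ?thesis by (simp add: power2_eq_square mult_ac mult_left_mono mult_right_mono ennreal_leI)
    qed
    have Vfin: "(V m)\<^sup>2 < top"
      using emeasure_lp_ball_finite[OF p a sn, of m] by (simp add: V_def power_less_top_ennreal)
    have lim0: "(\<lambda>n. (1/4::real) ^ n) \<longlonglongrightarrow> 0" by (rule LIMSEQ_realpow_zero) auto
    have "(\<lambda>n. (1 + (exp h - 1) * (1/4) ^ n) ^ DIM('a)) \<longlonglongrightarrow> (1 + (exp h - 1) * 0) ^ DIM('a)"
      by (intro tendsto_power tendsto_add tendsto_mult tendsto_const lim0)
    then have "(\<lambda>n. z n ^ DIM('a)) \<longlonglongrightarrow> 1" by (simp add: z_def power_divide)
    then have "(\<lambda>n. (V m)\<^sup>2 * ennreal (z n ^ DIM('a))) \<longlonglongrightarrow> (V m)\<^sup>2 * ennreal 1"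
      using Vfin by (intro ennreal_tendsto_cmult tendsto_ennrealI)
    then have "V s * V t \<le> (V m)\<^sup>2 * ennreal 1" using le by (intro LIMSEQ_le_const) auto
    then show ?thesis by (simp add: m_def)
  qed
  show ?thesis
    using main[of s t] main[of t s] unfolding V_def by (cases "s \<le> t") (auto simp: mult.commute add.commute)
qed

section \<open>Planar bodies\<close>

type_synonym plane = "real \<times> real"

section \<open>Determinants, coordinates and areas in the plane\<close>

definition det2 :: "plane \<Rightarrow> plane \<Rightarrow> real" where
  "det2 P Q = fst P * snd Q - snd P * fst Q"

lemma nn_integral_plane:
  fixes g :: "plane \<Rightarrow> ennreal"
  assumes [measurable]: "g \<in> borel_measurable borel"
  shows "(\<integral>\<^sup>+z. g z \<partial>lborel) = (\<integral>\<^sup>+x. (\<integral>\<^sup>+y. g (x, y) \<partial>lborel) \<partial>lborel)"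
proof -
  have "g \<in> borel_measurable (lborel \<Otimes>\<^sub>M lborel)" by (simp add: lborel_prod)
  from lborel.nn_integral_fst[OF this] show ?thesis by (simp add: lborel_prod)
qed

text \<open>The map is split into a shear with scaling in the second coordinate and an affine
  substitution in the first. The shear divides by the first component of \<open>P\<close>; the
  general case exchanges \<open>P\<close> and \<open>Q\<close> if that component vanishes.\<close>

lemma nn_integral_plane_linear_aux:
  fixes g :: "plane \<Rightarrow> ennreal"
  assumes [measurable]: "g \<in> borel_measurable borel" and det: "det2 P Q \<noteq> 0" and P: "fst P \<noteq> 0"
  shows "(\<integral>\<^sup>+z. g z \<partial>lborel) = ennreal \<bar>det2 P Q\<bar> * (\<integral>\<^sup>+x. (\<integral>\<^sup>+y. g (x *\<^sub>R P + y *\<^sub>R Q) \<partial>lborel) \<partial>lborel)"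
proof -
  obtain p1 p2 q1 q2 where PQ: "P = (p1, p2)" "Q = (q1, q2)" by fastforce
  define d where "d = det2 P Q / p1"
  have p1: "p1 \<noteq> 0" and d: "d \<noteq> 0" using P det by (auto simp: PQ d_def)
  have "(\<integral>\<^sup>+z. g z \<partial>lborel) = (\<integral>\<^sup>+u. (\<integral>\<^sup>+v. g (u, v) \<partial>lborel) \<partial>lborel)"
    by (rule nn_integral_plane) simp
  also have "\<dots> = (\<integral>\<^sup>+u. ennreal \<bar>d\<bar> * (\<integral>\<^sup>+y. g (u, p2 * u / p1 + d * y) \<partial>lborel) \<partial>lborel)"
    by (intro nn_integral_cong nn_integral_real_affine d) measurable
  also have "\<dots> = ennreal \<bar>d\<bar> * (\<integral>\<^sup>+u. (\<integral>\<^sup>+y. g (u, p2 * u / p1 + d * y) \<partial>lborel) \<partial>lborel)"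
    by (rule nn_integral_cmult) measurable
  also have "(\<integral>\<^sup>+u. (\<integral>\<^sup>+y. g (u, p2 * u / p1 + d * y) \<partial>lborel) \<partial>lborel)
    = (\<integral>\<^sup>+y. (\<integral>\<^sup>+u. g (u, p2 * u / p1 + d * y) \<partial>lborel) \<partial>lborel)"
    by (rule lborel_pair.Fubini'[symmetric]) measurable
  also have "\<dots> = (\<integral>\<^sup>+y. ennreal \<bar>p1\<bar> * (\<integral>\<^sup>+x. g (x *\<^sub>R P + y *\<^sub>R Q) \<partial>lborel) \<partial>lborel)"
  proof (rule nn_integral_cong)
    fix y :: real
    have "(\<integral>\<^sup>+u. g (u, p2 * u / p1 + d * y) \<partial>lborel)
      = ennreal \<bar>p1\<bar> * (\<integral>\<^sup>+x. g (q1 * y + p1 * x, p2 * (q1 * y + p1 * x) / p1 + d * y) \<partial>lborel)"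
      by (rule nn_integral_real_affine) (use p1 in measurable)
    moreover have "(q1 * y + p1 * x, p2 * (q1 * y + p1 * x) / p1 + d * y) = x *\<^sub>R P + y *\<^sub>R Q" for x
      using p1 by (simp add: PQ d_def det2_def field_simps)
    ultimately show "(\<integral>\<^sup>+u. g (u, p2 * u / p1 + d * y) \<partial>lborel) = ennreal \<bar>p1\<bar> * (\<integral>\<^sup>+x. g (x *\<^sub>R P + y *\<^sub>R Q) \<partial>lborel)"
      by simp
  qed
  also have "\<dots> = ennreal \<bar>p1\<bar> * (\<integral>\<^sup>+y. (\<integral>\<^sup>+x. g (x *\<^sub>R P + y *\<^sub>R Q) \<partial>lborel) \<partial>lborel)"
    by (rule nn_integral_cmult) measurable
  also have "(\<integral>\<^sup>+y. (\<integral>\<^sup>+x. g (x *\<^sub>R P + y *\<^sub>R Q) \<partial>lborel) \<partial>lborel) = (\<integral>\<^sup>+x. (\<integral>\<^sup>+y. g (x *\<^sub>R P + y *\<^sub>R Q) \<partial>lborel) \<partial>lborel)"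
    by (rule lborel_pair.Fubini') measurable
  also have "ennreal \<bar>d\<bar> * (ennreal \<bar>p1\<bar> * R) = ennreal \<bar>det2 P Q\<bar> * R" for R
    using p1 by (simp add: d_def abs_mult flip: mult.assoc ennreal_mult')
  finally show ?thesis .
qed

lemma nn_integral_plane_linear:
  fixes g :: "plane \<Rightarrow> ennreal"
  assumes [measurable]: "g \<in> borel_measurable borel" and det: "det2 P Q \<noteq> 0"
  shows "(\<integral>\<^sup>+z. g z \<partial>lborel) = ennreal \<bar>det2 P Q\<bar> * (\<integral>\<^sup>+x. (\<integral>\<^sup>+y. g (x *\<^sub>R P + y *\<^sub>R Q) \<partial>lborel) \<partial>lborel)"
proof (cases "fst P = 0")
  case True
  then have "det2 Q P \<noteq> 0" "fst Q \<noteq> 0" using det by (auto simp: det2_def)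
  then have "(\<integral>\<^sup>+z. g z \<partial>lborel) = ennreal \<bar>det2 Q P\<bar> * (\<integral>\<^sup>+y. (\<integral>\<^sup>+x. g (y *\<^sub>R Q + x *\<^sub>R P) \<partial>lborel) \<partial>lborel)"
    by (intro nn_integral_plane_linear_aux) auto
  also have "\<bar>det2 Q P\<bar> = \<bar>det2 P Q\<bar>" by (simp add: det2_def abs_minus_commute mult.commute)
  also have "(\<integral>\<^sup>+y. (\<integral>\<^sup>+x. g (y *\<^sub>R Q + x *\<^sub>R P) \<partial>lborel) \<partial>lborel) = (\<integral>\<^sup>+y. (\<integral>\<^sup>+x. g (x *\<^sub>R P + y *\<^sub>R Q) \<partial>lborel) \<partial>lborel)"
    by (simp add: add.commute)
  also have "\<dots> = (\<integral>\<^sup>+x. (\<integral>\<^sup>+y. g (x *\<^sub>R P + y *\<^sub>R Q) \<partial>lborel) \<partial>lborel)"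
    by (rule lborel_pair.Fubini') measurable
  finally show ?thesis .
qed (use nn_integral_plane_linear_aux[OF assms] in simp)

text \<open>Cramer's rule for the first coordinate of \<open>z\<close> in the basis
  \<open>P\<close>, \<open>Q\<close>.\<close>

definition ucoord :: "plane \<Rightarrow> plane \<Rightarrow> plane \<Rightarrow> real" where
  "ucoord P Q z = det2 z Q / det2 P Q"

definition vcoord :: "plane \<Rightarrow> plane \<Rightarrow> plane \<Rightarrow> real" where
  "vcoord P Q z = det2 P z / det2 P Q"

lemma coord_expand:
  assumes "det2 P Q \<noteq> 0"
  shows "z = ucoord P Q z *\<^sub>R P + vcoord P Q z *\<^sub>R Q"
proof -
  obtain p1 p2 q1 q2 z1 z2 where *: "P = (p1, p2)" "Q = (q1, q2)" "z = (z1, z2)" by (metis surj_pair)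
  have "det2 P Q * z1 = det2 z Q * p1 + det2 P z * q1" "det2 P Q * z2 = det2 z Q * p2 + det2 P z * q2"
    by (simp_all add: * det2_def algebra_simps)
  then show ?thesis using assms by (simp add: ucoord_def vcoord_def *(3)) (simp add: * field_simps)
qed

lemma coord_combination [simp]:
  assumes "det2 P Q \<noteq> 0"
  shows "ucoord P Q (x *\<^sub>R P + y *\<^sub>R Q) = x" "vcoord P Q (x *\<^sub>R P + y *\<^sub>R Q) = y"
proof -
  have "det2 (x *\<^sub>R P + y *\<^sub>R Q) Q = x * det2 P Q" "det2 P (x *\<^sub>R P + y *\<^sub>R Q) = y * det2 P Q"
    by (simp_all add: det2_def algebra_simps)
  then show "ucoord P Q (x *\<^sub>R P + y *\<^sub>R Q) = x" "vcoord P Q (x *\<^sub>R P + y *\<^sub>R Q) = y"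
    using assms by (simp_all add: ucoord_def vcoord_def)
qed

lemma coord_continuous: "continuous_on S (ucoord P Q)" "continuous_on S (vcoord P Q)"
  unfolding ucoord_def[abs_def] vcoord_def[abs_def] det2_def divide_inverse
  by (intro continuous_intros)+

lemma coord_measurable [measurable]:
  "ucoord P Q \<in> borel_measurable borel" "vcoord P Q \<in> borel_measurable borel"
  by (intro borel_measurable_continuous_onI coord_continuous)+

definition sector :: "plane \<Rightarrow> plane \<Rightarrow> plane set" where
  "sector P Q = {z. 0 < ucoord P Q z \<and> 0 < vcoord P Q z}"

text \<open>The triangle with vertices 0, \<open>P\<close> and \<open>Q\<close>, without its two
  sides at the origin.\<close>

definition corner_triangle :: "plane \<Rightarrow> plane \<Rightarrow> plane set" where
  "corner_triangle P Q = {z. 0 < ucoord P Q z \<and> 0 < vcoord P Q z \<and> ucoord P Q z + vcoord P Q z \<le> 1}"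

lemma sector_corner_triangle_borel [measurable]: "sector P Q \<in> sets borel" "corner_triangle P Q \<in> sets borel"
  unfolding sector_def corner_triangle_def by measurable

lemma emeasure_corner_triangle:
  assumes "det2 P Q \<noteq> 0"
  shows "emeasure lborel (corner_triangle P Q) = ennreal (\<bar>det2 P Q\<bar> / 2)"
proof -
  have "emeasure lborel (corner_triangle P Q) = (\<integral>\<^sup>+z. indicator (corner_triangle P Q) z \<partial>lborel)" by simp
  also have "\<dots> = ennreal \<bar>det2 P Q\<bar> * (\<integral>\<^sup>+x. (\<integral>\<^sup>+y. indicator (corner_triangle P Q) (x *\<^sub>R P + y *\<^sub>R Q) \<partial>lborel) \<partial>lborel)"
    by (rule nn_integral_plane_linear) (use assms in auto)
  also have "(\<integral>\<^sup>+x. (\<integral>\<^sup>+y. indicator (corner_triangle P Q) (x *\<^sub>R P + y *\<^sub>R Q) \<partial>lborel) \<partial>lborel)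
    = (\<integral>\<^sup>+x. ennreal (1 - x) * indicator {0..1} x \<partial>lborel)"
  proof (rule nn_integral_cong_AE)
    have "AE x in lborel. x \<noteq> (0::real)" by (rule AE_lborel_singleton)
    then show "AE x in lborel. (\<integral>\<^sup>+y. indicator (corner_triangle P Q) (x *\<^sub>R P + y *\<^sub>R Q) \<partial>lborel) = ennreal (1 - x) * indicator {0..1} x"
    proof eventually_elim
      fix x :: real assume x: "x \<noteq> 0"
      have "(\<integral>\<^sup>+y. indicator (corner_triangle P Q) (x *\<^sub>R P + y *\<^sub>R Q) \<partial>lborel)
        = (\<integral>\<^sup>+y. indicator (if 0 < x then {0<..1 - x} else {}) y \<partial>lborel)"
        using assms by (intro nn_integral_cong) (auto simp: corner_triangle_def indicator_def)
      also have "\<dots> = emeasure lborel (if 0 < x then {0<..1 - x} else {})"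
        by (rule nn_integral_indicator) auto
      also have "\<dots> = ennreal (1 - x) * indicator {0..1} x"
        using x by (auto simp: indicator_def)
      finally show "(\<integral>\<^sup>+y. indicator (corner_triangle P Q) (x *\<^sub>R P + y *\<^sub>R Q) \<partial>lborel) = ennreal (1 - x) * indicator {0..1} x" .
    qed
  qed
  also have "\<dots> = ennreal ((1 - 1\<^sup>2 / 2) - (0 - 0\<^sup>2 / 2))"
    by (rule nn_integral_FTC_Icc) (auto intro!: derivative_eq_intros)
  also have "ennreal \<bar>det2 P Q\<bar> * \<dots> = ennreal (\<bar>det2 P Q\<bar> * ((1 - 1\<^sup>2 / 2) - (0 - 0\<^sup>2 / 2)))"
    by (rule ennreal_mult'[symmetric]) simp
  finally show ?thesis by simp
qed

lemma measure_corner_triangle: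
  assumes "det2 P Q \<noteq> 0"
  shows "measure lborel (corner_triangle P Q) = \<bar>det2 P Q\<bar> / 2" "corner_triangle P Q \<in> fmeasurable lborel"
  using emeasure_corner_triangle[OF assms] by (auto simp: measure_def fmeasurable_def)

lemma emeasure_parallelogram:
  assumes "det2 P Q \<noteq> 0"
  shows "emeasure lborel {z. \<bar>ucoord P Q z\<bar> \<le> 1 \<and> \<bar>vcoord P Q z\<bar> \<le> 1} = ennreal (4 * \<bar>det2 P Q\<bar>)"
    (is "emeasure lborel ?S = _")
proof -
  have S [measurable]: "?S \<in> sets borel" by measurable
  have "emeasure lborel ?S = (\<integral>\<^sup>+z. indicator ?S z \<partial>lborel)" by (rule nn_integral_indicator[symmetric]) simp
  also have "\<dots> = ennreal \<bar>det2 P Q\<bar> * (\<integral>\<^sup>+x. (\<integral>\<^sup>+y. indicator ?S (x *\<^sub>R P + y *\<^sub>R Q) \<partial>lborel) \<partial>lborel)"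
    by (rule nn_integral_plane_linear) (use assms in auto)
  also have "(\<integral>\<^sup>+x. (\<integral>\<^sup>+y. indicator ?S (x *\<^sub>R P + y *\<^sub>R Q) \<partial>lborel) \<partial>lborel)
    = (\<integral>\<^sup>+x. (\<integral>\<^sup>+y. indicator {-1..1::real} y \<partial>lborel) * indicator {-1..1::real} x \<partial>lborel)"
    using assms by (intro nn_integral_cong, subst nn_integral_multc[symmetric])
      (auto intro!: nn_integral_cong simp: indicator_def abs_le_iff)
  also have "\<dots> = ennreal 4" by (simp add: nn_integral_cmult flip: ennreal_mult)
  also have "ennreal \<bar>det2 P Q\<bar> * ennreal 4 = ennreal (4 * \<bar>det2 P Q\<bar>)"
    by (subst ennreal_mult'[symmetric]) (simp_all add: mult.commute)
  finally show ?thesis .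
qed

section \<open>Slopes at the ends of a sector and the area gained there\<close>

text \<open>\<open>\<gamma>\<close> is the right derivative at 0 of
  \<open>n (P + s *\<^sub>R Q)\<close> as a function of \<open>s\<close>, obtained as the infimum of
  the difference quotients. By convexity it defines a supporting functional at \<open>P\<close>, and
  the quotients come within \<open>e\<close> of it on a whole interval. The unit circle may have a
  corner at \<open>P\<close>.\<close>

lemma seminorm_slope:
  fixes n :: "'a::real_vector \<Rightarrow> real"
  assumes n: "is_seminorm n" and P: "n P = 1" and Q: "n Q \<le> 1"
  obtains \<gamma> where "\<bar>\<gamma>\<bar> \<le> 1" "\<And>x y. x + \<gamma> * y \<le> n (x *\<^sub>R P + y *\<^sub>R Q)"
    "\<And>e. 0 < e \<Longrightarrow> \<exists>r>0. \<forall>s. 0 < s \<and> s \<le> r \<longrightarrow> n (P + s *\<^sub>R Q) \<le> 1 + (\<gamma> + e) * s"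
proof -
  define k where "k s = (n (P + s *\<^sub>R Q) - 1) / s" for s
  define \<gamma> where "\<gamma> = Inf (k ` {0<..})"
  have k_ge: "- 1 \<le> k s" if "0 < s" for s
  proof -
    have "n P \<le> n (P + s *\<^sub>R Q) + s * n Q"
      using is_seminormD(1)[OF n, of "P + s *\<^sub>R Q" "- (s *\<^sub>R Q)"] that
      by (simp add: seminorm_minus[OF n] is_seminormD(2)[OF n])
    moreover have "s * n Q \<le> s * 1" using Q that by (intro mult_left_mono) auto
    ultimately have "- s \<le> n (P + s *\<^sub>R Q) - 1" using P by linarith
    then show ?thesis using that by (simp add: k_def field_simps)
  qed
  have k_le: "k s \<le> 1" if "0 < s" for s
  proof -
    have "n (P + s *\<^sub>R Q) \<le> 1 + s * n Q"
      using is_seminormD(1)[OF n, of P "s *\<^sub>R Q"] that P by (simp add: is_seminormD(2)[OF n])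
    moreover have "s * n Q \<le> s * 1" using Q that by (intro mult_left_mono) auto
    ultimately have "n (P + s *\<^sub>R Q) - 1 \<le> s" by linarith
    then show ?thesis using that by (simp add: k_def field_simps)
  qed
  have bdd: "bdd_below (k ` {0<..})" using k_ge by (auto simp: bdd_below_def)
  have \<gamma>_le: "\<gamma> \<le> k s" if "0 < s" for s
    unfolding \<gamma>_def using that by (intro cInf_lower bdd) auto
  have \<gamma>1: "\<gamma> \<le> 1" using \<gamma>_le[of 1] k_le[of 1] by simp
  have \<gamma>2: "- 1 \<le> \<gamma>" unfolding \<gamma>_def using k_ge by (intro cInf_greatest) auto
  have near: "\<exists>s>0. k s < \<gamma> + e" if "0 < e" for e
    using cInf_lessD[of "k ` {0<..}" "\<gamma> + e"] that unfolding \<gamma>_def by auto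
  have line: "1 + \<gamma> * s \<le> n (P + s *\<^sub>R Q)" for s
  proof (cases "s = 0 \<or> 0 < s")
    case True
    then show ?thesis using \<gamma>_le[of s] P by (auto simp: k_def field_simps)
  next
    case False
    then have s: "s < 0" by simp
    show ?thesis
    proof (rule field_le_epsilon)
      fix e :: real assume e: "0 < e"
      have "0 < e / - s" using e s by (intro divide_pos_pos) auto
      then obtain r where r: "r > 0" "k r < \<gamma> + e / - s" using near by blast
      \<comment> \<open>Since \<open>s < 0 < r\<close>, the point \<open>P\<close> lies between
        \<open>P + s *\<^sub>R Q\<close> and \<open>P + r *\<^sub>R Q\<close>; convexity converts
        the upper bound on the right into a lower bound on the left.\<close>
      have "P = (r / (r - s)) *\<^sub>R (P + s *\<^sub>R Q) + (- s / (r - s)) *\<^sub>R (P + r *\<^sub>R Q)"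
      proof -
        have "(r / (r - s)) *\<^sub>R (P + s *\<^sub>R Q) + (- s / (r - s)) *\<^sub>R (P + r *\<^sub>R Q)
          = (r / (r - s) + - s / (r - s)) *\<^sub>R P + (r / (r - s) * s + - s / (r - s) * r) *\<^sub>R Q"
          by (simp only: scaleR_add_right scaleR_add_left scaleR_scaleR add_ac)
        also have "r / (r - s) + - s / (r - s) = 1"
          using r s by (simp only: add_divide_distrib[symmetric]) (simp add: divide_self_if)
        also have "r / (r - s) * s + - s / (r - s) * r = 0" by simp
        finally show ?thesis by simp
      qed
      then have "1 \<le> \<bar>r / (r - s)\<bar> * n (P + s *\<^sub>R Q) + \<bar>- s / (r - s)\<bar> * n (P + r *\<^sub>R Q)"
        using seminorm_combine[OF n] P by metis
      also have "\<bar>r / (r - s)\<bar> = r / (r - s)"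
        using r s by (intro abs_of_nonneg divide_nonneg_nonneg) auto
      also have "\<bar>- s / (r - s)\<bar> = - s / (r - s)"
        using r s by (intro abs_of_nonneg divide_nonneg_nonneg) auto
      finally have "(r - s) * 1 \<le> (r - s) * (r / (r - s) * n (P + s *\<^sub>R Q) + - s / (r - s) * n (P + r *\<^sub>R Q))"
        using r s by (intro mult_left_mono) auto
      also have "\<dots> = r * n (P + s *\<^sub>R Q) - s * n (P + r *\<^sub>R Q)"
      proof -
        have "r - s \<noteq> 0" using r s by simp
        then show ?thesis by (simp add: right_diff_distrib)
      qed
      also have "n (P + r *\<^sub>R Q) = 1 + r * k r" using r by (simp add: k_def)
      finally have "r * (1 + s * k r) \<le> r * n (P + s *\<^sub>R Q)" by (simp add: algebra_simps)
      then have "1 + s * k r \<le> n (P + s *\<^sub>R Q)" using r(1) by simp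
      moreover have "s * (\<gamma> + e / - s) \<le> s * k r" using r(2) s by (intro mult_left_mono_neg) auto
      moreover have "s * (\<gamma> + e / - s) = \<gamma> * s - e" using s by (simp add: field_simps)
      ultimately show "1 + \<gamma> * s \<le> n (P + s *\<^sub>R Q) + e" by linarith
    qed
  qed
  have pos: "x + \<gamma> * y \<le> n (x *\<^sub>R P + y *\<^sub>R Q)" if x: "0 < x" for x y
  proof -
    have "x * (1 + \<gamma> * (y / x)) \<le> x * n (P + (y / x) *\<^sub>R Q)" using x by (intro mult_left_mono line) auto
    also have "\<dots> = n (x *\<^sub>R (P + (y / x) *\<^sub>R Q))" using x by (simp add: is_seminormD(2)[OF n])
    finally show ?thesis using x by (simp add: scaleR_add_right distrib_left)
  qed
  have all: "x + \<gamma> * y \<le> n (x *\<^sub>R P + y *\<^sub>R Q)" for x y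
  proof (cases "0 < x")
    case False
    \<comment> \<open>For this \<open>t\<close> the point
      \<open>P + t *\<^sub>R (x *\<^sub>R P + y *\<^sub>R Q)\<close> has a positive first
      coordinate, so the case already settled applies to it, and subadditivity takes the bound
      back.\<close>
    define t where "t = 1 / (1 - x)"
    have t: "0 < t" "0 < 1 + t * x" using False by (simp_all add: t_def field_simps)
    have "1 + t * x + \<gamma> * (t * y) \<le> n ((1 + t * x) *\<^sub>R P + (t * y) *\<^sub>R Q)" by (rule pos[OF t(2)])
    also have "(1 + t * x) *\<^sub>R P + (t * y) *\<^sub>R Q = P + t *\<^sub>R (x *\<^sub>R P + y *\<^sub>R Q)"
      by (simp add: scaleR_add_left scaleR_add_right)
    also have "n \<dots> \<le> 1 + t * n (x *\<^sub>R P + y *\<^sub>R Q)"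
      using is_seminormD(1)[OF n, of P "t *\<^sub>R (x *\<^sub>R P + y *\<^sub>R Q)"] t(1) P by (simp add: is_seminormD(2)[OF n])
    finally have "t * (x + \<gamma> * y) \<le> t * n (x *\<^sub>R P + y *\<^sub>R Q)" by (simp add: algebra_simps)
    then show ?thesis using t(1) by simp
  qed (rule pos)
  have upper: "\<exists>r>0. \<forall>s. 0 < s \<and> s \<le> r \<longrightarrow> n (P + s *\<^sub>R Q) \<le> 1 + (\<gamma> + e) * s" if e: "0 < e" for e
  proof -
    obtain r where r: "r > 0" "k r < \<gamma> + e" using near[OF e] by blast
    have "n (P + s *\<^sub>R Q) \<le> 1 + (\<gamma> + e) * s" if s: "0 < s" "s \<le> r" for s
    proof -
      have "P + s *\<^sub>R Q = (1 - s / r) *\<^sub>R P + (s / r) *\<^sub>R (P + r *\<^sub>R Q)"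
        using r by (simp add: scaleR_add_right scaleR_diff_left)
      then have "n (P + s *\<^sub>R Q) \<le> \<bar>1 - s / r\<bar> * 1 + \<bar>s / r\<bar> * n (P + r *\<^sub>R Q)"
        using seminorm_combine[OF n] P by metis
      also have "\<bar>1 - s / r\<bar> = 1 - s / r" using r s by auto
      also have "\<bar>s / r\<bar> = s / r" using r s by auto
      also have "n (P + r *\<^sub>R Q) = 1 + r * k r" using r by (simp add: k_def)
      also have "(1 - s / r) * 1 + s / r * (1 + r * k r) = 1 + k r * s" using r by (simp add: field_simps)
      also have "\<dots> \<le> 1 + (\<gamma> + e) * s" using r s by (intro add_left_mono mult_right_mono) auto
      finally show ?thesis .
    qed
    then show ?thesis using r(1) by blast
  qed
  show ?thesis using that[of \<gamma>] \<gamma>1 \<gamma>2 all upper by (simp add: abs_le_iff)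
qed

lemma sector_swap: "sector Q P = sector P Q" "ucoord Q P z = vcoord P Q z" "vcoord Q P z = ucoord P Q z"
proof -
  have 1: "ucoord Q P z = vcoord P Q z" "vcoord Q P z = ucoord P Q z" for z
    unfolding ucoord_def vcoord_def det2_def
    by (metis (no_types, lifting) minus_diff_eq minus_divide_divide mult.commute)+
  then show "sector Q P = sector P Q" "ucoord Q P z = vcoord P Q z" "vcoord Q P z = ucoord P Q z"
    by (auto simp: sector_def)
qed

text \<open>On the ray through \<open>P + s *\<^sub>R Q\<close> with small \<open>s\<close>, the
  value of \<open>a\<close> is at least \<open>1 + \<alpha> * s\<close> and that of \<open>b\<close>
  at most about \<open>1 + \<beta> * s\<close>. So \<open>b \<le> exp h * a\<close> holds there
  while \<open>(\<beta> - \<alpha>) * s\<close> stays below about \<open>h\<close>, that is, up to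
  \<open>s = c * h\<close>. Division by \<open>1 + c * h\<close> puts the third vertex into the unit
  ball of \<open>a\<close>, because \<open>a P = a Q = 1\<close>. The condition comparing
  \<open>vcoord\<close> and \<open>ucoord\<close> keeps the triangle apart from its counterpart at
  \<open>Q\<close>.\<close>

lemma end_triangle:
  fixes a b :: "plane \<Rightarrow> real"
  assumes a: "is_seminorm a" and b: "is_seminorm b" and P: "a P = 1" "b P = 1" and Q: "a Q = 1" "b Q = 1"
    and det: "det2 P Q \<noteq> 0" and ab: "\<And>z. z \<in> sector P Q \<Longrightarrow> a z < b z"
  obtains \<alpha> \<beta> where "- 1 \<le> \<alpha>" "\<alpha> \<le> \<beta>" "\<beta> \<le> 1"
    "\<And>x y. x + \<alpha> * y \<le> a (x *\<^sub>R P + y *\<^sub>R Q)" "\<And>x y. x + \<beta> * y \<le> b (x *\<^sub>R P + y *\<^sub>R Q)"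
    "\<And>c. 0 < c \<Longrightarrow> c * (\<beta> - \<alpha>) < 1 \<Longrightarrow> \<exists>d>0. \<forall>h. 0 < h \<and> h < d \<longrightarrow>
       corner_triangle P ((1 / (1 + c * h)) *\<^sub>R (P + (c * h) *\<^sub>R Q))
         \<subseteq> {z \<in> sector P Q. a z \<le> 1 \<and> b z \<le> exp h * a z \<and> vcoord P Q z < ucoord P Q z}"
proof -
  obtain \<alpha> where \<alpha>: "\<bar>\<alpha>\<bar> \<le> 1" "\<And>x y. x + \<alpha> * y \<le> a (x *\<^sub>R P + y *\<^sub>R Q)"
    using seminorm_slope[OF a P(1)] Q(1) by (metis order_refl)
  obtain \<beta> where \<beta>: "\<bar>\<beta>\<bar> \<le> 1" "\<And>x y. x + \<beta> * y \<le> b (x *\<^sub>R P + y *\<^sub>R Q)"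
    "\<And>e. 0 < e \<Longrightarrow> \<exists>r>0. \<forall>s. 0 < s \<and> s \<le> r \<longrightarrow> b (P + s *\<^sub>R Q) \<le> 1 + (\<beta> + e) * s"
    using seminorm_slope[OF b P(2)] Q(2) by (metis order_refl)
  have in_sector: "x *\<^sub>R P + y *\<^sub>R Q \<in> sector P Q" if "0 < x" "0 < y" for x y
    using that det by (simp add: sector_def)
  have le: "\<alpha> \<le> \<beta>"
  proof (rule field_le_epsilon)
    fix e :: real assume "0 < e"
    then obtain r where r: "r > 0" "b (P + r *\<^sub>R Q) \<le> 1 + (\<beta> + e) * r" using \<beta>(3) by blast
    have "a (1 *\<^sub>R P + r *\<^sub>R Q) < b (1 *\<^sub>R P + r *\<^sub>R Q)" using r(1) by (intro ab in_sector) auto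
    then have "\<alpha> * r \<le> (\<beta> + e) * r" using r(2) \<alpha>(2)[of 1 r] by simp
    then show "\<alpha> \<le> \<beta> + e" using r(1) by simp
  qed
  have main: "\<exists>d>0. \<forall>h. 0 < h \<and> h < d \<longrightarrow>
       corner_triangle P ((1 / (1 + c * h)) *\<^sub>R (P + (c * h) *\<^sub>R Q))
         \<subseteq> {z \<in> sector P Q. a z \<le> 1 \<and> b z \<le> exp h * a z \<and> vcoord P Q z < ucoord P Q z}"
    if c: "0 < c" "c * (\<beta> - \<alpha>) < 1" for c
  proof -
    \<comment> \<open>\<open>c * e\<close> is half of the slack in
      \<open>c * (\<beta> - \<alpha>) < 1\<close>: one half pays for approximating \<open>b\<close>
      by its slope, the other for \<open>1 + \<alpha> * s \<ge> 1 - c * e\<close>.\<close>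
    define e where "e = (1 - c * (\<beta> - \<alpha>)) / (2 * c)"
    have e: "0 < e" "c * (\<beta> - \<alpha> + e) = 1 - c * e" using c by (simp_all add: e_def field_simps)
    obtain r where r: "r > 0" "\<And>s. 0 < s \<Longrightarrow> s \<le> r \<Longrightarrow> b (P + s *\<^sub>R Q) \<le> 1 + (\<beta> + e) * s"
      using \<beta>(3)[OF e(1)] by blast
    define d where "d = min (r / c) (min (1 / c) e)"
    have d: "0 < d" using r(1) c(1) e(1) by (simp add: d_def)
    have "corner_triangle P ((1 / (1 + c * h)) *\<^sub>R (P + (c * h) *\<^sub>R Q))
         \<subseteq> {z \<in> sector P Q. a z \<le> 1 \<and> b z \<le> exp h * a z \<and> vcoord P Q z < ucoord P Q z}"
      if h: "0 < h" "h < d" for h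
    proof
      fix z
      define \<eta> where "\<eta> = c * h"
      let ?R = "(1 / (1 + \<eta>)) *\<^sub>R (P + \<eta> *\<^sub>R Q)"
      have \<eta>: "0 < \<eta>" "\<eta> \<le> r" "\<eta> < 1" "\<eta> \<le> c * e"
        using h c(1) by (auto simp: \<eta>_def d_def field_simps)
      have detR: "det2 P ?R = \<eta> / (1 + \<eta>) * det2 P Q" by (simp add: det2_def algebra_simps)
      then have detR0: "det2 P ?R \<noteq> 0" using \<eta>(1) det by simp
      assume "z \<in> corner_triangle P ((1 / (1 + c * h)) *\<^sub>R (P + (c * h) *\<^sub>R Q))"
      then have "z \<in> corner_triangle P ?R" by (simp add: \<eta>_def)
      then obtain x y where xy: "0 < x" "0 < y" "x + y \<le> 1" and z: "z = x *\<^sub>R P + y *\<^sub>R ?R"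
        using coord_expand[OF detR0, of z] by (auto simp: corner_triangle_def)
      define u v where "u = x + y / (1 + \<eta>)" and "v = y * \<eta> / (1 + \<eta>)"
      have zuv: "z = u *\<^sub>R P + v *\<^sub>R Q" by (simp add: z u_def v_def scaleR_add_left scaleR_add_right)
      have u: "0 < u" and v: "0 < v" using xy \<eta> by (auto simp: u_def v_def intro!: add_pos_pos)
      have "y / (1 + \<eta>) + y * \<eta> / (1 + \<eta>) = y"
        using \<eta>(1) by (simp add: add_divide_distrib[symmetric] distrib_left[symmetric, of y 1, simplified])
      then have uv1: "u + v = x + y" by (simp add: u_def v_def)
      have vu: "v \<le> \<eta> * u" using xy(1) \<eta>(1) by (simp add: u_def v_def distrib_left mult.commute)
      also have "\<eta> * u < 1 * u" using \<eta>(3) u by (intro mult_strict_right_mono)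
      finally have vltu: "v < u" by simp
      have zs: "z \<in> sector P Q" unfolding zuv by (rule in_sector[OF u v])
      have az1: "a z \<le> 1"
        using seminorm_combine[OF a, of u P v Q] P Q u v uv1 xy(3) unfolding zuv by simp
      define s where "s = v / u"
      have s: "0 < s" "s \<le> \<eta>" using u v vu by (auto simp: s_def field_simps)
      have "z = u *\<^sub>R (P + s *\<^sub>R Q)" using u by (simp add: zuv s_def scaleR_add_right)
      then have bz: "b z = u * b (P + s *\<^sub>R Q)" and az: "a z = u * a (P + s *\<^sub>R Q)"
        using u by (simp_all add: is_seminormD(2)[OF a] is_seminormD(2)[OF b])
      have \<alpha>s: "0 \<le> 1 + \<alpha> * s"
        using \<alpha>(1) s \<eta>(3) mult_mono[of "- \<alpha>" 1 s 1] by (auto simp: abs_le_iff)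
      have "(\<beta> - \<alpha> + e) * s \<le> (\<beta> - \<alpha> + e) * \<eta>" using le e(1) s by (intro mult_left_mono) auto
      also have "\<dots> = h * (c * (\<beta> - \<alpha> + e))" by (simp add: \<eta>_def mult_ac)
      also have "\<dots> = h * (1 - c * e)" by (simp add: e(2))
      also have "\<dots> \<le> h * (1 + \<alpha> * s)"
      proof (rule mult_left_mono)
        have "- \<alpha> * s \<le> 1 * s" using \<alpha>(1) s by (intro mult_right_mono) auto
        then show "1 - c * e \<le> 1 + \<alpha> * s" using s(2) \<eta>(4) by simp
      qed (use h in auto)
      finally have "1 + (\<beta> + e) * s \<le> (1 + h) * (1 + \<alpha> * s)" by (simp add: algebra_simps)
      also have "\<dots> \<le> exp h * (1 + \<alpha> * s)" using \<alpha>s by (intro mult_right_mono exp_ge_add_one_self)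
      also have "\<dots> \<le> exp h * a (P + s *\<^sub>R Q)" using \<alpha>(2)[of 1 s] by simp
      finally have "1 + (\<beta> + e) * s \<le> exp h * a (P + s *\<^sub>R Q)" .
      moreover have "b (P + s *\<^sub>R Q) \<le> 1 + (\<beta> + e) * s" using s \<eta>(2) by (intro r(2)) auto
      ultimately have "u * b (P + s *\<^sub>R Q) \<le> u * (exp h * a (P + s *\<^sub>R Q))" using u by (intro mult_left_mono) auto
      then have "b z \<le> exp h * a z" unfolding az bz by (simp add: mult_ac)
      then show "z \<in> {z \<in> sector P Q. a z \<le> 1 \<and> b z \<le> exp h * a z \<and> vcoord P Q z < ucoord P Q z}"
        using zs az1 vltu det by (simp add: zuv)
    qed
    then show ?thesis using d by blast
  qed
  show ?thesis using that[of \<alpha> \<beta>] \<alpha> \<beta>(1,2) le main by (simp add: abs_le_iff)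
qed

lemma norm_ball_fmeasurable:
  fixes a :: "'a::euclidean_space \<Rightarrow> real"
  assumes a: "is_norm a"
  shows "{z. a z \<le> r} \<in> fmeasurable lborel"
proof -
  note [measurable] = seminorm_measurable[OF is_norm_seminorm[OF a]]
  obtain e where e: "e > 0" "\<And>x. e * norm x \<le> a x" using a by (auto simp: is_norm_def)
  have "{z. a z \<le> r} \<subseteq> cball 0 (r / e)"
  proof
    fix z assume "z \<in> {z. a z \<le> r}"
    then have "e * norm z \<le> r" using e(2)[of z] by simp
    then show "z \<in> cball 0 (r / e)" using e(1) by (simp add: field_simps)
  qed
  moreover have "{z. a z \<le> r} \<in> sets lborel" by measurable
  ultimately show ?thesis using fmeasurableI2[OF fmeasurable_compact[OF compact_cball]] by blast
qed

text \<open>The triangles at the two ends are disjoint, and to first order in \<open>h\<close> each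
  has area \<open>\<bar>det2 P Q\<bar> * c * h / 2\<close>, where \<open>c\<close> is the reciprocal
  of the slope gap at that end. The \<open>e\<close> in the denominators covers the case of equal
  slopes. The factor 2 accounts for the opposite sector, which contributes the same area.\<close>

lemma sector_rate:
  fixes a b :: "plane \<Rightarrow> real"
  assumes na: "is_norm a" and b: "is_seminorm b" and P: "a P = 1" "b P = 1" and Q: "a Q = 1" "b Q = 1"
    and det: "det2 P Q \<noteq> 0" and ab: "\<And>z. z \<in> sector P Q \<Longrightarrow> a z < b z"
  obtains \<alpha> \<beta> \<alpha>' \<beta>' where "- 1 \<le> \<alpha>" "\<alpha> \<le> \<beta>" "\<beta> \<le> 1" "- 1 \<le> \<alpha>'" "\<alpha>' \<le> \<beta>'" "\<beta>' \<le> 1"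
    "\<And>x y. x + \<alpha> * y \<le> a (x *\<^sub>R P + y *\<^sub>R Q)" "\<And>x y. x + \<beta> * y \<le> b (x *\<^sub>R P + y *\<^sub>R Q)"
    "\<And>x y. \<alpha>' * x + y \<le> a (x *\<^sub>R P + y *\<^sub>R Q)" "\<And>x y. \<beta>' * x + y \<le> b (x *\<^sub>R P + y *\<^sub>R Q)"
    "\<And>e. 0 < e \<Longrightarrow> \<exists>d>0. \<forall>h. 0 < h \<and> h < d \<longrightarrow>
       h * (\<bar>det2 P Q\<bar> * (1 / (\<beta> - \<alpha> + e) + 1 / (\<beta>' - \<alpha>' + e)) - e)
       \<le> 2 * measure lborel {z \<in> sector P Q. a z \<le> 1 \<and> b z \<le> exp h * a z}"
proof -
  have a: "is_seminorm a" by (rule is_norm_seminorm[OF na])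
  note [measurable] = seminorm_measurable[OF a] seminorm_measurable[OF b]
  have det': "det2 Q P \<noteq> 0" "\<bar>det2 Q P\<bar> = \<bar>det2 P Q\<bar>" using det by (auto simp: det2_def mult.commute)
  define D where "D = \<bar>det2 P Q\<bar>"
  have D: "0 < D" using det by (simp add: D_def)
  obtain \<alpha> \<beta> where ends: "- 1 \<le> \<alpha>" "\<alpha> \<le> \<beta>" "\<beta> \<le> 1"
    "\<And>x y. x + \<alpha> * y \<le> a (x *\<^sub>R P + y *\<^sub>R Q)" "\<And>x y. x + \<beta> * y \<le> b (x *\<^sub>R P + y *\<^sub>R Q)"
    "\<And>c. 0 < c \<Longrightarrow> c * (\<beta> - \<alpha>) < 1 \<Longrightarrow> \<exists>d>0. \<forall>h. 0 < h \<and> h < d \<longrightarrow>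
       corner_triangle P ((1 / (1 + c * h)) *\<^sub>R (P + (c * h) *\<^sub>R Q))
         \<subseteq> {z \<in> sector P Q. a z \<le> 1 \<and> b z \<le> exp h * a z \<and> vcoord P Q z < ucoord P Q z}"
    using end_triangle[OF a b P Q det ab] by blast
  have ab': "\<And>z. z \<in> sector Q P \<Longrightarrow> a z < b z" using ab by (simp add: sector_swap)
  obtain \<alpha>' \<beta>' where ends': "- 1 \<le> \<alpha>'" "\<alpha>' \<le> \<beta>'" "\<beta>' \<le> 1"
    "\<And>x y. x + \<alpha>' * y \<le> a (x *\<^sub>R Q + y *\<^sub>R P)" "\<And>x y. x + \<beta>' * y \<le> b (x *\<^sub>R Q + y *\<^sub>R P)"
    "\<And>c. 0 < c \<Longrightarrow> c * (\<beta>' - \<alpha>') < 1 \<Longrightarrow> \<exists>d>0. \<forall>h. 0 < h \<and> h < d \<longrightarrow>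
       corner_triangle Q ((1 / (1 + c * h)) *\<^sub>R (Q + (c * h) *\<^sub>R P))
         \<subseteq> {z \<in> sector P Q. a z \<le> 1 \<and> b z \<le> exp h * a z \<and> ucoord P Q z < vcoord P Q z}"
    using end_triangle[OF a b Q P det'(1) ab'] unfolding sector_swap(1)[of Q P] sector_swap(2)[of Q P] sector_swap(3)[of Q P]
    by blast
  have rate: "\<exists>d>0. \<forall>h. 0 < h \<and> h < d \<longrightarrow>
       h * (D * (1 / (\<beta> - \<alpha> + e) + 1 / (\<beta>' - \<alpha>' + e)) - e)
       \<le> 2 * measure lborel {z \<in> sector P Q. a z \<le> 1 \<and> b z \<le> exp h * a z}" if e: "0 < e" for e
  proof -
    define c c' where "c = 1 / (\<beta> - \<alpha> + e)" and "c' = 1 / (\<beta>' - \<alpha>' + e)"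
    have X: "0 < \<beta> - \<alpha> + e" "0 < \<beta>' - \<alpha>' + e" using ends(2) ends'(2) e by auto
    then have c: "0 < c" "0 < c'" by (simp_all add: c_def c'_def)
    have c1: "c * (\<beta> - \<alpha>) < 1" "c' * (\<beta>' - \<alpha>') < 1" using X e by (simp_all add: c_def c'_def)
    obtain d where d: "0 < d"
      and sub: "\<And>h. 0 < h \<Longrightarrow> h < d \<Longrightarrow> corner_triangle P ((1 / (1 + c * h)) *\<^sub>R (P + (c * h) *\<^sub>R Q))
         \<subseteq> {z \<in> sector P Q. a z \<le> 1 \<and> b z \<le> exp h * a z \<and> vcoord P Q z < ucoord P Q z}"
      using ends(6)[OF c(1) c1(1)] by blast
    obtain d' where d': "0 < d'"
      and sub': "\<And>h. 0 < h \<Longrightarrow> h < d' \<Longrightarrow> corner_triangle Q ((1 / (1 + c' * h)) *\<^sub>R (Q + (c' * h) *\<^sub>R P))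
         \<subseteq> {z \<in> sector P Q. a z \<le> 1 \<and> b z \<le> exp h * a z \<and> ucoord P Q z < vcoord P Q z}"
      using ends'(6)[OF c(2) c1(2)] by blast
    \<comment> \<open>The third bound absorbs the quadratic loss in
      \<open>k * h / (1 + k * h) \<ge> k * h - k\<^sup>2 * h\<^sup>2\<close> at both ends into
      \<open>e * h\<close>.\<close>
    define d0 where "d0 = min (min d d') (e / (D * (c\<^sup>2 + c'\<^sup>2)))"
    have cc: "0 < D * (c\<^sup>2 + c'\<^sup>2)" using D c by (intro mult_pos_pos add_pos_pos) auto
    have d0: "0 < d0" using d d' e cc by (simp add: d0_def)
    have "h * (D * (c + c') - e) \<le> 2 * measure lborel {z \<in> sector P Q. a z \<le> 1 \<and> b z \<le> exp h * a z}"
      if h: "0 < h" "h < d0" for h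
    proof -
      let ?T = "{z \<in> sector P Q. a z \<le> 1 \<and> b z \<le> exp h * a z}"
      let ?A = "corner_triangle P ((1 / (1 + c * h)) *\<^sub>R (P + (c * h) *\<^sub>R Q))"
      let ?B = "corner_triangle Q ((1 / (1 + c' * h)) *\<^sub>R (Q + (c' * h) *\<^sub>R P))"
      have A: "?A \<subseteq> {z \<in> sector P Q. a z \<le> 1 \<and> b z \<le> exp h * a z \<and> vcoord P Q z < ucoord P Q z}"
        using h by (intro sub) (auto simp: d0_def)
      have B: "?B \<subseteq> {z \<in> sector P Q. a z \<le> 1 \<and> b z \<le> exp h * a z \<and> ucoord P Q z < vcoord P Q z}"
        using h by (intro sub') (auto simp: d0_def)
      have AB: "?A \<union> ?B \<subseteq> ?T" "?A \<inter> ?B = {}" using A B by fastforce+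
      have dA: "det2 P ((1 / (1 + c * h)) *\<^sub>R (P + (c * h) *\<^sub>R Q)) = c * h / (1 + c * h) * det2 P Q"
        by (simp add: det2_def algebra_simps)
      have dB: "det2 Q ((1 / (1 + c' * h)) *\<^sub>R (Q + (c' * h) *\<^sub>R P)) = c' * h / (1 + c' * h) * det2 Q P"
        by (simp add: det2_def algebra_simps)
      have p: "0 < c * h" "0 < c' * h" using c h by auto
      have nz: "det2 P ((1 / (1 + c * h)) *\<^sub>R (P + (c * h) *\<^sub>R Q)) \<noteq> 0" "det2 Q ((1 / (1 + c' * h)) *\<^sub>R (Q + (c' * h) *\<^sub>R P)) \<noteq> 0"
        unfolding dA dB using p det det' by auto
      have "?T \<in> sets borel" by measurable
      then have Tf: "?T \<in> fmeasurable lborel"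
        by (intro fmeasurableI2[OF norm_ball_fmeasurable[OF na, of 1]]) auto
      have "D * (c * h / (1 + c * h)) / 2 + D * (c' * h / (1 + c' * h)) / 2 = measure lborel ?A + measure lborel ?B"
        unfolding measure_corner_triangle(1)[OF nz(1)] measure_corner_triangle(1)[OF nz(2)] dA dB
        using p det' c h by (simp add: abs_mult D_def mult_ac)
      also have "\<dots> = measure lborel (?A \<union> ?B)"
        using measure_corner_triangle(2)[OF nz(1)] measure_corner_triangle(2)[OF nz(2)] AB(2)
        by (simp add: measure_Union fmeasurableD2)
      also have "\<dots> \<le> measure lborel ?T"
        by (rule measure_mono_fmeasurable[OF AB(1) _ Tf]) auto
      finally have "D * (c * h / (1 + c * h)) / 2 + D * (c' * h / (1 + c' * h)) / 2 \<le> measure lborel ?T" .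
      then have m: "D * (c * h / (1 + c * h) + c' * h / (1 + c' * h)) \<le> 2 * measure lborel ?T"
      proof -
        have "x + y \<le> 2 * m" if "x / 2 + y / 2 \<le> m" for x y m :: real using that by simp
        from this[OF \<open>D * (c * h / (1 + c * h)) / 2 + D * (c' * h / (1 + c' * h)) / 2 \<le> measure lborel ?T\<close>]
        show ?thesis by (simp only: distrib_left)
      qed
      have q: "k * h - k\<^sup>2 * h\<^sup>2 \<le> k * h / (1 + k * h)" if "0 < k * h" for k
      proof -
        have "(k * h - k\<^sup>2 * h\<^sup>2) * (1 + k * h) = k * h - (k * h) ^ 3"
          by (simp add: power2_eq_square power3_eq_cube algebra_simps)
        also have "\<dots> \<le> k * h" using that by simp
        finally show ?thesis using that by (simp add: pos_le_divide_eq)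
      qed
      have "h * (D * (c\<^sup>2 + c'\<^sup>2)) \<le> e" using h(2) cc by (simp add: d0_def pos_less_divide_eq less_imp_le)
      then have "h * (h * (D * (c\<^sup>2 + c'\<^sup>2))) \<le> h * e" using h(1) by (intro mult_left_mono) auto
      then have "h * (D * (c + c') - e) \<le> D * ((c * h - c\<^sup>2 * h\<^sup>2) + (c' * h - c'\<^sup>2 * h\<^sup>2))"
        by (simp add: algebra_simps power2_eq_square)
      also have "\<dots> \<le> D * (c * h / (1 + c * h) + c' * h / (1 + c' * h))"
        using D p by (intro mult_left_mono add_mono q) auto
      finally show ?thesis using m by simp
    qed
    then show ?thesis using d0 unfolding c_def c'_def by blast
  qed
  have "\<alpha>' * x + y \<le> a (x *\<^sub>R P + y *\<^sub>R Q)" "\<beta>' * x + y \<le> b (x *\<^sub>R P + y *\<^sub>R Q)" for x y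
    using ends'(4)[of y x] ends'(5)[of y x] by (simp_all add: add.commute)
  then show ?thesis
    using that[of \<alpha> \<beta> \<alpha>' \<beta>'] ends(1-5) ends'(1-3) rate unfolding D_def by blast
qed

section \<open>The double sectors of \<open>{a < b}\<close> and their areas\<close>

lemma emeasure_lborel_uminus:
  fixes S :: "'a::euclidean_space set"
  assumes [measurable]: "S \<in> sets borel"
  shows "emeasure lborel {x. - x \<in> S} = emeasure lborel S"
proof -
  have "emeasure lborel {x. - x \<in> S} = (\<integral>\<^sup>+x. indicator {x. - x \<in> S} x \<partial>lborel)"
    by (rule nn_integral_indicator[symmetric]) measurable
  also have "\<dots> = ennreal (\<bar>- 1\<bar> ^ DIM('a)) * (\<integral>\<^sup>+x. indicator {x. - x \<in> S} (0 + (- 1) *\<^sub>R x) \<partial>lborel)"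
    by (rule nn_integral_lborel_affine) auto
  also have "(\<integral>\<^sup>+x. indicator {x. - x \<in> S} (0 + (- 1) *\<^sub>R x) \<partial>lborel) = (\<integral>\<^sup>+x. indicator S x \<partial>lborel)"
    by (intro nn_integral_cong) (auto simp: indicator_def)
  finally show ?thesis by simp
qed

lemma measure_symmetric_ge:
  fixes S C :: "'a::euclidean_space set"
  assumes S: "S \<in> fmeasurable lborel" and sym: "\<And>z. - z \<in> S \<longleftrightarrow> z \<in> S"
    and C: "C \<in> sets borel" and dis: "\<And>z. z \<in> C \<Longrightarrow> - z \<notin> C"
  shows "2 * measure lborel (S \<inter> C) \<le> measure lborel S"
proof -
  have [measurable]: "S \<in> sets borel" "C \<in> sets borel" using S C by auto
  have f1: "S \<inter> C \<in> fmeasurable lborel" by (rule fmeasurableI2[OF S]) auto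
  have f2: "{z. - z \<in> S \<inter> C} \<in> fmeasurable lborel"
    by (rule fmeasurableI2[OF S]) (auto simp: sym)
  have "measure lborel {z. - z \<in> S \<inter> C} = measure lborel (S \<inter> C)"
    using emeasure_lborel_uminus[of "S \<inter> C"] by (simp add: measure_def)
  then have "2 * measure lborel (S \<inter> C) = measure lborel (S \<inter> C) + measure lborel {z. - z \<in> S \<inter> C}" by simp
  also have "\<dots> = measure lborel ((S \<inter> C) \<union> {z. - z \<in> S \<inter> C})"
    by (rule measure_Union[symmetric]) (use f1 f2 dis in \<open>auto simp: fmeasurableD2\<close>)
  also have "\<dots> \<le> measure lborel S"
    by (rule measure_mono_fmeasurable[OF _ _ S]) (use f1 f2 sym in auto)
  finally show ?thesis .
qed

lemma det2_combination:
  "det2 (p *\<^sub>R x + q *\<^sub>R y) (r *\<^sub>R x + t *\<^sub>R y) = (p * t - q * r) * det2 x y"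
  by (simp add: det2_def algebra_simps)

lemma det2_scale: "det2 (p *\<^sub>R x) (q *\<^sub>R y) = p * q * det2 x y"
  by (simp add: det2_def algebra_simps)

lemma coord_linear:
  "ucoord P Q (s *\<^sub>R z + t *\<^sub>R w) = s * ucoord P Q z + t * ucoord P Q w"
  "vcoord P Q (s *\<^sub>R z + t *\<^sub>R w) = s * vcoord P Q z + t * vcoord P Q w"
  by (simp_all add: ucoord_def vcoord_def det2_def algebra_simps add_divide_distrib diff_divide_distrib)

lemma coord_minus: "ucoord P Q (- z) = - ucoord P Q z" "vcoord P Q (- z) = - vcoord P Q z"
  using coord_linear[of P Q "- 1" z 0 z] by simp_all

lemma null_sets_line:
  assumes "y \<noteq> 0"
  shows "{z. det2 z y = 0} \<in> null_sets lborel"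
proof -
  have eq: "{z. det2 z y = 0} = {z. (snd y, - fst y) \<bullet> z = 0}"
    by (auto simp: det2_def inner_prod_def mult.commute)
  have "(snd y, - fst y) \<noteq> 0" using assms by (auto simp: prod_eq_iff)
  then have "negligible {z. det2 z y = 0}" unfolding eq by (intro negligible_hyperplane) auto
  moreover have "{z. det2 z y = 0} \<in> sets borel" unfolding eq by (intro borel_closed closed_hyperplane)
  ultimately show ?thesis by (simp add: negligible_iff_null_sets null_sets_completion_iff)
qed

lemma exit_point:
  fixes a b :: "plane \<Rightarrow> real"
  assumes a: "is_seminorm a" and b: "is_seminorm b" and x: "a x < b x" and y: "b y \<le> a y"
  obtains s where "0 < s" "s \<le> 1" "b ((1 - s) *\<^sub>R x + s *\<^sub>R y) = a ((1 - s) *\<^sub>R x + s *\<^sub>R y)"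
    "\<And>r. 0 \<le> r \<Longrightarrow> r < s \<Longrightarrow> a ((1 - r) *\<^sub>R x + r *\<^sub>R y) < b ((1 - r) *\<^sub>R x + r *\<^sub>R y)"
proof -
  define f where "f r = b ((1 - r) *\<^sub>R x + r *\<^sub>R y) - a ((1 - r) *\<^sub>R x + r *\<^sub>R y)" for r :: real
  have cont: "continuous_on S f" for S
    unfolding f_def
    by (intro continuous_intros continuous_on_compose2[OF seminorm_continuous[OF a, of UNIV]]
      continuous_on_compose2[OF seminorm_continuous[OF b, of UNIV]]) auto
  have "compact {r \<in> {0..1}. f r \<le> 0}"
  proof -
    have "closed ({0..1} \<inter> f -` {..0})"
      by (intro continuous_closed_preimage cont) auto
    moreover have "{0..1} \<inter> f -` {..0} = {r \<in> {0..1}. f r \<le> 0}" by auto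
    ultimately have "closed {r \<in> {0..1}. f r \<le> 0}" by simp
    moreover have "bounded {r \<in> {0..1}. f r \<le> 0}" by (rule bounded_subset[OF bounded_closed_interval[of 0 1]]) auto
    ultimately show ?thesis by (simp add: compact_eq_bounded_closed)
  qed
  moreover have "1 \<in> {r \<in> {0..1}. f r \<le> 0}" using y by (simp add: f_def)
  ultimately obtain s where s: "s \<in> {r \<in> {0..1}. f r \<le> 0}" "\<And>r. r \<in> {r \<in> {0..1}. f r \<le> 0} \<Longrightarrow> s \<le> r"
    using compact_attains_inf[of "{r \<in> {0..1}. f r \<le> 0}"] by blast
  have f0: "0 < f 0" using x by (simp add: f_def)
  have s0: "0 < s" using s(1) f0 by (cases "s = 0") auto
  have "f s = 0"
  proof -
    obtain r where r: "0 \<le> r" "r \<le> s" "f r = 0"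
      using IVT2'[of f s 0 0] s(1) f0 cont by auto
    then have "s \<le> r" using s by (intro s(2)) auto
    then show ?thesis using r by simp
  qed
  moreover have "0 < f r" if "0 \<le> r" "r < s" for r
    using s(2)[of r] that s(1) by (cases "f r \<le> 0") auto
  ultimately show ?thesis using that[of s] s0 s(1) by (auto simp: f_def)
qed

text \<open>Both seminorms are homogeneous, so their comparison is constant along a line through the
  origin.\<close>

lemma det2_nonzero_of_comparison:
  fixes a b :: "plane \<Rightarrow> real"
  assumes a: "is_seminorm a" and b: "is_seminorm b" and x: "a x < b x" and y: "b y \<le> a y" "y \<noteq> 0"
  shows "det2 x y \<noteq> 0"
proof
  assume d: "det2 x y = 0"
  obtain x1 x2 y1 y2 where *: "x = (x1, x2)" "y = (y1, y2)" by fastforce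
  have d': "x1 * y2 = x2 * y1" using d by (simp add: * det2_def)
  have "\<exists>c. x = c *\<^sub>R y"
  proof (cases "y1 = 0")
    case True
    then have "y2 \<noteq> 0" using y(2) by (auto simp: * zero_prod_def)
    then show ?thesis using d' True by (intro exI[of _ "x2 / y2"]) (auto simp: *)
  next
    case False
    then show ?thesis using d' by (intro exI[of _ "x1 / y1"]) (auto simp: * field_simps)
  qed
  then obtain c where c: "x = c *\<^sub>R y" by blast
  then have "b x \<le> a x" using y(1) by (simp add: is_seminormD(2)[OF a] is_seminormD(2)[OF b] mult_left_mono)
  then show False using x by simp
qed

text \<open>From \<open>x\<close> one walks towards \<open>y\<close> and towards \<open>- y\<close>,
  where \<open>b \<le> a\<close>, up to the first points with \<open>a = b\<close>. The two exit
  points, normalized, span the sector. They would be linearly dependent only if both walks ended at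
  \<open>y\<close> and \<open>- y\<close> themselves; then \<open>b \<le> a\<close> would hold only
  on a line, against the positive area.\<close>

lemma component_sector:
  fixes a b :: "plane \<Rightarrow> real"
  assumes na: "is_norm a" and nb: "is_norm b" and x: "a x < b x"
    and pos: "0 < emeasure lborel {z. a z \<le> 1 \<and> b z \<le> a z}"
  obtains P Q where "a P = 1" "b P = 1" "a Q = 1" "b Q = 1" "det2 P Q \<noteq> 0" "x \<in> sector P Q"
    "\<And>z. z \<in> sector P Q \<Longrightarrow> a z < b z"
proof -
  have a: "is_seminorm a" and b: "is_seminorm b" using na nb by (auto intro: is_norm_seminorm)
  note [measurable] = seminorm_measurable[OF a] seminorm_measurable[OF b]
  let ?S = "{z. a z \<le> 1 \<and> b z \<le> a z}"
  have "\<exists>y\<in>?S. y \<noteq> 0"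
  proof (rule ccontr)
    assume "\<not> (\<exists>y\<in>?S. y \<noteq> 0)"
    then have "?S \<subseteq> {0}" by auto
    then have "emeasure lborel ?S = 0"
      by (meson emeasure_lborel_countable finite.emptyI finite.insertI countable_finite countable_subset)
    then show False using pos by simp
  qed
  then obtain y where y: "b y \<le> a y" "y \<noteq> 0" by auto
  have det: "det2 x y \<noteq> 0" by (rule det2_nonzero_of_comparison[OF a b x y])
  have y': "b (- y) \<le> a (- y)" using y by (simp add: seminorm_minus a b)
  obtain s where s: "0 < s" "s \<le> 1" "b ((1 - s) *\<^sub>R x + s *\<^sub>R y) = a ((1 - s) *\<^sub>R x + s *\<^sub>R y)"
    "\<And>r. 0 \<le> r \<Longrightarrow> r < s \<Longrightarrow> a ((1 - r) *\<^sub>R x + r *\<^sub>R y) < b ((1 - r) *\<^sub>R x + r *\<^sub>R y)"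
    using exit_point[OF a b x y(1)] by blast
  obtain t where t: "0 < t" "t \<le> 1" "b ((1 - t) *\<^sub>R x + t *\<^sub>R (- y)) = a ((1 - t) *\<^sub>R x + t *\<^sub>R (- y))"
    "\<And>r. 0 \<le> r \<Longrightarrow> r < t \<Longrightarrow> a ((1 - r) *\<^sub>R x + r *\<^sub>R (- y)) < b ((1 - r) *\<^sub>R x + r *\<^sub>R (- y))"
    using exit_point[OF a b x y'] by blast
  \<comment> \<open>The condition \<open>Y * (1 - u) < u * X\<close> says that the ray through the
    point meets the segment from \<open>x\<close> to \<open>w\<close> at a parameter below the exit
    \<open>u\<close>.\<close>
  have ray: "a (X *\<^sub>R x + Y *\<^sub>R w) < b (X *\<^sub>R x + Y *\<^sub>R w)"
    if Y: "0 \<le> Y" and XY: "Y * (1 - u) < u * X" and u: "0 < u" "u \<le> 1"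
      and w: "\<And>r. 0 \<le> r \<Longrightarrow> r < u \<Longrightarrow> a ((1 - r) *\<^sub>R x + r *\<^sub>R w) < b ((1 - r) *\<^sub>R x + r *\<^sub>R w)" for X Y u w
  proof -
    have "0 \<le> Y * (1 - u)" using Y u by simp
    then have X: "0 < X" using XY u by (metis less_le_trans not_less order_less_imp_le zero_less_mult_pos le_less_trans)
    have sum: "0 < X + Y" using X Y by simp
    define r where "r = Y / (X + Y)"
    have "Y < u * (X + Y)" using XY by (simp add: algebra_simps)
    then have r: "0 \<le> r" "r < u" using Y sum by (simp_all add: r_def field_simps)
    have "(1 - r) = X / (X + Y)" using sum by (simp add: r_def field_simps)
    then have "X *\<^sub>R x + Y *\<^sub>R w = (X + Y) *\<^sub>R ((1 - r) *\<^sub>R x + r *\<^sub>R w)"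
      using sum by (simp add: r_def scaleR_add_right)
    then show ?thesis using w[OF r] sum by (simp add: is_seminormD(2)[OF a] is_seminormD(2)[OF b])
  qed
  have inU: "a (X *\<^sub>R x + Y *\<^sub>R y) < b (X *\<^sub>R x + Y *\<^sub>R y)"
    if "Y * (1 - s) < s * X" "- Y * (1 - t) < t * X" for X Y
  proof (cases "0 \<le> Y")
    case True
    then show ?thesis using ray[OF True that(1) s(1,2,4)] by blast
  next
    case False
    then have "a (X *\<^sub>R x + (- Y) *\<^sub>R (- y)) < b (X *\<^sub>R x + (- Y) *\<^sub>R (- y))"
      using ray[OF _ that(2) t(1,2,4)] by simp
    then show ?thesis by simp
  qed
  \<comment> \<open>\<open>K\<close> is the determinant of the exit points \<open>w2\<close>,
    \<open>w1\<close> relative to that of \<open>x\<close>, \<open>y\<close>.\<close>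
  define K where "K = s * (1 - t) + t * (1 - s)"
  have "K \<noteq> 0"
  proof
    assume "K = 0"
    moreover have "0 \<le> s * (1 - t)" "0 \<le> t * (1 - s)" using s(1,2) t(1,2) by auto
    ultimately have "s * (1 - t) = 0" "t * (1 - s) = 0" unfolding K_def by linarith+
    then have st: "s = 1" "t = 1" using s t by auto
    have U: "a z < b z" if "ucoord x y z > 0" for z
      using inU[of "vcoord x y z" "ucoord x y z"] that by (simp add: st coord_expand[OF det, symmetric])
    have "?S \<subseteq> {z. det2 z y = 0}"
    proof
      fix z assume z: "z \<in> ?S"
      have "\<not> ucoord x y z > 0" using U[of z] z by auto
      moreover have "\<not> ucoord x y (- z) > 0" using U[of "- z"] z by (auto simp: seminorm_minus a b)
      ultimately have "ucoord x y z = 0" by (simp add: coord_minus)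
      then show "z \<in> {z. det2 z y = 0}" using det by (simp add: ucoord_def)
    qed
    then have "?S \<in> null_sets lborel" by (rule null_sets_subset[OF null_sets_line[OF y(2)], rotated]) measurable
    then show False using pos by auto
  qed
  moreover have "0 \<le> K" using s(1,2) t(1,2) by (simp add: K_def)
  ultimately have K: "0 < K" by simp
  define w1 w2 where "w1 = (1 - s) *\<^sub>R x + s *\<^sub>R y" and "w2 = (1 - t) *\<^sub>R x + (- t) *\<^sub>R y"
  have "vcoord x y 0 = 0" by (simp add: vcoord_def det2_def)
  moreover have "vcoord x y w1 = s" "vcoord x y w2 = - t"
    unfolding w1_def w2_def by (simp_all only: coord_combination[OF det])
  ultimately have w0: "w1 \<noteq> 0" "w2 \<noteq> 0" using s(1) t(1) by auto
  have aw: "0 < a w1" "0 < a w2" "b w1 = a w1" "b w2 = a w2"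
    using w0 s(3) t(3) is_norm_pos[OF na] by (auto simp: w1_def w2_def)
  define P Q where "P = (1 / a w2) *\<^sub>R w2" and "Q = (1 / a w1) *\<^sub>R w1"
  have PQ: "a P = 1" "b P = 1" "a Q = 1" "b Q = 1"
    using aw by (simp_all add: P_def Q_def is_seminormD(2)[OF a] is_seminormD(2)[OF b])
  have "det2 w2 w1 = K * det2 x y"
    unfolding w1_def w2_def det2_combination by (simp add: K_def algebra_simps)
  then have dPQ: "det2 P Q \<noteq> 0" using K aw det by (simp add: P_def Q_def det2_scale)
  have "K *\<^sub>R x = s *\<^sub>R w2 + t *\<^sub>R w1"
  proof -
    have "s *\<^sub>R w2 + t *\<^sub>R w1 = (s * (1 - t) + t * (1 - s)) *\<^sub>R x + (s * - t + t * s) *\<^sub>R y"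
      by (simp only: w1_def w2_def scaleR_add_right scaleR_add_left scaleR_scaleR add_ac)
    then show ?thesis by (simp add: K_def)
  qed
  then have "x = (1 / K) *\<^sub>R (s *\<^sub>R w2 + t *\<^sub>R w1)" using K by (metis divide_inverse inverse_eq_divide scaleR_scaleR scaleR_one right_inverse less_irrefl mult.commute mult_1 divide_self)
  also have "\<dots> = (s * a w2 / K) *\<^sub>R P + (t * a w1 / K) *\<^sub>R Q"
    using aw by (simp add: P_def Q_def scaleR_add_right)
  finally have x_eq: "x = (s * a w2 / K) *\<^sub>R P + (t * a w1 / K) *\<^sub>R Q" .
  have xs: "x \<in> sector P Q"
  proof -
    have "ucoord P Q x = s * a w2 / K" "vcoord P Q x = t * a w1 / K"
      using coord_combination[OF dPQ] x_eq by metis+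
    then show ?thesis using s(1) t(1) aw K by (simp add: sector_def)
  qed
  have "a z < b z" if z: "z \<in> sector P Q" for z
  proof -
    define c d where "c = ucoord P Q z / a w2" and "d = vcoord P Q z / a w1"
    have cd: "0 < c" "0 < d" using z aw by (simp_all add: c_def d_def sector_def)
    have "z = c *\<^sub>R w2 + d *\<^sub>R w1"
      using coord_expand[OF dPQ, of z] by (simp add: P_def Q_def c_def d_def)
    also have "\<dots> = (c * (1 - t) + d * (1 - s)) *\<^sub>R x + (c * - t + d * s) *\<^sub>R y"
      by (simp only: w1_def w2_def scaleR_add_right scaleR_add_left scaleR_scaleR add_ac)
    finally have zeq: "z = (c * (1 - t) + d * (1 - s)) *\<^sub>R x + (c * - t + d * s) *\<^sub>R y" .
    have "s * (c * (1 - t) + d * (1 - s)) - (c * - t + d * s) * (1 - s) = c * K"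
      "t * (c * (1 - t) + d * (1 - s)) - - (c * - t + d * s) * (1 - t) = d * K"
      by (simp_all add: K_def algebra_simps)
    moreover have "0 < c * K" "0 < d * K" using cd K by auto
    ultimately show ?thesis unfolding zeq by (intro inU) linarith+
  qed
  then show ?thesis using that PQ dPQ xs by blast
qed

text \<open>A pair in the unit ball that maximizes the modulus of the determinant will do: replacing
  either member by \<open>z\<close> cannot increase it, and by Cramer's rule this bounds the
  coordinates of \<open>z\<close> by 1.\<close>

lemma auerbach:
  fixes n :: "plane \<Rightarrow> real"
  assumes n: "is_norm n"
  obtains E F where "n E \<le> 1" "n F \<le> 1" "det2 E F \<noteq> 0"
    "\<And>z. n z \<le> 1 \<Longrightarrow> \<bar>ucoord E F z\<bar> \<le> 1 \<and> \<bar>vcoord E F z\<bar> \<le> 1"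
proof -
  have s: "is_seminorm n" by (rule is_norm_seminorm[OF n])
  let ?B = "{z. n z \<le> 1}"
  have comp: "compact ?B"
  proof -
    obtain e where e: "e > 0" "\<And>x. e * norm x \<le> n x" using n by (auto simp: is_norm_def)
    have "norm z \<le> 1 / e" if "z \<in> ?B" for z
    proof -
      have "e * norm z \<le> 1" using that e(2)[of z] by simp
      then show ?thesis using e(1) by (simp add: field_simps)
    qed
    then have "bounded ?B" by (auto simp: bounded_iff)
    moreover have "closed (n -` {..1})" by (intro closed_vimage seminorm_continuous[OF s] closed_atMost)
    moreover have "n -` {..1} = ?B" by auto
    ultimately show ?thesis by (simp add: compact_eq_bounded_closed)
  qed
  have "compact (?B \<times> ?B)" using comp by (rule compact_Times) (rule comp)
  moreover have "(0, 0) \<in> ?B \<times> ?B" by (simp add: seminorm_0[OF s])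
  moreover have "continuous_on (?B \<times> ?B) (\<lambda>w. \<bar>det2 (fst w) (snd w)\<bar>)"
    unfolding det2_def by (intro continuous_intros)
  ultimately obtain w where w: "w \<in> ?B \<times> ?B" "\<And>w'. w' \<in> ?B \<times> ?B \<Longrightarrow> \<bar>det2 (fst w') (snd w')\<bar> \<le> \<bar>det2 (fst w) (snd w)\<bar>"
    using continuous_attains_sup[of "?B \<times> ?B" "\<lambda>w. \<bar>det2 (fst w) (snd w)\<bar>"] by blast
  obtain E F where EF: "w = (E, F)" by (cases w)
  have B: "n E \<le> 1" "n F \<le> 1" using w(1) by (auto simp: EF)
  have max: "\<bar>det2 z z'\<bar> \<le> \<bar>det2 E F\<bar>" if "n z \<le> 1" "n z' \<le> 1" for z z'
    using w(2)[of "(z, z')"] that by (simp add: EF)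
  obtain C where C: "C > 0" "\<And>x. n x \<le> C * norm x" using seminorm_upper_bound[OF s] by blast
  have "n (1 / C, 0) \<le> 1" "n (0, 1 / C) \<le> 1"
    using C(2)[of "(1 / C, 0)"] C(2)[of "(0, 1 / C)"] C(1) by (simp_all add: norm_Pair)
  then have "\<bar>det2 (1 / C, 0) (0, 1 / C)\<bar> \<le> \<bar>det2 E F\<bar>" by (rule max)
  then have d: "det2 E F \<noteq> 0" using mult_pos_pos[OF C(1) C(1)] by (auto simp: det2_def)
  have "\<bar>ucoord E F z\<bar> \<le> 1 \<and> \<bar>vcoord E F z\<bar> \<le> 1" if "n z \<le> 1" for z
    using max[OF that B(2)] max[OF B(1) that] d by (simp add: ucoord_def vcoord_def)
  then show ?thesis using that[of E F] B d by blast
qed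

text \<open>The functionals with slopes \<open>\<alpha>\<close> and \<open>\<beta>\<close> are
  bounded by 1 in modulus at \<open>E\<close> and \<open>F\<close>, so the determinant of these four
  values is at most 2 in modulus. Up to sign it equals
  \<open>(\<beta> - \<alpha>) * det2 E F / det2 P Q\<close>. The estimate bounds the rate at an end
  of a sector from below, independently of the sector.\<close>

lemma slope_gap_le:
  fixes a b :: "plane \<Rightarrow> real"
  assumes a: "is_seminorm a" and b: "is_seminorm b" and det: "det2 P Q \<noteq> 0"
    and la: "\<And>x y. x + \<alpha> * y \<le> a (x *\<^sub>R P + y *\<^sub>R Q)" and lb: "\<And>x y. x + \<beta> * y \<le> b (x *\<^sub>R P + y *\<^sub>R Q)"
    and E: "a E \<le> 1" "b E \<le> 1" and F: "a F \<le> 1" "b F \<le> 1"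
  shows "(\<beta> - \<alpha>) * \<bar>det2 E F\<bar> \<le> 2 * \<bar>det2 P Q\<bar>"
proof -
  have bound: "\<bar>ucoord P Q z + \<gamma> * vcoord P Q z\<bar> \<le> 1"
    if n: "is_seminorm n" and l: "\<And>x y. x + \<gamma> * y \<le> n (x *\<^sub>R P + y *\<^sub>R Q)" and z: "n z \<le> 1" for n \<gamma> z
  proof -
    have "ucoord P Q w + \<gamma> * vcoord P Q w \<le> n w" for w
      using l[of "ucoord P Q w" "vcoord P Q w"] by (simp add: coord_expand[OF det, symmetric])
    from this[of z] this[of "- z"] show ?thesis using z by (simp add: coord_minus seminorm_minus[OF n])
  qed
  define u v u' v' where "u = ucoord P Q E" and "v = vcoord P Q E" and "u' = ucoord P Q F" and "v' = vcoord P Q F"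
  have ab: "\<bar>u + \<alpha> * v\<bar> \<le> 1" "\<bar>u + \<beta> * v\<bar> \<le> 1" "\<bar>u' + \<alpha> * v'\<bar> \<le> 1" "\<bar>u' + \<beta> * v'\<bar> \<le> 1"
    unfolding u_def v_def u'_def v'_def
    by (rule bound[OF a la E(1)], rule bound[OF b lb E(2)], rule bound[OF a la F(1)], rule bound[OF b lb F(2)])
  have dEF: "det2 E F = (u * v' - v * u') * det2 P Q"
    using det2_combination[of u P v Q u' v']
    by (simp add: u_def v_def u'_def v'_def coord_expand[OF det, symmetric])
  have "(\<beta> - \<alpha>) * (u * v' - v * u') = (u + \<alpha> * v) * (u' + \<beta> * v') - (u' + \<alpha> * v') * (u + \<beta> * v)"
    by (simp add: algebra_simps)
  then have "\<bar>(\<beta> - \<alpha>) * (u * v' - v * u')\<bar> \<le> \<bar>u + \<alpha> * v\<bar> * \<bar>u' + \<beta> * v'\<bar> + \<bar>u' + \<alpha> * v'\<bar> * \<bar>u + \<beta> * v\<bar>"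
    by (metis abs_mult abs_triangle_ineq4)
  also have "\<dots> \<le> 1 * 1 + 1 * 1" using ab by (intro add_mono mult_mono) auto
  finally have "\<bar>\<beta> - \<alpha>\<bar> * \<bar>u * v' - v * u'\<bar> \<le> 2" by (simp add: abs_mult)
  then have "\<bar>\<beta> - \<alpha>\<bar> * \<bar>u * v' - v * u'\<bar> * \<bar>det2 P Q\<bar> \<le> 2 * \<bar>det2 P Q\<bar>" by (rule mult_right_mono) simp
  moreover have "(\<beta> - \<alpha>) * \<bar>det2 E F\<bar> \<le> \<bar>\<beta> - \<alpha>\<bar> * \<bar>det2 E F\<bar>" by (rule mult_right_mono) auto
  ultimately show ?thesis by (simp add: dEF abs_mult mult.assoc)
qed

text \<open>The segment from a common point to \<open>x\<close> must leave the first sector through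
  a boundary ray, where \<open>a = b\<close>, while by convexity it stays in the second, where
  \<open>a < b\<close>.\<close>

lemma sectors_disjoint:
  fixes a b :: "plane \<Rightarrow> real"
  assumes a: "is_seminorm a" and b: "is_seminorm b" and P: "a P = b P" and Q: "a Q = b Q" and det: "det2 P Q \<noteq> 0"
    and U: "\<And>z. z \<in> sector P' Q' \<Longrightarrow> a z < b z"
    and x: "x \<in> sector P' Q'" "x \<notin> sector P Q"
  shows "sector P Q \<inter> sector P' Q' = {}"
proof (rule ccontr)
  assume "sector P Q \<inter> sector P' Q' \<noteq> {}"
  then obtain z where z: "z \<in> sector P Q" "z \<in> sector P' Q'" by blast
  define w where "w t = (1 - t) *\<^sub>R z + t *\<^sub>R x" for t :: real
  \<comment> \<open>Positive exactly on the sector, so a zero of \<open>g\<close> is a crossing of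
    one of the boundary rays.\<close>
  define g where "g t = min (ucoord P Q (w t)) (vcoord P Q (w t))" for t
  have cont: "continuous_on {0..1} g"
    unfolding g_def w_def coord_linear by (intro continuous_intros)
  have "g 1 \<le> 0" using x(2) by (auto simp: g_def w_def sector_def min_def)
  moreover have "0 \<le> g 0" using z(1) by (simp add: g_def w_def sector_def)
  ultimately obtain t where t: "0 \<le> t" "t \<le> 1" "g t = 0" using IVT2'[of g 1 0 0] cont by auto
  have pos: "0 < (1 - t) * p + t * q" if "0 < p" "0 < q" for p q
  proof (cases "t = 1")
    case False
    then have "0 < (1 - t) * p" using t that by simp
    then show ?thesis using t that by (simp add: add_pos_nonneg)
  qed (use that in simp)
  have "w t \<in> sector P' Q'"
    using z(2) x(1) unfolding sector_def w_def mem_Collect_eq coord_linear by (auto intro: pos)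
  then have lt: "a (w t) < b (w t)" by (rule U)
  have "ucoord P Q (w t) = 0 \<or> vcoord P Q (w t) = 0" using t(3) by (auto simp: g_def min_def split: if_splits)
  then have "w t = vcoord P Q (w t) *\<^sub>R Q \<or> w t = ucoord P Q (w t) *\<^sub>R P"
    using coord_expand[OF det, of "w t"] by (metis add.left_neutral add.right_neutral scaleR_zero_left)
  then have "a (w t) = b (w t)"
    using P Q is_seminormD(2)[OF a] is_seminormD(2)[OF b] by metis
  then show False using lt by simp
qed

lemma sector_minus: "sector (- P) (- Q) = {z. - z \<in> sector P Q}"
proof -
  have "ucoord (- P) (- Q) z = ucoord P Q (- z)" "vcoord (- P) (- Q) z = vcoord P Q (- z)" for z
    by (simp_all add: ucoord_def vcoord_def det2_def)
  then show ?thesis by (simp add: sector_def)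
qed

lemma sector_no_antipodes: "z \<in> sector P Q \<Longrightarrow> - z \<notin> sector P Q"
  by (simp add: sector_def coord_minus)

text \<open>The lower bound on \<open>n\<close> confines the part of its unit ball in the sector to
  the triangle with vertices 0, \<open>P / p\<close> and \<open>Q / q\<close>, of area
  \<open>\<bar>det2 P Q\<bar> / (2 * p * q)\<close>. The opposite sector doubles this, and
  \<open>N\<close> makes room for boundary rays.\<close>

lemma sector_area_product_le:
  fixes n :: "plane \<Rightarrow> real"
  assumes n: "is_norm n" and det: "det2 P Q \<noteq> 0" and pq: "0 \<le> p" "0 \<le> q"
    and lower: "\<And>x y. 0 < x \<Longrightarrow> 0 < y \<Longrightarrow> p * x + q * y \<le> n (x *\<^sub>R P + y *\<^sub>R Q)"
    and S: "S \<in> sets borel" "\<And>z. z \<in> S \<Longrightarrow> n z \<le> 1"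
    and cover: "S \<subseteq> sector P Q \<union> {z. - z \<in> sector P Q} \<union> N" and N: "N \<in> null_sets lborel"
  shows "measure lborel S * (p * q) \<le> \<bar>det2 P Q\<bar>"
proof (cases "p * q = 0")
  case False
  then have pq': "0 < p" "0 < q" using pq by auto
  let ?P = "(1 / p) *\<^sub>R P" and ?Q = "(1 / q) *\<^sub>R Q"
  have d: "det2 ?P ?Q = det2 P Q / (p * q)" by (simp add: det2_scale)
  then have d0: "det2 ?P ?Q \<noteq> 0" using det pq' by simp
  define T where "T = corner_triangle ?P ?Q"
  have [measurable]: "T \<in> sets borel" unfolding T_def by simp
  have Tf: "T \<in> fmeasurable lborel" "measure lborel T = \<bar>det2 P Q\<bar> / (p * q) / 2"
    using measure_corner_triangle[OF d0] pq' by (simp_all add: T_def d abs_mult)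
  have inT: "z \<in> T" if z: "z \<in> sector P Q" "n z \<le> 1" for z
  proof -
    have "det2 z ?Q = det2 z Q / q" "det2 ?P z = det2 P z / p"
      using det2_scale[of 1 z "1 / q" Q] det2_scale[of "1 / p" P 1 z] by simp_all
    then have "ucoord ?P ?Q z = p * ucoord P Q z" "vcoord ?P ?Q z = q * vcoord P Q z"
      using pq' by (simp_all add: ucoord_def vcoord_def d)
    moreover have "p * ucoord P Q z + q * vcoord P Q z \<le> n z"
      using lower[of "ucoord P Q z" "vcoord P Q z"] z(1) by (simp add: sector_def coord_expand[OF det, symmetric])
    ultimately show ?thesis using z pq' by (simp add: T_def corner_triangle_def sector_def)
  qed
  have Tm: "emeasure lborel {z. - z \<in> T} = emeasure lborel T" by (rule emeasure_lborel_uminus) simp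
  then have Tmf: "{z. - z \<in> T} \<in> fmeasurable lborel" "measure lborel {z. - z \<in> T} = measure lborel T"
    using Tf(1) by (auto simp: fmeasurable_def measure_def)
  have Nf: "N \<in> fmeasurable lborel" "measure lborel N = 0"
    using N by (auto simp: fmeasurable_def null_sets_def measure_def)
  have "S \<subseteq> T \<union> {z. - z \<in> T} \<union> N"
  proof
    fix z assume z: "z \<in> S"
    then have "n (- z) \<le> 1" "n z \<le> 1" using S(2) by (simp_all add: seminorm_minus[OF is_norm_seminorm[OF n]])
    then show "z \<in> T \<union> {z. - z \<in> T} \<union> N" using cover z inT by blast
  qed
  then have "measure lborel S \<le> measure lborel (T \<union> {z. - z \<in> T} \<union> N)"
    by (rule measure_mono_fmeasurable) (use S Tf Tmf Nf in auto)
  also have "\<dots> \<le> measure lborel (T \<union> {z. - z \<in> T}) + measure lborel N"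
    by (rule measure_Un_le) (use Nf in auto)
  also have "measure lborel (T \<union> {z. - z \<in> T}) \<le> measure lborel T + measure lborel {z. - z \<in> T}"
    by (rule measure_Un_le) auto
  finally have "measure lborel S \<le> \<bar>det2 P Q\<bar> / (p * q)" using Tmf Nf Tf by simp
  then show ?thesis using pq' by (simp add: field_simps)
qed auto

lemma null_sets_axes:
  assumes "det2 P Q \<noteq> 0"
  shows "{z. ucoord P Q z = 0 \<or> vcoord P Q z = 0} \<in> null_sets lborel"
proof -
  have "P \<noteq> 0" "Q \<noteq> 0" using assms by (auto simp: det2_def)
  then have "{z. det2 z Q = 0} \<union> {z. det2 z P = 0} \<in> null_sets lborel"
    by (intro null_sets.Un null_sets_line)
  moreover have "{z. ucoord P Q z = 0 \<or> vcoord P Q z = 0} = {z. det2 z Q = 0} \<union> {z. det2 z P = 0}"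
    using assms by (auto simp: ucoord_def vcoord_def det2_def mult.commute)
  ultimately show ?thesis by simp
qed

text \<open>\<open>2 A B / (A + B)\<close> is the rate at which the cone \<open>b \<le> e\<^sup>h a\<close> must eat up area for
  \<open>A / (A + B)\<close> not to increase. If \<open>{a < b}\<close> is one double sector, the tangents at its two ends
  bound both the rate and the areas \<open>A\<close>, \<open>B\<close>. Otherwise there are at least two double sectors,
  hence eight ends, and the crude bounds from an Auerbach basis already suffice.\<close>

lemma planar_rate:
  fixes a b :: "plane \<Rightarrow> real"
  assumes na: "is_norm a" and nb: "is_norm b" and e: "0 < e"
  defines "A \<equiv> measure lborel {z. b z \<le> 1 \<and> a z < b z}" and "B \<equiv> measure lborel {z. a z \<le> 1 \<and> b z \<le> a z}"
  shows "\<exists>d>0. \<forall>h. 0 < h \<and> h < d \<longrightarrow>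
    h * (2 * A * B / (A + B) - e) \<le> measure lborel {z. a z \<le> 1 \<and> a z < b z \<and> b z \<le> exp h * a z}"
proof (cases "A = 0 \<or> B = 0")
  case True
  have "h * (2 * A * B / (A + B) - e) \<le> measure lborel {z. a z \<le> 1 \<and> a z < b z \<and> b z \<le> exp h * a z}" if "0 < h" for h
  proof -
    have "h * (2 * A * B / (A + B) - e) \<le> 0" using True that e by auto
    then show ?thesis using measure_nonneg order.trans by blast
  qed
  then show ?thesis by (intro exI[of _ 1]) auto
next
  case False
  have a: "is_seminorm a" and b: "is_seminorm b" using na nb by (auto intro: is_norm_seminorm)
  note [measurable] = seminorm_measurable[OF a] seminorm_measurable[OF b]
  let ?A = "{z. b z \<le> 1 \<and> a z < b z}" and ?B = "{z. a z \<le> 1 \<and> b z \<le> a z}"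
  let ?T = "\<lambda>h. {z. a z \<le> 1 \<and> a z < b z \<and> b z \<le> exp h * a z}"
  let ?W = "\<lambda>P Q h. {z \<in> sector P Q. a z \<le> 1 \<and> b z \<le> exp h * a z}"
  have Af: "?A \<in> fmeasurable lborel"
    by (rule fmeasurableI2[OF norm_ball_fmeasurable[OF nb, of 1]]) auto
  have Bf: "?B \<in> fmeasurable lborel"
    by (rule fmeasurableI2[OF norm_ball_fmeasurable[OF na, of 1]]) auto
  have Tf: "?T h \<in> fmeasurable lborel" for h
    by (rule fmeasurableI2[OF norm_ball_fmeasurable[OF na, of 1]]) auto
  have Tsym: "- z \<in> ?T h \<longleftrightarrow> z \<in> ?T h" for z h by (simp add: seminorm_minus a b)
  have AB: "0 < A" "0 < B" using False by (auto simp: A_def B_def zero_less_measure_iff)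
  have Bpos: "0 < emeasure lborel ?B" using AB(2) by (auto simp: B_def measure_def zero_less_iff_neq_zero)
  have "?A \<noteq> {}" using AB(1) unfolding A_def by (metis less_irrefl measure_empty)
  then obtain x where x: "a x < b x" by blast
  obtain P Q where PQ: "a P = 1" "b P = 1" "a Q = 1" "b Q = 1" "det2 P Q \<noteq> 0" "x \<in> sector P Q"
    and U: "\<And>z. z \<in> sector P Q \<Longrightarrow> a z < b z"
    using component_sector[OF na nb x Bpos] by blast
  define D where "D = \<bar>det2 P Q\<bar>"
  have D: "0 < D" using PQ(5) by (simp add: D_def)
  obtain \<alpha> \<beta> \<alpha>' \<beta>' where s1: "- 1 \<le> \<alpha>" "\<alpha> \<le> \<beta>" "\<beta> \<le> 1" and s2: "- 1 \<le> \<alpha>'" "\<alpha>' \<le> \<beta>'" "\<beta>' \<le> 1"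
    and l\<alpha>: "\<And>x y. x + \<alpha> * y \<le> a (x *\<^sub>R P + y *\<^sub>R Q)" and l\<beta>: "\<And>x y. x + \<beta> * y \<le> b (x *\<^sub>R P + y *\<^sub>R Q)"
    and l\<alpha>': "\<And>x y. \<alpha>' * x + y \<le> a (x *\<^sub>R P + y *\<^sub>R Q)" and l\<beta>': "\<And>x y. \<beta>' * x + y \<le> b (x *\<^sub>R P + y *\<^sub>R Q)"
    and rate: "\<And>e. 0 < e \<Longrightarrow> \<exists>d>0. \<forall>h. 0 < h \<and> h < d \<longrightarrow>
       h * (D * (1 / (\<beta> - \<alpha> + e) + 1 / (\<beta>' - \<alpha>' + e)) - e) \<le> 2 * measure lborel (?W P Q h)"
    unfolding D_def using sector_rate[OF na b PQ(1-5) U] by blast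
  have W: "?T h \<inter> sector P Q = ?W P Q h" for h using U by auto
  show ?thesis
  proof (cases "\<forall>z. a z < b z \<longrightarrow> z \<in> sector P Q \<or> - z \<in> sector P Q")
    case True
    \<comment> \<open>The lower bound for \<open>b\<close> is the average of its supporting
      functionals at \<open>P\<close> and \<open>Q\<close>.\<close>
    have "A * ((1 + \<beta>') / 2 * ((1 + \<beta>) / 2)) \<le> D"
      unfolding A_def D_def
    proof (rule sector_area_product_le[OF nb PQ(5), where N = "{}"])
      fix x y :: real
      show "(1 + \<beta>') / 2 * x + (1 + \<beta>) / 2 * y \<le> b (x *\<^sub>R P + y *\<^sub>R Q)"
        using l\<beta>[of x y] l\<beta>'[of x y] by (simp add: field_simps)
      show "?A \<subseteq> sector P Q \<union> {z. - z \<in> sector P Q} \<union> {}" using True by blast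
    qed (use s1 s2 in auto)
    then have DA: "(1 + \<beta>') * (1 + \<beta>) / 4 \<le> D / A" using AB(1) by (simp add: field_simps)
    \<comment> \<open>Up to two lines, \<open>{b \<le> a}\<close> lies in the complementary double
      sector, which is spanned by \<open>P\<close> and \<open>- Q\<close>.\<close>
    have det': "det2 P (- Q) \<noteq> 0" using PQ(5) by (simp add: det2_def)
    have uv: "ucoord P (- Q) z = ucoord P Q z" "vcoord P (- Q) z = - vcoord P Q z" for z
    proof -
      have "det2 w (- Q) = - det2 w Q" for w by (simp add: det2_def)
      then show "ucoord P (- Q) z = ucoord P Q z" "vcoord P (- Q) z = - vcoord P Q z"
        by (simp_all add: ucoord_def vcoord_def)
    qed
    have "B * ((1 - \<alpha>') / 2 * ((1 - \<alpha>) / 2)) \<le> \<bar>det2 P (- Q)\<bar>"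
      unfolding B_def
    proof (rule sector_area_product_le[OF na det' _ _ _ _ _ _ null_sets_axes[OF PQ(5)]])
      fix x y :: real
      have "a (x *\<^sub>R P + y *\<^sub>R - Q) = a ((- x) *\<^sub>R P + y *\<^sub>R Q)"
        using seminorm_minus[OF a, of "x *\<^sub>R P + y *\<^sub>R - Q"] by simp
      then show "(1 - \<alpha>') / 2 * x + (1 - \<alpha>) / 2 * y \<le> a (x *\<^sub>R P + y *\<^sub>R - Q)"
        using l\<alpha>[of x "- y"] l\<alpha>'[of "- x" y] by (simp add: field_simps)
      show "?B \<subseteq> sector P (- Q) \<union> {z. - z \<in> sector P (- Q)} \<union> {z. ucoord P Q z = 0 \<or> vcoord P Q z = 0}"
      proof
        fix z assume z: "z \<in> ?B"
        have "z \<notin> sector P Q" using U[of z] z by auto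
        moreover have "- z \<notin> sector P Q" using U[of "- z"] z by (auto simp: seminorm_minus a b)
        ultimately show "z \<in> sector P (- Q) \<union> {z. - z \<in> sector P (- Q)} \<union> {z. ucoord P Q z = 0 \<or> vcoord P Q z = 0}"
          by (auto simp: sector_def coord_minus uv)
      qed
    qed (use s1 s2 in auto)
    moreover have "\<bar>det2 P (- Q)\<bar> = D" by (simp add: D_def det2_def abs_minus_commute)
    ultimately have DB: "(1 - \<alpha>') * (1 - \<alpha>) / 4 \<le> D / B" using AB(2) by (simp add: field_simps)
    \<comment> \<open>The required rate is \<open>2 * D / Z\<close>, and \<open>Z\<close> turns out
      to dominate the mean of the two slope gaps; the inequality between harmonic and arithmetic
      means then gives the rate.\<close>
    define Z where "Z = D / A + D / B"
    have Z0: "0 < Z" using D AB by (simp add: Z_def add_pos_pos)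
    have Z: "(\<beta> - \<alpha> + (\<beta>' - \<alpha>')) / 2 \<le> Z"
    proof -
      \<comment> \<open>A quarter of the sum of these products is exactly the difference of the two
        sides of the next inequality.\<close>
      have "0 \<le> (1 - \<beta>') * (1 - \<beta>)" "0 \<le> (1 + \<alpha>') * (1 + \<alpha>)" using s1 s2 by auto
      then have "(\<beta> - \<alpha> + (\<beta>' - \<alpha>')) / 2 \<le> (1 + \<beta>') * (1 + \<beta>) / 4 + (1 - \<alpha>') * (1 - \<alpha>) / 4"
        by (simp add: field_simps)
      then show ?thesis using DA DB unfolding Z_def by linarith
    qed
    have goal: "2 * A * B / (A + B) = 2 * D / Z"
    proof -
      have "Z = D * (A + B) / (A * B)" using AB by (simp add: Z_def field_simps)
      then show ?thesis using D by simp
    qed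
    \<comment> \<open>Regularizing the denominators costs \<open>e'\<close> itself and at most
      \<open>2 * D * e' / Z\<^sup>2\<close>; the divisor makes the total equal to
      \<open>e\<close>.\<close>
    define e' where "e' = e / (1 + 2 * D / Z\<^sup>2)"
    have den: "0 < 1 + 2 * D / Z\<^sup>2" using D by (intro add_pos_nonneg) auto
    have e': "0 < e'" "e' * (1 + 2 * D / Z\<^sup>2) = e" using e den by (simp_all add: e'_def)
    have ineq: "2 * A * B / (A + B) - e \<le> D * (1 / (\<beta> - \<alpha> + e') + 1 / (\<beta>' - \<alpha>' + e')) - e'"
    proof -
      define X X' where "X = \<beta> - \<alpha> + e'" and "X' = \<beta>' - \<alpha>' + e'"
      have X: "0 < X" "0 < X'" using s1 s2 e' by (auto simp: X_def X'_def)
      have "2 / (Z + e') \<le> 4 / (X + X')"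
        using Z X Z0 e'(1) by (simp add: X_def X'_def field_simps)
      also have "\<dots> \<le> 1 / X + 1 / X'"
      proof -
        have "4 * (X * X') \<le> (X + X') * (X + X')" using zero_le_square[of "X - X'"] by (simp add: algebra_simps)
        then have "4 / (X + X') \<le> (X + X') / (X * X')" using X by (simp add: field_simps)
        also have "\<dots> = 1 / X + 1 / X'" using X by (simp add: field_simps)
        finally show ?thesis .
      qed
      finally have 1: "D * (2 / (Z + e')) \<le> D * (1 / X + 1 / X')" using D by (intro mult_left_mono) auto
      have "2 * D / Z - D * (2 / (Z + e')) = 2 * D * e' / (Z * (Z + e'))"
        using Z0 e'(1) by (simp add: field_simps)
      also have "\<dots> \<le> 2 * D * e' / Z\<^sup>2"
        using D Z0 e'(1) by (intro divide_left_mono) (auto simp: power2_eq_square)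
      also have "\<dots> = e - e'" using e'(2) by (simp add: distrib_left mult_ac)
      finally show ?thesis using 1 unfolding goal X_def X'_def by linarith
    qed
    obtain d where d: "d > 0" "\<And>h. 0 < h \<Longrightarrow> h < d \<Longrightarrow>
       h * (D * (1 / (\<beta> - \<alpha> + e') + 1 / (\<beta>' - \<alpha>' + e')) - e') \<le> 2 * measure lborel (?W P Q h)"
      using rate[OF e'(1)] by blast
    have "h * (2 * A * B / (A + B) - e) \<le> measure lborel (?T h)" if h: "0 < h" "h < d" for h
    proof -
      have "h * (2 * A * B / (A + B) - e) \<le> h * (D * (1 / (\<beta> - \<alpha> + e') + 1 / (\<beta>' - \<alpha>' + e')) - e')"
        using ineq h by (intro mult_left_mono) auto
      also have "\<dots> \<le> 2 * measure lborel (?W P Q h)" by (rule d(2)[OF h])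
      also have "\<dots> \<le> measure lborel (?T h)"
        unfolding W[symmetric]
        by (rule measure_symmetric_ge[OF Tf Tsym]) (auto dest: sector_no_antipodes)
      finally show ?thesis .
    qed
    then show ?thesis using d(1) by blast
  next
    case False
    then obtain x' where x': "a x' < b x'" "x' \<notin> sector P Q" "- x' \<notin> sector P Q" by blast
    obtain P' Q' where PQ': "a P' = 1" "b P' = 1" "a Q' = 1" "b Q' = 1" "det2 P' Q' \<noteq> 0" "x' \<in> sector P' Q'"
      and U': "\<And>z. z \<in> sector P' Q' \<Longrightarrow> a z < b z"
      using component_sector[OF na nb x'(1) Bpos] by blast
    define D' where "D' = \<bar>det2 P' Q'\<bar>"
    have D': "0 < D'" using PQ'(5) by (simp add: D'_def)
    obtain \<gamma> \<delta> \<gamma>' \<delta>' where t1: "- 1 \<le> \<gamma>" "\<gamma> \<le> \<delta>" "\<delta> \<le> 1"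
      and t2: "- 1 \<le> \<gamma>'" "\<gamma>' \<le> \<delta>'" "\<delta>' \<le> 1"
      and l\<gamma>: "\<And>x y. x + \<gamma> * y \<le> a (x *\<^sub>R P' + y *\<^sub>R Q')" and l\<delta>: "\<And>x y. x + \<delta> * y \<le> b (x *\<^sub>R P' + y *\<^sub>R Q')"
      and l\<gamma>': "\<And>x y. \<gamma>' * x + y \<le> a (x *\<^sub>R P' + y *\<^sub>R Q')" and l\<delta>': "\<And>x y. \<delta>' * x + y \<le> b (x *\<^sub>R P' + y *\<^sub>R Q')"
      and rate': "\<And>e. 0 < e \<Longrightarrow> \<exists>d>0. \<forall>h. 0 < h \<and> h < d \<longrightarrow>
         h * (D' * (1 / (\<delta> - \<gamma> + e) + 1 / (\<delta>' - \<gamma>' + e)) - e) \<le> 2 * measure lborel (?W P' Q' h)"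
      unfolding D'_def using sector_rate[OF na b PQ'(1-5) U'] by blast
    have W': "?T h \<inter> sector P' Q' = ?W P' Q' h" for h using U' by auto
    have dis: "sector P Q \<inter> sector P' Q' = {}"
      by (rule sectors_disjoint[OF a b _ _ PQ(5) U' PQ'(6) x'(2)]) (use PQ in auto)
    have dis': "sector (- P) (- Q) \<inter> sector P' Q' = {}"
      by (rule sectors_disjoint[OF a b _ _ _ U' PQ'(6)])
        (use PQ x'(3) in \<open>auto simp: seminorm_minus a b det2_def sector_minus\<close>)
    \<comment> \<open>The unit ball of the maximum is the union of the regions measured by
      \<open>A\<close> and \<open>B\<close>, and the Auerbach parallelogram around it bounds
      \<open>A + B\<close> by \<open>4 * G\<close>.\<close>
    let ?n = "\<lambda>z. max (a z) (b z)"
    have sn: "is_seminorm ?n"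
      unfolding is_seminorm_def
    proof (intro conjI allI)
      fix x y :: plane and c :: real
      show "?n (x + y) \<le> ?n x + ?n y"
        using is_seminormD(1)[OF a, of x y] is_seminormD(1)[OF b, of x y] by linarith
      show "?n (c *\<^sub>R x) = \<bar>c\<bar> * ?n x"
        by (simp add: is_seminormD(2)[OF a] is_seminormD(2)[OF b] max_mult_distrib_left)
    qed
    have nn: "is_norm ?n"
      by (rule is_normI[OF sn]) (use is_norm_pos[OF na] in \<open>simp add: less_max_iff_disj\<close>)
    obtain E F where EF: "?n E \<le> 1" "?n F \<le> 1" "det2 E F \<noteq> 0"
      "\<And>z. ?n z \<le> 1 \<Longrightarrow> \<bar>ucoord E F z\<bar> \<le> 1 \<and> \<bar>vcoord E F z\<bar> \<le> 1"
      using auerbach[OF nn] by blast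
    define G where "G = \<bar>det2 E F\<bar>"
    have G: "0 < G" using EF(3) by (simp add: G_def)
    have E: "a E \<le> 1" "b E \<le> 1" "a F \<le> 1" "b F \<le> 1" using EF(1,2) by auto
    have gap: "(\<beta> - \<alpha>) * G \<le> 2 * D" "(\<delta> - \<gamma>) * G \<le> 2 * D'"
      unfolding G_def D_def D'_def
      by (rule slope_gap_le[OF a b PQ(5) l\<alpha> l\<beta> E], rule slope_gap_le[OF a b PQ'(5) l\<gamma> l\<delta> E])
    have swap: "\<bar>det2 Q P\<bar> = \<bar>det2 P Q\<bar>" for P Q by (simp add: det2_def mult.commute)
    have gap': "(\<beta>' - \<alpha>') * G \<le> 2 * D" "(\<delta>' - \<gamma>') * G \<le> 2 * D'"
    proof -
      have "(\<beta>' - \<alpha>') * \<bar>det2 E F\<bar> \<le> 2 * \<bar>det2 Q P\<bar>"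
      proof (rule slope_gap_le[OF a b _ _ _ E])
        show "det2 Q P \<noteq> 0" using swap[of Q P] PQ(5) by auto
        show "x + \<alpha>' * y \<le> a (x *\<^sub>R Q + y *\<^sub>R P)" "x + \<beta>' * y \<le> b (x *\<^sub>R Q + y *\<^sub>R P)" for x y
          using l\<alpha>'[of y x] l\<beta>'[of y x] by (simp_all add: add.commute)
      qed
      then show "(\<beta>' - \<alpha>') * G \<le> 2 * D" by (simp add: G_def D_def swap[of P Q])
      have "(\<delta>' - \<gamma>') * \<bar>det2 E F\<bar> \<le> 2 * \<bar>det2 Q' P'\<bar>"
      proof (rule slope_gap_le[OF a b _ _ _ E])
        show "det2 Q' P' \<noteq> 0" using swap[of Q' P'] PQ'(5) by auto
        show "x + \<gamma>' * y \<le> a (x *\<^sub>R Q' + y *\<^sub>R P')" "x + \<delta>' * y \<le> b (x *\<^sub>R Q' + y *\<^sub>R P')" for x y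
          using l\<gamma>'[of y x] l\<delta>'[of y x] by (simp_all add: add.commute)
      qed
      then show "(\<delta>' - \<gamma>') * G \<le> 2 * D'" by (simp add: G_def D'_def swap[of P' Q'])
    qed
    have AB4: "A + B \<le> 4 * G"
    proof -
      have "A + B = measure lborel (?A \<union> ?B)" unfolding A_def B_def
        by (rule measure_Union[symmetric]) (use Af Bf in \<open>auto simp: fmeasurableD2\<close>)
      also have "\<dots> \<le> measure lborel {z. \<bar>ucoord E F z\<bar> \<le> 1 \<and> \<bar>vcoord E F z\<bar> \<le> 1}"
      proof (rule measure_mono_fmeasurable)
        show "?A \<union> ?B \<subseteq> {z. \<bar>ucoord E F z\<bar> \<le> 1 \<and> \<bar>vcoord E F z\<bar> \<le> 1}"
          using EF(4) by fastforce
        show "{z. \<bar>ucoord E F z\<bar> \<le> 1 \<and> \<bar>vcoord E F z\<bar> \<le> 1} \<in> fmeasurable lborel"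
          using emeasure_parallelogram[OF EF(3)] by (intro fmeasurableI) auto
      qed auto
      also have "\<dots> = 4 * G" using emeasure_parallelogram[OF EF(3)] by (simp add: measure_def G_def)
      finally show ?thesis .
    qed
    \<comment> \<open>The required rate is at most \<open>(A + B) / 2\<close>, hence at most
      \<open>2 * G\<close>. Each of the four ends contributes at least about \<open>G / 2\<close> to
      \<open>R + R'\<close>, by the gap bounds.\<close>
    have goal: "2 * A * B / (A + B) \<le> 2 * G"
    proof -
      have "4 * (A * B) \<le> (A + B) * (A + B)" using zero_le_square[of "A - B"] by (simp add: algebra_simps)
      also have "\<dots> \<le> (A + B) * (4 * G)" using AB AB4 by (intro mult_left_mono) auto
      finally show ?thesis using AB by (simp add: field_simps)
    qed
    \<comment> \<open>The loss per unit of \<open>e'\<close>: \<open>G\<^sup>2 / (4 * D)\<close> at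
      each end of the first sector, \<open>G\<^sup>2 / (4 * D')\<close> at each end of the second,
      and 1 in each of \<open>R\<close> and \<open>R'\<close>.\<close>
    define k where "k = G\<^sup>2 / (2 * D) + G\<^sup>2 / (2 * D') + 2"
    have k: "0 < k" using D D' by (simp add: k_def add_nonneg_pos)
    define e' where "e' = e / k"
    have e': "0 < e'" "e' * k = e" using e k by (simp_all add: e'_def)
    have end_rate: "G / 2 - e' * (G\<^sup>2 / (4 * M)) \<le> M * (1 / (y + e'))" if M: "0 < M" and y: "0 \<le> y" "y * G \<le> 2 * M" for M y
    proof -
      have p: "0 < y + e'" using y e' by simp
      have q: "y * G + e' * G \<le> 2 * M + e' * G" using y by simp
      have "(G / 2 - e' * (G\<^sup>2 / (4 * M))) * (2 * M + e' * G) \<le> M * G"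
        using M G e' by (simp add: field_simps power2_eq_square)
      then have "G / 2 - e' * (G\<^sup>2 / (4 * M)) \<le> M * G / (2 * M + e' * G)"
        using M G e' by (simp add: pos_le_divide_eq add_pos_pos)
      also have "\<dots> \<le> M * G / (y * G + e' * G)"
        using q M G e' y p by (intro divide_left_mono mult_pos_pos add_nonneg_pos add_pos_pos) auto
      also have "\<dots> = M * (1 / (y + e'))" using G by (simp flip: distrib_right)
      finally show ?thesis .
    qed
    define R where "R = D * (1 / (\<beta> - \<alpha> + e') + 1 / (\<beta>' - \<alpha>' + e')) - e'"
    define R' where "R' = D' * (1 / (\<delta> - \<gamma> + e') + 1 / (\<delta>' - \<gamma>' + e')) - e'"
    have ineq: "2 * A * B / (A + B) - e \<le> R + R'"
    proof -
      have "G / 2 - e' * (G\<^sup>2 / (4 * D)) \<le> D * (1 / (\<beta> - \<alpha> + e'))" "G / 2 - e' * (G\<^sup>2 / (4 * D)) \<le> D * (1 / (\<beta>' - \<alpha>' + e'))"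
        "G / 2 - e' * (G\<^sup>2 / (4 * D')) \<le> D' * (1 / (\<delta> - \<gamma> + e'))" "G / 2 - e' * (G\<^sup>2 / (4 * D')) \<le> D' * (1 / (\<delta>' - \<gamma>' + e'))"
        using s1 s2 t1 t2 gap gap' D D' by - (rule end_rate; simp)+
      then have "2 * G - (2 * (e' * (G\<^sup>2 / (4 * D))) + 2 * (e' * (G\<^sup>2 / (4 * D'))) + 2 * e') \<le> R + R'"
        unfolding R_def R'_def distrib_left[of D] distrib_left[of D'] by linarith
      moreover have "2 * (e' * (G\<^sup>2 / (4 * D))) + 2 * (e' * (G\<^sup>2 / (4 * D'))) + 2 * e' = e' * k"
        by (simp add: k_def distrib_left)
      ultimately show ?thesis using goal e'(2) by linarith
    qed
    obtain d where d: "d > 0" "\<And>h. 0 < h \<Longrightarrow> h < d \<Longrightarrow> h * R \<le> 2 * measure lborel (?W P Q h)"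
      using rate[OF e'(1)] unfolding R_def by blast
    obtain d' where d': "d' > 0" "\<And>h. 0 < h \<Longrightarrow> h < d' \<Longrightarrow> h * R' \<le> 2 * measure lborel (?W P' Q' h)"
      using rate'[OF e'(1)] unfolding R'_def by blast
    have "h * (2 * A * B / (A + B) - e) \<le> measure lborel (?T h)" if h: "0 < h" "h < min d d'" for h
    proof -
      let ?C = "sector P Q \<union> sector P' Q'"
      have f: "?T h \<inter> sector P Q \<in> fmeasurable lborel" "?T h \<inter> sector P' Q' \<in> fmeasurable lborel"
        by (auto intro!: fmeasurableI2[OF Tf[of h]])
      have "h * (2 * A * B / (A + B) - e) \<le> h * (R + R')"
        using ineq h by (intro mult_left_mono) auto
      also have "\<dots> \<le> 2 * (measure lborel (?T h \<inter> sector P Q) + measure lborel (?T h \<inter> sector P' Q'))"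
        unfolding W W' using d(2)[of h] d'(2)[of h] h by (simp add: distrib_left)
      also have "measure lborel (?T h \<inter> sector P Q) + measure lborel (?T h \<inter> sector P' Q')
        = measure lborel (?T h \<inter> sector P Q \<union> ?T h \<inter> sector P' Q')"
        by (rule measure_Union[symmetric]) (use f dis in \<open>auto simp: fmeasurableD2\<close>)
      also have "?T h \<inter> sector P Q \<union> ?T h \<inter> sector P' Q' = ?T h \<inter> ?C" by blast
      also have "2 * measure lborel (?T h \<inter> ?C) \<le> measure lborel (?T h)"
      proof (rule measure_symmetric_ge[OF Tf Tsym])
        fix z assume z: "z \<in> ?C"
        have no: "\<not> (w \<in> sector P' Q' \<and> - w \<in> sector P Q)" for w
          using dis' by (auto simp: sector_minus)
        show "- z \<notin> ?C"
          using z no[of z] no[of "- z"] sector_no_antipodes[of z P Q] sector_no_antipodes[of z P' Q'] by auto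
      qed auto
      finally show ?thesis .
    qed
    then show ?thesis using d(1) d'(1) by (intro exI[of _ "min d d'"]) auto
  qed
qed

section \<open>Log-concavity of the areas of planar level sets\<close>

text \<open>A bound with total allowance \<open>e * (u - s)\<close> is carried to the right as far
  as possible. At the supremum of the points reached, \<open>left\<close>, which excludes downward
  jumps, shows that this point is reached too, and \<open>right\<close> moves beyond it unless it is
  \<open>t\<close>.\<close>

lemma dini_nondecreasing:
  fixes R :: "real \<Rightarrow> real"
  assumes st: "s \<le> t"
    and right: "\<And>u e. s \<le> u \<Longrightarrow> u < t \<Longrightarrow> 0 < e \<Longrightarrow> \<exists>d>0. \<forall>h. 0 < h \<and> h < d \<longrightarrow> R u - e * h \<le> R (u + h)"
    and left: "\<And>u e. s < u \<Longrightarrow> u \<le> t \<Longrightarrow> 0 < e \<Longrightarrow> \<exists>d>0. \<forall>v. s \<le> v \<and> u - d < v \<and> v < u \<longrightarrow> R v \<le> R u + e"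
  shows "R s \<le> R t"
proof (rule field_le_epsilon)
  fix e0 :: real assume e0: "0 < e0"
  define e where "e = e0 / (1 + (t - s))"
  have e: "0 < e" "e * (t - s) \<le> e0" using e0 st by (simp_all add: e_def field_simps add_pos_nonneg)
  define S where "S = {u \<in> {s..t}. R s - e * (u - s) \<le> R u}"
  have sS: "s \<in> S" using st by (simp add: S_def)
  have bdd: "bdd_above S" by (auto simp: S_def bdd_above_def)
  define c where "c = Sup S"
  have "c \<le> t" unfolding c_def using sS by (intro cSup_least) (auto simp: S_def)
  then have c: "s \<le> c" "c \<le> t" using cSup_upper[OF sS bdd] by (auto simp: c_def)
  have cS: "R s - e * (c - s) \<le> R c"
  proof (cases "c \<in> S")
    case False
    then have sc: "s < c" using sS c(1) by (cases "s = c") auto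
    show ?thesis
    proof (rule field_le_epsilon)
      fix e' :: real assume "0 < e'"
      then obtain d where d: "0 < d" "\<And>v. s \<le> v \<Longrightarrow> c - d < v \<Longrightarrow> v < c \<Longrightarrow> R v \<le> R c + e'"
        using left[OF sc c(2)] by blast
      obtain v where v: "v \<in> S" "c - d < v" using less_cSupD[of S "c - d"] sS d(1) by (auto simp: c_def)
      then have "v < c" using cSup_upper[OF v(1) bdd] False by (cases "v = c") (auto simp: c_def)
      then have "R v \<le> R c + e'" using v by (intro d(2)) (auto simp: S_def)
      moreover have "e * (v - s) \<le> e * (c - s)" using e(1) \<open>v < c\<close> by (intro mult_left_mono) auto
      ultimately show "R s - e * (c - s) \<le> R c + e'" using v(1) by (simp add: S_def)
    qed
  qed (simp add: S_def)
  have "c = t"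
  proof (rule ccontr)
    assume "c \<noteq> t"
    then have ct: "c < t" using c(2) by simp
    obtain d where d: "0 < d" "\<And>h. 0 < h \<Longrightarrow> h < d \<Longrightarrow> R c - e * h \<le> R (c + h)"
      using right[OF c(1) ct e(1)] by blast
    define h where "h = min (d / 2) (t - c)"
    have h: "0 < h" "h < d" "c + h \<le> t" using d(1) ct by (auto simp: h_def)
    have "R s - e * (c + h - s) \<le> R (c + h)" using d(2)[OF h(1,2)] cS by (simp add: algebra_simps)
    then have "c + h \<in> S" using h c(1) by (simp add: S_def)
    then have "c + h \<le> c" unfolding c_def by (rule cSup_upper[OF _ bdd])
    then show False using h(1) by simp
  qed
  then show "R s \<le> R t + e0" using cS e(2) by simp
qed

lemma exp_minus_le: "exp (- y) \<le> 1 - y + y\<^sup>2" if "0 \<le> y" for y :: real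
proof -
  \<comment> \<open>The product on the right equals \<open>1 + y ^ 3\<close>.\<close>
  have "1 \<le> (1 - y + y\<^sup>2) * (1 + y)" using that by (simp add: algebra_simps power2_eq_square)
  also have "\<dots> \<le> (1 - y + y\<^sup>2) * exp y"
  proof (rule mult_left_mono[OF exp_ge_add_one_self])
    show "0 \<le> 1 - y + y\<^sup>2" using zero_le_power2[of "y - 1/2"] by (simp add: power2_eq_square algebra_simps)
  qed
  finally show ?thesis by (simp add: exp_minus field_simps)
qed

text \<open>\<open>V\<close> splits into \<open>F\<close>, inside the cone, and \<open>A\<close>,
  outside it. As \<open>t\<close> grows with the cone held fixed, only the outer part grows, and it
  does so by dilation, so \<open>ln V\<close> should have the derivative \<open>2 * A / V\<close>.
  This is nonincreasing if \<open>F / V\<close> is nondecreasing, which asks \<open>F\<close> to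
  grow at rate \<open>2 * A * F / V\<close>, the rate of \<open>planar_rate\<close>. One-sided
  estimates with error terms take the place of derivatives.\<close>

lemma planar_level_midpoint:
  fixes a b :: "plane \<Rightarrow> real"
  assumes na: "is_norm a" and nb: "is_norm b"
  defines "V \<equiv> \<lambda>t. measure lborel {z. a z \<le> 1 \<and> b z \<le> exp t}"
  shows "V s * V t \<le> (V ((s + t) / 2))\<^sup>2"
proof -
  have a: "is_seminorm a" and b: "is_seminorm b" using na nb by (auto intro: is_norm_seminorm)
  note [measurable] = seminorm_measurable[OF a] seminorm_measurable[OF b]
  have aball: "{z. a z \<le> r} \<in> fmeasurable lborel" and bball: "{z. b z \<le> r} \<in> fmeasurable lborel" for r
    by (rule norm_ball_fmeasurable[OF na], rule norm_ball_fmeasurable[OF nb])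
  define F where "F t = measure lborel {z. a z \<le> 1 \<and> b z \<le> exp t * a z}" for t
  define A where "A t = measure lborel {z. b z \<le> exp t \<and> exp t * a z < b z}" for t
  have fF: "{z. a z \<le> 1 \<and> b z \<le> r * a z} \<in> fmeasurable lborel" for r
    by (rule fmeasurableI2[OF aball[of 1]]) auto
  have fA: "{z. b z \<le> r \<and> r' * a z < b z} \<in> fmeasurable lborel" for r r'
    by (rule fmeasurableI2[OF bball[of r]]) auto
  have fV: "{z. a z \<le> 1 \<and> b z \<le> r} \<in> fmeasurable lborel" for r
    by (rule fmeasurableI2[OF aball[of 1]]) auto
  have A0: "0 \<le> A t" and F0: "0 \<le> F t" for t by (simp_all add: A_def F_def)
  have scale: "measure lborel {z. b z \<le> c * r \<and> r' * a z < b z} = c\<^sup>2 * measure lborel {z. b z \<le> r \<and> r' * a z < b z}"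
    if c: "0 < c" for c r r'
  proof -
    have eq: "{z. b z \<le> c * r \<and> r' * a z < b z} = {z. (1 / c) *\<^sub>R z \<in> {z. b z \<le> r \<and> r' * a z < b z}}"
      using c by (auto simp: is_seminormD(2)[OF a] is_seminormD(2)[OF b] field_simps)
    have "emeasure lborel {z. b z \<le> c * r \<and> r' * a z < b z} = ennreal (c ^ DIM(plane)) * emeasure lborel {z. b z \<le> r \<and> r' * a z < b z}"
      unfolding eq by (rule emeasure_lborel_scale[OF _ c]) measurable
    then show ?thesis using c by (simp add: measure_def enn2real_mult power2_eq_square)
  qed
  have VFA: "V t = F t + A t" for t
  proof -
    have le: "exp t * a z \<le> exp t" if "a z \<le> 1" for z using that by simp
    have "b z \<le> exp t \<Longrightarrow> exp t * a z < b z \<Longrightarrow> a z \<le> 1" for z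
      by (smt (verit) exp_gt_zero mult_le_cancel_left_pos mult_cancel_left2)
    then have eq: "{z. a z \<le> 1 \<and> b z \<le> exp t} = {z. a z \<le> 1 \<and> b z \<le> exp t * a z} \<union> {z. b z \<le> exp t \<and> exp t * a z < b z}"
      using le by (force intro: order.trans)
    show ?thesis unfolding V_def F_def A_def eq
      by (rule measure_Union) (use fF fA in \<open>auto simp: fmeasurableD2\<close>)
  qed
  \<comment> \<open>The cone is held at \<open>t\<close>; outside it the new region is the old one
    dilated by \<open>exp h\<close>. In \<open>down\<close> the cone is held at \<open>t + h\<close>
    instead.\<close>
  have up: "V (t + h) \<le> F t + exp (2 * h) * A t" if h: "0 \<le> h" for t h
  proof -
    have "V (t + h) \<le> measure lborel ({z. a z \<le> 1 \<and> b z \<le> exp t * a z} \<union> {z. b z \<le> exp h * exp t \<and> exp t * a z < b z})"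
      unfolding V_def
      by (rule measure_mono_fmeasurable) (use fF fA fV in \<open>auto simp: exp_add mult.commute\<close>)
    also have "\<dots> \<le> F t + measure lborel {z. b z \<le> exp h * exp t \<and> exp t * a z < b z}"
      unfolding F_def by (rule measure_Un_le) auto
    also have "measure lborel {z. b z \<le> exp h * exp t \<and> exp t * a z < b z} = exp (2 * h) * A t"
      using scale[of "exp h" "exp t" "exp t"] by (simp add: A_def power2_eq_square flip: exp_add)
    finally show ?thesis .
  qed
  have down: "V t \<le> F (t + h) + exp (- (2 * h)) * A (t + h)" if h: "0 \<le> h" for t h
  proof -
    have "exp (- h) * exp (t + h) = exp t" by (simp flip: exp_add)
    then have "V t \<le> measure lborel ({z. a z \<le> 1 \<and> b z \<le> exp (t + h) * a z} \<union> {z. b z \<le> exp (- h) * exp (t + h) \<and> exp (t + h) * a z < b z})"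
      unfolding V_def
      by (intro measure_mono_fmeasurable) (use fF fA fV in auto)
    also have "\<dots> \<le> F (t + h) + measure lborel {z. b z \<le> exp (- h) * exp (t + h) \<and> exp (t + h) * a z < b z}"
      unfolding F_def by (rule measure_Un_le) auto
    also have "measure lborel {z. b z \<le> exp (- h) * exp (t + h) \<and> exp (t + h) * a z < b z} = exp (- (2 * h)) * A (t + h)"
      using scale[of "exp (- h)" "exp (t + h)" "exp (t + h)"] by (simp add: A_def power2_eq_square flip: exp_add)
    finally show ?thesis .
  qed
  have Vmono: "V u \<le> V v" if "u \<le> v" for u v
    unfolding V_def by (rule measure_mono_fmeasurable) (use fV that in \<open>auto intro: order.trans\<close>)
  have Fmono: "F u \<le> F v" if "u \<le> v" for u v
    unfolding F_def
  proof (rule measure_mono_fmeasurable)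
    have "exp u * a z \<le> exp v * a z" for z using that seminorm_nonneg[OF a, of z] by (intro mult_right_mono) auto
    then show "{z. a z \<le> 1 \<and> b z \<le> exp u * a z} \<subseteq> {z. a z \<le> 1 \<and> b z \<le> exp v * a z}" by (auto intro: order.trans)
  qed (use fF in auto)
  have Vpos: "0 < V t" for t
  proof -
    have "open {z. a z < 1 \<and> b z < exp t}"
      by (intro open_Collect_conj open_Collect_less seminorm_continuous a b continuous_intros)
    moreover have "0 \<in> {z. a z < 1 \<and> b z < exp t}" by (simp add: seminorm_0 a b)
    ultimately obtain e where e: "e > 0" "ball 0 e \<subseteq> {z. a z < 1 \<and> b z < exp t}" by (meson openE)
    have "0 < measure lborel (ball (0::plane) e)" using content_ball_pos[OF e(1)] by simp
    also have "\<dots> \<le> V t" unfolding V_def by (rule measure_mono_fmeasurable) (use e(2) fV in auto)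
    finally show ?thesis .
  qed
  have up': "V (t + h) \<le> V t + (exp (2 * h) - 1) * A t" if "0 \<le> h" for t h
    using up[OF that, of t] VFA[of t] by (simp add: algebra_simps)
  have growth: "V (t + h) \<le> exp (2 * h) * V t" if "0 \<le> h" for t h
  proof -
    have "F t * 1 \<le> F t * exp (2 * h)" using that F0 by (intro mult_left_mono) auto
    then show ?thesis using up[OF that, of t] VFA[of t] by (simp add: algebra_simps)
  qed
  have e1: "exp (2 * h) \<le> 1 + 2 * h + 4 * h\<^sup>2" if "0 \<le> h" "h \<le> 1/2" for h :: real
    using exp_bound[of "2 * h"] that by (simp add: power_mult_distrib)
  have e2: "exp (2 * h) \<le> 1 + 4 * h" if "0 \<le> h" "h \<le> 1/2" for h :: real
  proof -
    have "4 * h\<^sup>2 \<le> 2 * h" using that mult_right_mono[of "2 * h" 1 "2 * h"] by (simp add: power2_eq_square)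
    then show ?thesis using e1[OF that] by simp
  qed
  define R where "R t = F t / V t" for t
  have R01: "0 \<le> R t" "R t \<le> 1" for t using F0[of t] A0[of t] Vpos[of t] VFA[of t] by (simp_all add: R_def)
  have Rmono: "R u \<le> R v" if "u \<le> v" for u v
    using that
  proof (rule dini_nondecreasing)
    fix u e :: real assume e: "0 < e"
    \<comment> \<open>Half of \<open>e\<close> is spent on the rate of \<open>F\<close>, the other
      half on the quadratic remainder of \<open>exp (2 * h)\<close>; hence \<open>h < e / 8\<close>
      below. The factor \<open>V u\<close> comes from clearing denominators in
      \<open>R\<close>.\<close>
    define e' where "e' = e * V u / 2"
    have e': "0 < e'" using e Vpos by (simp add: e'_def)
    \<comment> \<open>Rescaling \<open>b\<close> moves the level \<open>u\<close> to 0, where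
      \<open>planar_rate\<close> is stated; its two areas become \<open>A u\<close> and
      \<open>F u\<close>.\<close>
    let ?b = "\<lambda>z. exp (- u) * b z"
    have nb': "is_norm ?b"
    proof (rule is_normI)
      have "is_seminorm (\<lambda>x. b (exp (- u) *\<^sub>R x))" by (rule seminorm_linear_image[OF b linear_scaleR])
      then show "is_seminorm ?b" by (simp add: is_seminormD(2)[OF b])
    qed (simp add: is_norm_pos[OF nb])
    have sets: "{z. ?b z \<le> 1 \<and> a z < ?b z} = {z. b z \<le> exp u \<and> exp u * a z < b z}"
      "{z. a z \<le> 1 \<and> ?b z \<le> a z} = {z. a z \<le> 1 \<and> b z \<le> exp u * a z}"
      "{z. a z \<le> 1 \<and> a z < ?b z \<and> ?b z \<le> exp h * a z} = {z. a z \<le> 1 \<and> b z \<le> exp (u + h) * a z} - {z. a z \<le> 1 \<and> b z \<le> exp u * a z}" for h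
      by (auto simp: exp_minus exp_add field_simps)
    obtain d where d: "d > 0" "\<And>h. 0 < h \<Longrightarrow> h < d \<Longrightarrow>
      h * (2 * A u * F u / (A u + F u) - e') \<le> measure lborel ({z. a z \<le> 1 \<and> b z \<le> exp (u + h) * a z} - {z. a z \<le> 1 \<and> b z \<le> exp u * a z})"
      using planar_rate[OF na nb' e'] unfolding sets A_def F_def by blast
    have inc: "F u + h * (2 * A u * F u / V u - e') \<le> F (u + h)" if h: "0 < h" "h < d" for h
    proof -
      have "{z. a z \<le> 1 \<and> b z \<le> exp u * a z} \<subseteq> {z. a z \<le> 1 \<and> b z \<le> exp (u + h) * a z}"
      proof -
        have "exp u * a z \<le> exp (u + h) * a z" for z using h seminorm_nonneg[OF a, of z] by (intro mult_right_mono) auto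
        then show ?thesis by (auto intro: order.trans)
      qed
      then have "measure lborel ({z. a z \<le> 1 \<and> b z \<le> exp (u + h) * a z} - {z. a z \<le> 1 \<and> b z \<le> exp u * a z}) = F (u + h) - F u"
        unfolding F_def by (intro measure_Diff) (use fF in \<open>auto simp: fmeasurableD2\<close>)
      then show ?thesis using d(2)[OF h] VFA[of u] by (simp add: add.commute)
    qed
    have "R u - e * h \<le> R (u + h)" if h: "0 < h" "h < min d (min (1/2) (e / 8))" for h
    proof -
      have hd: "h < d" "h \<le> 1/2" "8 * h \<le> e" using h by auto
      have V1: "V u \<le> V (u + h)" using h by (intro Vmono) auto
      have "(F u + h * (X / V u - e')) * V u = V u * F u + h * (X - e' * V u)" for X
        using Vpos[of u] by (simp add: field_simps)
      then have "V u * F u + h * (2 * A u * F u - e' * V u) \<le> F (u + h) * V u"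
        using mult_right_mono[OF inc[OF h(1) hd(1)], of "V u"] Vpos[of u] by simp
      moreover have "F u * V (u + h) \<le> F u * (V u + (exp (2 * h) - 1) * A u)"
        using h F0 by (intro mult_left_mono up') auto
      moreover have "F u * A u * (exp (2 * h) - 1) \<le> F u * A u * (2 * h + 4 * h\<^sup>2)"
        using e1[of h] h hd F0 A0 by (intro mult_left_mono) auto
      ultimately have "F u * V (u + h) - F (u + h) * V u \<le> h * e' * V u + F u * A u * (4 * h\<^sup>2)"
        by (simp add: algebra_simps)
      also have "F u * A u * (4 * h\<^sup>2) \<le> V u * V u * (4 * h\<^sup>2)"
        using F0[of u] A0[of u] VFA[of u] by (intro mult_right_mono mult_mono) auto
      also have "h * e' * V u + V u * V u * (4 * h\<^sup>2) = h * (e / 2 + 4 * h) * (V u * V u)"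
        by (simp add: e'_def power2_eq_square algebra_simps)
      also have "\<dots> \<le> h * e * (V u * V u)" using h hd Vpos[of u] by (intro mult_right_mono mult_left_mono) auto
      also have "\<dots> \<le> h * e * (V u * V (u + h))"
        using h e V1 Vpos[of u] by (intro mult_left_mono) auto
      finally have "F u * V (u + h) - h * e * (V u * V (u + h)) \<le> F (u + h) * V u" by simp
      then have "(F u * V (u + h) - h * e * (V u * V (u + h))) / (V u * V (u + h)) \<le> F (u + h) * V u / (V u * V (u + h))"
        using Vpos[of u] Vpos[of "u + h"] by (intro divide_right_mono) auto
      then show ?thesis using Vpos[of u] Vpos[of "u + h"] by (simp add: R_def diff_divide_distrib mult.commute)
    qed
    then show "\<exists>d>0. \<forall>h. 0 < h \<and> h < d \<longrightarrow> R u - e * h \<le> R (u + h)"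
      using d(1) e by (intro exI[of _ "min d (min (1/2) (e / 8))"]) auto
  next
    fix u e :: real assume e: "0 < e"
    have "R w \<le> R u + e" if w: "u - min (1/2) (e / 4) < w" "w < u" for w
    proof -
      define h where "h = u - w"
      have h: "0 \<le> h" "h \<le> 1/2" "4 * h \<le> e" "w + h = u" using w by (auto simp: h_def)
      have "F w * V u \<le> F u * (exp (2 * h) * V w)"
        using growth[OF h(1), of w] Fmono[of w u] w Vpos[of u] F0[of u] unfolding h(4) by (intro mult_mono) auto
      then have "F w / V w \<le> exp (2 * h) * (F u / V u)"
        using Vpos[of u] Vpos[of w] by (simp add: field_simps)
      also have "\<dots> \<le> (1 + 4 * h) * (F u / V u)"
        using R01(1)[of u] e2[OF h(1,2)] by (intro mult_right_mono) (auto simp: R_def)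
      also have "\<dots> = F u / V u + 4 * h * (F u / V u)" by (simp only: distrib_right mult_1)
      also have "4 * h * (F u / V u) \<le> 4 * h * 1"
        using R01(2)[of u] h by (intro mult_left_mono) (auto simp: R_def)
      finally show ?thesis using h(3) by (simp add: R_def)
    qed
    then show "\<exists>d>0. \<forall>w. u' \<le> w \<and> u - d < w \<and> w < u \<longrightarrow> R w \<le> R u + e" for u'
      using e by (intro exI[of _ "min (1/2) (e / 4)"]) auto
  qed
  define q where "q t = A t / V t" for t
  have qR: "q t = 1 - R t" for t using VFA[of t] Vpos[of t] by (simp add: q_def R_def field_simps)
  have q01: "0 \<le> q t" "q t \<le> 1" for t using R01[of t] by (simp_all add: qR)
  define g where "g t = ln (V t)" for t
  have gmono: "g u \<le> g v" if "u \<le> v" for u v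
    unfolding g_def using Vmono[OF that] Vpos[of u] Vpos[of v] by simp
  have gup: "g (t + h) - g t \<le> (exp (2 * h) - 1) * q t" if h: "0 \<le> h" for t h
  proof -
    have "V (t + h) \<le> V t * (1 + (exp (2 * h) - 1) * q t)"
      using up'[OF h, of t] Vpos[of t] by (simp add: q_def distrib_left)
    moreover have p: "0 < 1 + (exp (2 * h) - 1) * q t" using h q01[of t] by (intro add_pos_nonneg) auto
    ultimately have "g (t + h) \<le> ln (V t * (1 + (exp (2 * h) - 1) * q t))"
      unfolding g_def using Vpos[of "t + h"] by (subst ln_le_cancel_iff) auto
    also have "\<dots> = g t + ln (1 + (exp (2 * h) - 1) * q t)" using Vpos[of t] p by (simp add: g_def ln_mult)
    finally show ?thesis using ln_add_one_self_le_self2[of "(exp (2 * h) - 1) * q t"] p by simp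
  qed
  have gdown: "(1 - exp (- (2 * h))) * q (t + h) \<le> g (t + h) - g t" if h: "0 \<le> h" for t h
  proof -
    have "V t \<le> V (t + h) * (1 - (1 - exp (- (2 * h))) * q (t + h))"
    proof -
      have eq: "V (t + h) * (1 - k * q (t + h)) = V (t + h) - k * A (t + h)" for k
        using Vpos[of "t + h"] by (simp add: q_def right_diff_distrib)
      show ?thesis unfolding eq using down[OF h, of t] VFA[of "t + h"] by (simp add: left_diff_distrib)
    qed
    moreover from this have p: "0 < 1 - (1 - exp (- (2 * h))) * q (t + h)"
      using Vpos[of t] Vpos[of "t + h"] by (metis less_le_trans zero_less_mult_pos)
    ultimately have "g t \<le> ln (V (t + h) * (1 - (1 - exp (- (2 * h))) * q (t + h)))"
      unfolding g_def using Vpos[of t] by (subst ln_le_cancel_iff) (use Vpos[of "t + h"] in auto)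
    also have "\<dots> = g (t + h) + ln (1 - (1 - exp (- (2 * h))) * q (t + h))" using Vpos[of "t + h"] p by (simp add: g_def ln_mult)
    finally show ?thesis using ln_add_one_self_le_self2[of "- ((1 - exp (- (2 * h))) * q (t + h))"] p by simp
  qed
  \<comment> \<open>The line of slope \<open>2 * q z\<close> through the graph of \<open>g\<close>
    at \<open>z\<close> stays above \<open>g\<close>: to the right of \<open>z\<close> here, to the
    left in \<open>below\<close>. Adding the two bounds at the midpoint gives the claim.\<close>
  have above: "g y - g z \<le> 2 * q z * (y - z)" if zy: "z \<le> y" for y z
  proof -
    have "2 * q z * z - g z \<le> 2 * q z * y - g y"
      using zy
    proof (rule dini_nondecreasing)
      fix u e :: real assume u: "z \<le> u" and e: "0 < e"
      have "2 * q z * u - g u - e * h \<le> 2 * q z * (u + h) - g (u + h)" if h: "0 < h" "h < min (1/2) (e / 4)" for h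
      proof -
        have "g (u + h) - g u \<le> (exp (2 * h) - 1) * q u" using h by (intro gup) auto
        also have "\<dots> \<le> (exp (2 * h) - 1) * q z" using h Rmono[OF u] by (intro mult_left_mono) (auto simp: qR)
        also have "\<dots> \<le> (2 * h + 4 * h\<^sup>2) * q z" using h e1[of h] q01 by (intro mult_right_mono) auto
        also have "\<dots> = 2 * h * q z + 4 * h\<^sup>2 * q z" by (simp add: distrib_right)
        also have "4 * h\<^sup>2 * q z \<le> 4 * h\<^sup>2 * 1" using q01[of z] by (intro mult_left_mono) auto
        also have "4 * h\<^sup>2 * 1 \<le> e * h" using h mult_right_mono[of "4 * h" e h] by (simp add: power2_eq_square)
        finally show ?thesis by (simp add: algebra_simps)
      qed
      then show "\<exists>d>0. \<forall>h. 0 < h \<and> h < d \<longrightarrow> 2 * q z * u - g u - e * h \<le> 2 * q z * (u + h) - g (u + h)"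
        using e by (intro exI[of _ "min (1/2) (e / 4)"]) auto
    next
      fix u e :: real assume e: "0 < e"
      have "2 * q z * v - g v \<le> 2 * q z * u - g u + e" if v: "u - min (1/2) (e / 4) < v" "v < u" for v
      proof -
        define h where "h = u - v"
        have h: "0 \<le> h" "h \<le> 1/2" "4 * h \<le> e" "v + h = u" using v by (auto simp: h_def)
        have "g u - g v \<le> (exp (2 * h) - 1) * q v" using gup[OF h(1), of v] unfolding h(4) .
        also have "\<dots> \<le> (exp (2 * h) - 1) * 1" using h(1) q01[of v] by (intro mult_left_mono) auto
        also have "\<dots> \<le> e" using e2[OF h(1,2)] h(3) by simp
        finally have "g u - g v \<le> e" .
        moreover have "2 * q z * v \<le> 2 * q z * u" using v q01[of z] by (intro mult_left_mono) auto
        ultimately show ?thesis by simp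
      qed
      then show "\<exists>d>0. \<forall>v. z \<le> v \<and> u - d < v \<and> v < u \<longrightarrow> 2 * q z * v - g v \<le> 2 * q z * u - g u + e"
        using e by (intro exI[of _ "min (1/2) (e / 4)"]) auto
    qed
    then show ?thesis by (simp add: algebra_simps)
  qed
  have below: "2 * q z * (z - x) \<le> g z - g x" if xz: "x \<le> z" for x z
  proof -
    have "g x - 2 * q z * x \<le> g z - 2 * q z * z"
      using xz
    proof (rule dini_nondecreasing)
      fix u e :: real assume u: "u < z" and e: "0 < e"
      have "g u - 2 * q z * u - e * h \<le> g (u + h) - 2 * q z * (u + h)" if h: "0 < h" "h < min (z - u) (e / 4)" for h
      proof -
        have "2 * h - (2 * h)\<^sup>2 \<le> 1 - exp (- (2 * h))" using exp_minus_le[of "2 * h"] h by simp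
        then have "(2 * h - (2 * h)\<^sup>2) * q z \<le> (1 - exp (- (2 * h))) * q z" using q01 by (intro mult_right_mono) auto
        also have "\<dots> \<le> (1 - exp (- (2 * h))) * q (u + h)"
          using h Rmono[of "u + h" z] by (intro mult_left_mono) (auto simp: qR)
        also have "\<dots> \<le> g (u + h) - g u" using h by (intro gdown) auto
        finally have "2 * h * q z - 4 * h\<^sup>2 * q z \<le> g (u + h) - g u" by (simp add: left_diff_distrib power_mult_distrib)
        moreover have "4 * h\<^sup>2 * q z \<le> 4 * h\<^sup>2 * 1" using q01[of z] by (intro mult_left_mono) auto
        moreover have "4 * h\<^sup>2 * 1 \<le> e * h" using h mult_right_mono[of "4 * h" e h] by (simp add: power2_eq_square)
        ultimately show ?thesis by (simp add: algebra_simps)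
      qed
      then show "\<exists>d>0. \<forall>h. 0 < h \<and> h < d \<longrightarrow> g u - 2 * q z * u - e * h \<le> g (u + h) - 2 * q z * (u + h)"
        using e u by (intro exI[of _ "min (z - u) (e / 4)"]) auto
    next
      fix u e :: real assume e: "0 < e"
      have "g v - 2 * q z * v \<le> g u - 2 * q z * u + e" if v: "u - e / 2 < v" "v < u" for v
      proof -
        have "q z * (2 * (u - v)) \<le> 1 * (2 * (u - v))" using v q01[of z] by (intro mult_right_mono) auto
        then show ?thesis using gmono[of v u] v by (simp add: algebra_simps)
      qed
      then show "\<exists>d>0. \<forall>v. x \<le> v \<and> u - d < v \<and> v < u \<longrightarrow> g v - 2 * q z * v \<le> g u - 2 * q z * u + e"
        using e by (intro exI[of _ "e / 2"]) auto
    qed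
    then show ?thesis by (simp add: algebra_simps)
  qed
  have main: "V s * V t \<le> (V ((s + t) / 2))\<^sup>2" if st: "s \<le> t" for s t
  proof -
    define m where "m = (s + t) / 2"
    have "s \<le> m" "m \<le> t" using st by (auto simp: m_def)
    then have "g t - g m \<le> 2 * q m * (t - m)" "2 * q m * (m - s) \<le> g m - g s"
      using above[of m t] below[of s m] by auto
    moreover have "t - m = m - s" by (simp add: m_def field_simps)
    ultimately have "g s + g t \<le> 2 * g m" by simp
    then have "ln (V s * V t) \<le> ln ((V m)\<^sup>2)" using Vpos[of s] Vpos[of t] Vpos[of m] by (simp add: g_def ln_mult ln_realpow)
    then show ?thesis using Vpos[of s] Vpos[of t] Vpos[of m] by (simp add: m_def)
  qed
  show ?thesis
    using main[of s t] main[of t s] by (cases "s \<le> t") (auto simp: mult.commute add.commute)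
qed

text \<open>By homogeneity \<open>H t r q\<close> is a power of \<open>r\<close> times the level
  volume at \<open>(ln q - t - ln r) / p\<close>. This argument is affine in \<open>t\<close>,
  \<open>ln q\<close> and \<open>ln r\<close>, so geometric means of \<open>r\<close> and
  \<open>q\<close> and the midpoint in \<open>t\<close> produce its midpoint, where
  \<open>lev\<close> applies. The exponential integral is a double integral of \<open>H\<close>
  against \<open>exp (- r)\<close> and \<open>exp (- q)\<close>, handled by the multiplicative
  inequality first in \<open>q\<close> and then in \<open>r\<close>.\<close>

lemma midpoint_volume_from_level_sets:
  fixes a b :: "'a::euclidean_space \<Rightarrow> real"
  assumes p: "p \<ge> 1" and na: "is_norm a" and nb: "is_norm b"
    and lev: "\<And>s t. emeasure lborel {z. a z \<le> 1 \<and> b z \<le> exp s} * emeasure lborel {z. a z \<le> 1 \<and> b z \<le> exp t}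
      \<le> (emeasure lborel {z. a z \<le> 1 \<and> b z \<le> exp ((s + t) / 2)})\<^sup>2"
  shows "emeasure lborel (lp_ball p a b s) * emeasure lborel (lp_ball p a b t)
    \<le> (emeasure lborel (lp_ball p a b ((s + t) / 2)))\<^sup>2"
proof -
  have a: "is_seminorm a" and b: "is_seminorm b" using na nb by (auto intro: is_norm_seminorm)
  note [measurable] = seminorm_measurable[OF a] seminorm_measurable[OF b]
  have a0: "0 \<le> a z" and b0: "0 \<le> b z" for z by (simp_all add: seminorm_nonneg a b)
  define m where "m s = emeasure lborel {z. a z \<le> 1 \<and> b z \<le> exp s}" for s
  define H where "H t r q = emeasure lborel {z. a z powr p \<le> r \<and> exp t * b z powr p \<le> q}" for t r q
  have H_eq: "H t r q = ennreal (r powr (real DIM('a) / p)) * m ((ln q - t - ln r) / p)" if rq: "0 < r" "0 < q" for t r q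
  proof -
    define c where "c = r powr (1 / p)"
    have c: "c > 0" "c powr p = r" "c ^ DIM('a) = r powr (real DIM('a) / p)"
      using rq p by (simp_all add: c_def powr_powr flip: powr_realpow)
    define \<tau> where "\<tau> = (ln q - t - ln r) / p"
    have \<tau>: "(c * exp \<tau>) powr p = q * exp (- t)"
    proof -
      have "(c * exp \<tau>) powr p = r * exp (\<tau> * p)" using c by (simp add: powr_mult exp_powr_real)
      also have "\<tau> * p = ln q - t - ln r" using p by (simp add: \<tau>_def)
      also have "r * exp (ln q - t - ln r) = q * exp (- t)" using rq by (simp add: exp_diff exp_minus exp_add field_simps)
      finally show ?thesis .
    qed
    have powr_le: "x powr p \<le> y powr p \<longleftrightarrow> x \<le> y" if "0 \<le> x" "0 \<le> y" for x y :: real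
      using that p powr_less_mono2[of p y x] powr_mono2[of p x y] by fastforce
    have 1: "a z powr p \<le> r \<longleftrightarrow> a ((1 / c) *\<^sub>R z) \<le> 1" for z
      using powr_le[OF a0[of z], of c] c by (simp add: is_seminormD(2)[OF a] field_simps)
    have 2: "exp t * b z powr p \<le> q \<longleftrightarrow> b ((1 / c) *\<^sub>R z) \<le> exp \<tau>" for z
    proof -
      have "exp t * b z powr p \<le> q \<longleftrightarrow> b z powr p \<le> (c * exp \<tau>) powr p"
        unfolding \<tau> by (simp add: exp_minus field_simps)
      also have "\<dots> \<longleftrightarrow> b z \<le> c * exp \<tau>" using c by (intro powr_le b0) auto
      finally show ?thesis using c by (simp add: is_seminormD(2)[OF b] field_simps)
    qed
    have "H t r q = emeasure lborel {z. (1 / c) *\<^sub>R z \<in> {z. a z \<le> 1 \<and> b z \<le> exp \<tau>}}"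
      unfolding H_def 1 2 by simp
    also have "\<dots> = ennreal (c ^ DIM('a)) * m \<tau>"
      unfolding m_def by (rule emeasure_lborel_scale) (use c in measurable)
    finally show ?thesis by (simp add: c \<tau>_def)
  qed
  have H_mid: "H s r q * H t r' q' \<le> (H ((s + t) / 2) (sqrt (r * r')) (sqrt (q * q')))\<^sup>2"
    if pos: "0 < r" "0 < q" "0 < r'" "0 < q'" for r q r' q'
  proof -
    let ?\<sigma> = "(ln q - s - ln r) / p" and ?\<tau> = "(ln q' - t - ln r') / p"
    have e: "(ln (sqrt (q * q')) - (s + t) / 2 - ln (sqrt (r * r'))) / p = (?\<sigma> + ?\<tau>) / 2"
    proof -
      have "p \<noteq> 0" using p by simp
      then show ?thesis using pos by (simp add: ln_sqrt ln_mult) (simp add: field_simps)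
    qed
    have c: "(ennreal (sqrt (r * r') powr (real DIM('a) / p)))\<^sup>2 = ennreal (r powr (real DIM('a) / p)) * ennreal (r' powr (real DIM('a) / p))"
      using pos by (simp add: power2_eq_square real_sqrt_mult powr_mult flip: ennreal_mult)
        (simp add: mult_ac flip: powr_mult)
    have "H s r q * H t r' q' = (ennreal (sqrt (r * r') powr (real DIM('a) / p)))\<^sup>2 * (m ?\<sigma> * m ?\<tau>)"
      unfolding c using pos by (simp add: H_eq mult_ac)
    also have "\<dots> \<le> (ennreal (sqrt (r * r') powr (real DIM('a) / p)))\<^sup>2 * (m ((?\<sigma> + ?\<tau>) / 2))\<^sup>2"
      unfolding m_def by (intro mult_left_mono lev) auto
    also have "\<dots> = (H ((s + t) / 2) (sqrt (r * r')) (sqrt (q * q')))\<^sup>2"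
      using pos by (simp add: H_eq e power_mult_distrib)
    finally show ?thesis .
  qed
  \<comment> \<open>The multiplicative inequality demands vanishing off the positive half-line;
    there the set contains at most the origin, because both norms are definite.\<close>
  have H0: "H t r q = 0" if "r \<le> 0 \<or> q \<le> 0" for t r q
  proof -
    have "z = 0" if z: "a z powr p \<le> r" "exp t * b z powr p \<le> q" for z
    proof (rule ccontr)
      assume "z \<noteq> 0"
      then have "0 < a z" "0 < b z" by (auto intro: is_norm_pos[OF na] is_norm_pos[OF nb])
      then have "0 < a z powr p" "0 < exp t * b z powr p" by auto
      then show False using z \<open>r \<le> 0 \<or> q \<le> 0\<close> by linarith
    qed
    then have "{z. a z powr p \<le> r \<and> exp t * b z powr p \<le> q} \<subseteq> {0}" by auto
    then show ?thesis unfolding H_def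
      by (meson emeasure_lborel_countable finite.emptyI finite.insertI countable_finite countable_subset)
  qed
  let ?e = "\<lambda>r. ennreal (exp (- r))"
  have exp_mid: "?e r * ?e r' \<le> (?e (sqrt (r * r')))\<^sup>2" if "0 < r" "0 < r'" for r r' :: real
  proof -
    have "2 * sqrt (r * r') \<le> r + r'" using arith_geo_mean_sqrt[of r r'] that by simp
    then show ?thesis by (simp add: power2_eq_square flip: ennreal_mult exp_add)
  qed
  have H_meas [measurable]: "(\<lambda>(r, q). H t r q) \<in> borel_measurable (borel \<Otimes>\<^sub>M borel)" for t
  proof -
    have "(\<lambda>(w, z). indicator {z. a z powr p \<le> fst w \<and> exp t * b z powr p \<le> snd w} z :: ennreal) \<in> borel_measurable ((borel \<Otimes>\<^sub>M borel) \<Otimes>\<^sub>M lborel)"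
      unfolding indicator_def by measurable
    then have "(\<lambda>w. \<integral>\<^sup>+z. indicator {z. a z powr p \<le> fst w \<and> exp t * b z powr p \<le> snd w} z \<partial>lborel) \<in> borel_measurable (borel \<Otimes>\<^sub>M borel)"
      by (rule lborel.borel_measurable_nn_integral)
    moreover have "(\<integral>\<^sup>+z. indicator {z. a z powr p \<le> fst w \<and> exp t * b z powr p \<le> snd w} z \<partial>lborel) = H t (fst w) (snd w)" for w
      unfolding H_def by (rule nn_integral_indicator) measurable
    ultimately show ?thesis by (simp add: split_beta')
  qed
  have int: "(\<integral>\<^sup>+z. ennreal (exp (- lp_energy p a b t z)) \<partial>lborel) = (\<integral>\<^sup>+r. (\<integral>\<^sup>+q. ?e r * (?e q * H t r q) \<partial>lborel) \<partial>lborel)" for t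
  proof -
    let ?i = "\<lambda>z r. indicator {r. a z powr p \<le> r} r :: ennreal" and ?j = "\<lambda>z q. indicator {q. exp t * b z powr p \<le> q} q :: ennreal"
    have "(\<integral>\<^sup>+z. ennreal (exp (- lp_energy p a b t z)) \<partial>lborel)
      = (\<integral>\<^sup>+z. (\<integral>\<^sup>+r. (\<integral>\<^sup>+q. ?e r * ?i z r * (?e q * ?j z q) \<partial>lborel) \<partial>lborel) \<partial>lborel)"
    proof (rule nn_integral_cong)
      fix z
      have "ennreal (exp (- lp_energy p a b t z)) = ?e (a z powr p) * ?e (exp t * b z powr p)"
        by (simp add: lp_energy_def flip: ennreal_mult exp_add)
      also have "\<dots> = (\<integral>\<^sup>+r. ?e r * ?i z r \<partial>lborel) * (\<integral>\<^sup>+q. ?e q * ?j z q \<partial>lborel)"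
        by (simp add: exp_minus_eq_nn_integral atLeast_def)
      also have "\<dots> = (\<integral>\<^sup>+r. (\<integral>\<^sup>+q. ?e r * ?i z r * (?e q * ?j z q) \<partial>lborel) \<partial>lborel)"
        by (subst nn_integral_multc[symmetric]) (auto intro!: nn_integral_cong simp: nn_integral_cmult)
      finally show "ennreal (exp (- lp_energy p a b t z)) = (\<integral>\<^sup>+r. (\<integral>\<^sup>+q. ?e r * ?i z r * (?e q * ?j z q) \<partial>lborel) \<partial>lborel)" .
    qed
    also have "\<dots> = (\<integral>\<^sup>+r. (\<integral>\<^sup>+z. (\<integral>\<^sup>+q. ?e r * ?i z r * (?e q * ?j z q) \<partial>lborel) \<partial>lborel) \<partial>lborel)"
      by (rule lborel_pair.Fubini'[symmetric]) measurable
    also have "\<dots> = (\<integral>\<^sup>+r. (\<integral>\<^sup>+q. (\<integral>\<^sup>+z. ?e r * ?i z r * (?e q * ?j z q) \<partial>lborel) \<partial>lborel) \<partial>lborel)"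
      by (intro nn_integral_cong lborel_pair.Fubini'[symmetric]) measurable
    also have "\<dots> = (\<integral>\<^sup>+r. (\<integral>\<^sup>+q. ?e r * (?e q * H t r q) \<partial>lborel) \<partial>lborel)"
    proof (intro nn_integral_cong)
      fix r q :: real
      have "(\<integral>\<^sup>+z. ?e r * ?i z r * (?e q * ?j z q) \<partial>lborel)
        = (\<integral>\<^sup>+z. (?e r * ?e q) * indicator {z. a z powr p \<le> r \<and> exp t * b z powr p \<le> q} z \<partial>lborel)"
        by (intro nn_integral_cong) (auto simp: indicator_def)
      also have "\<dots> = (?e r * ?e q) * (\<integral>\<^sup>+z. indicator {z. a z powr p \<le> r \<and> exp t * b z powr p \<le> q} z \<partial>lborel)"
        by (rule nn_integral_cmult) measurable
      also have "(\<integral>\<^sup>+z. indicator {z. a z powr p \<le> r \<and> exp t * b z powr p \<le> q} z \<partial>lborel) = H t r q"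
        unfolding H_def by (rule nn_integral_indicator) measurable
      finally show "(\<integral>\<^sup>+z. ?e r * ?i z r * (?e q * ?j z q) \<partial>lborel) = ?e r * (?e q * H t r q)"
        by (simp add: mult.assoc)
    qed
    finally show ?thesis .
  qed
  show ?thesis
  proof (rule midpoint_volume_from_integral[OF p na b], unfold int,
      rule prekopa_leindlerD[OF prekopa_leindler_real_mult])
    fix r r' :: real assume r: "r \<in> {0<..}" "r' \<in> {0<..}"
    show "(\<integral>\<^sup>+q. ?e r * (?e q * H s r q) \<partial>lborel) * (\<integral>\<^sup>+q. ?e r' * (?e q * H t r' q) \<partial>lborel)
      \<le> (\<integral>\<^sup>+q. ?e (sqrt (r * r')) * (?e q * H ((s + t) / 2) (sqrt (r * r')) q) \<partial>lborel)\<^sup>2"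
    proof (rule prekopa_leindlerD[OF prekopa_leindler_real_mult])
      fix q q' :: real assume q: "q \<in> {0<..}" "q' \<in> {0<..}"
      have "(?e r * ?e r') * ((?e q * ?e q') * (H s r q * H t r' q'))
        \<le> (?e (sqrt (r * r')))\<^sup>2 * ((?e (sqrt (q * q')))\<^sup>2 * (H ((s + t) / 2) (sqrt (r * r')) (sqrt (q * q')))\<^sup>2)"
        using r q by (intro mult_mono exp_mid H_mid) auto
      then show "?e r * (?e q * H s r q) * (?e r' * (?e q' * H t r' q'))
        \<le> (?e (sqrt (r * r')) * (?e (sqrt (q * q')) * H ((s + t) / 2) (sqrt (r * r')) (sqrt (q * q'))))\<^sup>2"
        by (simp add: power_mult_distrib mult_ac)
    qed (auto simp: H0)
  qed (auto simp: H0)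
qed

lemma midpoint_volume_planar:
  fixes a b :: "real ^ 'n \<Rightarrow> real"
  assumes n: "CARD('n) = 2" and p: "p \<ge> 1" and a: "is_norm a" and b: "is_norm b"
  shows "emeasure lborel (lp_ball p a b s) * emeasure lborel (lp_ball p a b t)
    \<le> (emeasure lborel (lp_ball p a b ((s + t) / 2)))\<^sup>2"
proof -
  obtain i j :: 'n where ij: "i \<noteq> j" "UNIV = {i, j}"
    using n card_2_iff[of "UNIV :: 'n set"] by auto
  define f :: "plane \<Rightarrow> real ^ 'n" where "f z = fst z *\<^sub>R axis i 1 + snd z *\<^sub>R axis j 1" for z
  have lin: "linear f"
    by (rule linearI) (simp_all add: f_def scaleR_add_left scaleR_add_right)
  have fi: "f z $ i = fst z" "f z $ j = snd z" for z using ij(1) by (auto simp: f_def axis_def)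
  have "inj f" by (rule injI) (metis fi prod_eq_iff)
  moreover have "surj f"
  proof (rule surjI)
    fix x :: "real ^ 'n"
    have "f (x $ i, x $ j) $ k = x $ k" for k
    proof -
      have "k = i \<or> k = j" using ij(2) by auto
      then show ?thesis using fi[of "(x $ i, x $ j)"] by auto
    qed
    then show "f (x $ i, x $ j) = x" by (simp add: vec_eq_iff)
  qed
  ultimately have bij: "bij f" by (simp add: bij_def)
  have na: "is_norm (\<lambda>z. a (f z))" and nb: "is_norm (\<lambda>z. b (f z))"
    using \<open>inj f\<close> by (auto intro: is_norm_linear_image a b lin)
  let ?S = "\<lambda>t. {z. a (f z) \<le> 1 \<and> b (f z) \<le> exp t}"
  have V: "emeasure lborel (?S t) = ennreal (measure lborel (?S t))" for t
  proof -
    note [measurable] = seminorm_measurable[OF is_norm_seminorm[OF na]] seminorm_measurable[OF is_norm_seminorm[OF nb]]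
    have "?S t \<in> fmeasurable lborel" by (rule fmeasurableI2[OF norm_ball_fmeasurable[OF na, of 1]]) auto
    then show ?thesis by (simp add: emeasure_eq_measure2)
  qed
  show ?thesis
  proof (rule midpoint_volume_linear_image[OF lin bij p a is_norm_seminorm[OF b]],
      rule midpoint_volume_from_level_sets[OF p na nb])
    show "emeasure lborel (?S s) * emeasure lborel (?S t) \<le> (emeasure lborel (?S ((s + t) / 2)))\<^sup>2" for s t
      using planar_level_midpoint[OF na nb, of s t] unfolding V
      by (simp add: ennreal_power ennreal_leI flip: ennreal_mult)
  qed
qed

section \<open>Support functions in the four cases, and the conclusion\<close>

lemma support_fun_segment: "support_fun (closed_segment (- v) v) x = \<bar>x \<bullet> v\<bar>"
  unfolding support_fun_def
proof (rule cSup_eq_maximum)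
  have "x \<bullet> v \<in> (\<bullet>) x ` closed_segment (- v) v" "x \<bullet> (- v) \<in> (\<bullet>) x ` closed_segment (- v) v"
    by (auto simp del: inner_minus_right)
  then show "\<bar>x \<bullet> v\<bar> \<in> (\<bullet>) x ` closed_segment (- v) v" by (auto simp: abs_if)
  fix r assume "r \<in> (\<bullet>) x ` closed_segment (- v) v"
  then obtain u where u: "0 \<le> u" "u \<le> 1" and r: "r = x \<bullet> ((1 - u) *\<^sub>R (- v) + u *\<^sub>R v)"
    by (auto simp: closed_segment_def)
  have "r = (2 * u - 1) * (x \<bullet> v)" by (simp add: r inner_add_right algebra_simps)
  also have "\<dots> \<le> \<bar>2 * u - 1\<bar> * \<bar>x \<bullet> v\<bar>" by (metis abs_ge_self abs_mult)
  also have "\<dots> \<le> 1 * \<bar>x \<bullet> v\<bar>" using u by (intro mult_right_mono) auto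
  finally show "r \<le> \<bar>x \<bullet> v\<bar>" by simp
qed

lemma support_fun_cball: "support_fun (cball 0 1) x = norm (x :: 'a::euclidean_space)"
  unfolding support_fun_def
proof (rule cSup_eq_maximum)
  have "norm x = x \<bullet> ((1 / norm x) *\<^sub>R x)" by (simp add: dot_square_norm power2_eq_square)
  moreover have "(1 / norm x) *\<^sub>R x \<in> cball 0 1" by simp
  ultimately show "norm x \<in> (\<bullet>) x ` cball 0 1" by (rule image_eqI)
  fix r assume "r \<in> (\<bullet>) x ` cball 0 1"
  then obtain y where y: "norm y \<le> 1" "r = x \<bullet> y" by auto
  have "x \<bullet> y \<le> norm x * norm y" by (rule norm_cauchy_schwarz)
  also have "\<dots> \<le> norm x * 1" using y(1) by (intro mult_left_mono) auto
  finally show "r \<le> norm x" using y(2) by simp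
qed

lemma support_fun_unconditional:
  assumes "unconditional B K" "u \<in> B"
  shows "support_fun K (x - (2 * (x \<bullet> u)) *\<^sub>R u) = support_fun K x"
proof -
  let ?R = "\<lambda>x. x - (2 * (x \<bullet> u)) *\<^sub>R u"
  have "?R x \<bullet> y = x \<bullet> ?R y" for y
    by (simp add: inner_diff_left inner_diff_right inner_commute)
  then have "(\<lambda>y. ?R x \<bullet> y) ` K = (\<lambda>y. x \<bullet> y) ` ?R ` K" by (simp add: image_image)
  also have "?R ` K = K" using assms by (simp add: unconditional_def)
  finally show ?thesis by (simp add: support_fun_def)
qed

lemma unconditional_polar_body:
  assumes B: "orthonormal_basis B" and K: "unconditional B K"
  shows "unconditional B (polar_body K)"
  unfolding unconditional_def
proof
  fix u assume u: "u \<in> B"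
  let ?R = "\<lambda>x. x - (2 * (x \<bullet> u)) *\<^sub>R u"
  have "u \<bullet> u = 1" using B u by (simp add: orthonormal_basis_def dot_square_norm)
  then have inv: "?R (?R x) = x" for x by (simp add: inner_diff_left)
  have sub: "?R x \<in> polar_body K" if "x \<in> polar_body K" for x
    unfolding polar_body_def
  proof (intro CollectI ballI)
    fix y assume "y \<in> K"
    then have "?R y \<in> K" using K u unfolding unconditional_def by blast
    then have "x \<bullet> ?R y \<le> 1" using that unfolding polar_body_def by blast
    then show "?R x \<bullet> y \<le> 1" by (simp add: inner_diff_left inner_diff_right inner_commute mult_ac)
  qed
  show "?R ` polar_body K = polar_body K"
  proof
    show "?R ` polar_body K \<subseteq> polar_body K" using sub by blast
    show "polar_body K \<subseteq> ?R ` polar_body K"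
    proof
      fix x assume "x \<in> polar_body K"
      then show "x \<in> ?R ` polar_body K" by (intro image_eqI[of _ _ "?R x"]) (simp only: inv, rule sub)
    qed
  qed
qed

theorem corollary4p6:
  fixes p :: real and K L :: "(real ^ 'n) set"
  assumes "p \<ge> 1"
    and "convex_body K" and "origin_symmetric K"
    and "(convex_body L \<and> origin_symmetric L) \<or> symmetric_segment L"
    and "(p = 2 \<and> L = cball 0 1)
       \<or> symmetric_segment L
       \<or> (\<exists>B. orthonormal_basis B \<and> unconditional B K \<and> unconditional B L)
       \<or> CARD('n) = 2"
  shows "log_concave_fun
    (\<lambda>t::real. measure lebesgue (polar_body (Lp_sum p (polar_body K) (exp t) L)))"
proof -
  let ?a = "support_fun (polar_body K)" and ?b = "support_fun L"
  have a: "is_norm ?a" by (rule is_norm_support_fun_polar[OF assms(2,3)])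
  have conclude: ?thesis
    if b: "is_seminorm ?b"
      and mid: "\<And>s t. emeasure lborel (lp_ball p ?a ?b s) * emeasure lborel (lp_ball p ?a ?b t)
        \<le> (emeasure lborel (lp_ball p ?a ?b ((s + t) / 2)))\<^sup>2"
    using log_concave_fun_lp_ball[OF assms(1) a b mid] by (simp add: polar_body_Lp_sum[OF assms(1) a b])
  show ?thesis
  \<comment> \<open>Segments are split off first, whichever alternative holds: for them the support
    function is only a seminorm. In the remaining cases \<open>L\<close> is a body and its support
    function a norm.\<close>
  proof (cases "symmetric_segment L")
    case True
    then obtain v where "L = closed_segment (- v) v" by (auto simp: symmetric_segment_def)
    then have b: "?b = (\<lambda>x. \<bar>x \<bullet> v\<bar>)" by (auto simp: support_fun_segment)
    show ?thesis
    proof (rule conclude)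
      show "is_seminorm ?b" by (auto simp: b is_seminorm_def inner_add_left abs_mult)
    qed (unfold b, rule midpoint_volume_linear_functional[OF assms(1) a])
  next
    case False
    then have L: "convex_body L" "origin_symmetric L" using assms(4) by auto
    have nb: "is_norm ?b" by (rule is_norm_support_fun_body[OF L])
    note conclude = conclude[OF is_norm_seminorm[OF nb]]
    consider "p = 2" "L = cball 0 1" | B where "orthonormal_basis B" "unconditional B K" "unconditional B L" | "CARD('n) = 2"
      using assms(5) False by auto
    then show ?thesis
    proof cases
      case 1
      then have "?b = norm" by (auto simp: support_fun_cball)
      then show ?thesis using 1 by (intro conclude) (simp add: midpoint_volume_euclidean[OF a])
    next
      case 2
      then show ?thesis
        by (intro conclude midpoint_volume_unconditional[OF assms(1) a nb 2(1)]
            support_fun_unconditional unconditional_polar_body) auto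
    next
      case 3
      then show ?thesis by (intro conclude midpoint_volume_planar[OF _ assms(1) a nb])
    qed
  qed
qed

end
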